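(* Let $\mathcal C(\mathfrak g,k)$ be one of the following Verlinde categories: $SU(n+1)_k$ with $\gcd(n+1,k)\ne1$; $E_6(k)$ with $k\in3\mathbb Z$; $SO(2n+1)_k$ with any $k$; $Sp(2n)_k$ with $k\in2\mathbb Z$; $E_7(k)$ with $k\in2\mathbb Z$; $SO(2n)_k$ with $n=2s+1$ odd and $k\in2\mathbb Z$. The parameters $(a,b)\in\mathbb Z/m\times\mathbb Z/N$ and $\epsilon_a$ of the cyclic associative zestings $(\lambda_a,\omega_{a,b})$ (defined in the context), together with the pairs $(a,b)$ that admit a braided zesting structure (the pairs with $a\frac Nm\equiv\epsilon_a+2b \pmod N$), are given by the following table. (i) $SU(n+1)_k$: $m=\gcd(n+1,k)$, $N=n+1$. — $\epsilon_a=1$ if $\gcd(n+1,k)$ is even and $\frac{n+1}{\gcd(n+1,k)}$, $a$ and $\frac{k}{\gcd(n+1,k)}$ are odd; braided pairs: $a\frac{n+1}{\gcd(n+1,k)}\equiv1+2b\pmod{n+1}$. — $\epsilon_a=0$ else; braided pairs: $a\frac{n+1}{\gcd(n+1,k)}\equiv2b\pmod{n+1}$. (ii) $E_6(k)$: $m=3$, $N=3$, $\epsilon_a=0$; braided pairs $(0,0),(1,2),(2,1)$. (iii) $SO(2n+1)_k$: $m=2$, $N=2$. — $\epsilon_a=1$ if $k$ is odd; braided pairs $(1,0),(1,1)$. — $\epsilon_a=0$; braided pairs $(0,0)$. (iv) $Sp(2n)_k$: $m=2$, $N=2$. — $\epsilon_a=1$ if $n$ is odd; braided pairs $(1,0),(1,1)$.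 — $\epsilon_a=0$; braided pairs $(0,0)$. (v) $E_7(k)$: $m=2$, $N=2$. — $\epsilon_a=1$ if $k=2s$ with $s$ odd; braided pairs $(1,0),(1,1)$. — $\epsilon_a=0$; braided pairs $(0,0)$. (vi) $SO(2n)_k$, $n=2s+1$, $k\notin4\mathbb Z$: $m=2$, $N=4$, $\epsilon_a=0$; braided pairs $(0,0),(0,2),(1,1),(1,3)$. (vii) $SO(2n)_k$, $n=2s+1$, $k\in4\mathbb Z$: $m=4$, $N=4$. — $\epsilon_a=1$ if $k=4j$ with $j,a$ odd; braided pairs $(1,0),(1,2),(3,1),(3,3)$. — $\epsilon_a=0$ else; braided pairs $(0,0),(0,2),(2,1),(2,3)$.
   Context: Verlinde categories: for a simple Lie algebra $\mathfrak g$ and integer $k\ge1$, $\mathcal C(\mathfrak g,k)$ is the modular category obtained as the semisimplification of tilting modules of $U_{\mathsf q}(\mathfrak g)$ at $\mathsf q=e^{\pi i/(\ell(k+h^\vee))}$, where $h^\vee$ is the dual Coxeter number and $\ell=3$ for $G_2$, $\ell=2$ for $B_n,C_n,F_4$, $\ell=1$ otherwise. Its simple objects are the dominant weights $\lambda$ with $\langle\lambda,\Theta\rangle\le k$ ($\Theta$ the highest root, $\langle\ ,\ \rangle$ normalized so that long roots have square length 2), with twist $\theta_\lambda=\mathsf q^{\ell\langle\lambda,\lambda+2\rho\rangle}$. $SU(n+1)_k$, $SO(2n+1)_k$, $Sp(2n)_k$, $SO(2n)_k$, $E_6(k)$, $E_7(k)$ denote $\mathcal C(\mathfrak g,k)$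 for $\mathfrak g$ of type $A_n,B_n,C_n,D_n,E_6,E_7$. With $\lambda_i$ the fundamental weights, the group $A$ of invertible objects is, in these cases, cyclic with generator $g=k\lambda_1$ for $A_n,E_6,B_n$; $g=k\lambda_n$ for $C_n$ and for $D_n$ with $n$ odd; $g=k\lambda_7$ for $E_7$. The associated pre-metric group is $(A,q)$ with $q(x)=\theta_x$. Put $N=|A|$, $A_0=\{x\in A:q(xy)=q(x)q(y)\ \forall y\in A\}$, $m=|A_0|$, $h=g^{N/m}$ (a generator of $A_0$), and let $c:A_0\times A_0\to\{\pm1\}$ be the bicharacter with $c(x,y)=-1$ iff $q(x)=q(y)=-1$. Identify $\widehat A$ with $\mathbb Z/N$ by letting $j$ correspond to the character $g\mapsto\xi^j$, with $\xi=e^{2\pi\sqrt{-1}/N}$; represent elements by $0\le j<N$; fix $\zeta\in\mathbb C^*$ with $\zeta^2=\xi$. An associative zesting datum is a pair $(\lambda,\omega)\in Z^2(\widehat A,A_0)\times C^3(\widehat A,\mathbb C^* )$ with $d^3\omega(\chi_1,\chi_2,\chi_3,\chi_4)=c(\lambda(\chi_1,\chi_2),\lambda(\chi_3,\chi_4))$ (trivial action). A braided zesting datum is $(\lambda,\omega,t)$ with $(\lambda,\omega)$ an associative zesting datum, $\lambda$ symmetric, and $t\in C^2(\widehat A,\mathbb C^* )$ with $$\frac{\omega(\chi_1,\chi_2,\chi_3)\omega(\chi_2,\chi_3,\chi_1)}{\omega(\chi_2,\chi_1,\chi_3)}=\frac{t(\chi_1,\chi_2)t(\chi_1,\chi_3)}{t(\chi_1,\chi_2\chi_3)},$$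 $$\chi_3(\lambda(\chi_1,\chi_2))=\frac{\omega(\chi_1,\chi_2,\chi_3)\omega(\chi_3,\chi_1,\chi_2)}{\omega(\chi_1,\chi_3,\chi_2)}\cdot\frac{t(\chi_1,\chi_3)t(\chi_2,\chi_3)}{t(\chi_1\chi_2,\chi_3)}.$$ $(\lambda,\omega)$ admits a braided zesting structure if such a $t$ exists. Cyclic associative zestings: for $(a,b)$, $\epsilon_a=1$ if $q(h^a)=-1$ and $\epsilon_a=0$ if $q(h^a)=1$, and for $0\le i,j,l<N$ $$\lambda_a(i,j)=\begin{cases}1,&i+j<N\\ h^a,&i+j\ge N\end{cases}\qquad \omega_{a,b}(i,j,l)=\begin{cases}1,&i+j<N\\ \zeta^{\,l(\epsilon_a+2b)},&i+j\ge N.\end{cases}$$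
   Formalization: In (iii)–(v) the ε_a=0 braided pairs are corrected to (0,0),(0,1); in (iv) ε_a=1 needs n and k/2 both odd (Sp(2)_4 has ε_1=0). The category enters through its simple objects, twists and the Verlinde formula for the S-matrix; B_n is taken with n≥2. *)

theory Defs
  imports
    "HOL-Algebra.Elementary_Groups"
    "HOL-Number_Theory.Cong"
    "Jordan_Normal_Form.Determinant"
    Complex_Main
begin

section \<open>Root data\<close>

text \<open>Nodes are numbered from 1 as in Bourbaki; vectors are coordinate vectors with respect to the
  simple roots, so that coordinate \<open>i - 1\<close> belongs to node \<open>i\<close>.\<close>

datatype cartan_type =
  Type_A nat | Type_B nat | Type_C nat | Type_D nat | Type_E6 | Type_E7

fun rank :: "cartan_type \<Rightarrow> nat" where
  "rank (Type_A n) = n"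
| "rank (Type_B n) = n"
| "rank (Type_C n) = n"
| "rank (Type_D n) = n"
| "rank Type_E6 = 6"
| "rank Type_E7 = 7"

fun dynkin_edge :: "cartan_type \<Rightarrow> nat \<Rightarrow> nat \<Rightarrow> bool" where
  "dynkin_edge (Type_A n) i j \<longleftrightarrow> j = i + 1"
| "dynkin_edge (Type_B n) i j \<longleftrightarrow> j = i + 1"
| "dynkin_edge (Type_C n) i j \<longleftrightarrow> j = i + 1"
| "dynkin_edge (Type_D n) i j \<longleftrightarrow> (j = i + 1 \<and> j < n) \<or> (i + 2 = n \<and> j = n)"
| "dynkin_edge Type_E6 i j \<longleftrightarrow> (i, j) \<in> {(1,3), (3,4), (2,4), (4,5), (5,6)}"
| "dynkin_edge Type_E7 i j \<longleftrightarrow> (i, j) \<in> {(1,3), (3,4), (2,4), (4,5), (5,6), (6,7)}"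

fun root_sqlen :: "cartan_type \<Rightarrow> nat \<Rightarrow> real" where
  "root_sqlen (Type_B n) i = (if i = n then 1 else 2)"
| "root_sqlen (Type_C n) i = (if i = n then 2 else 1)"
| "root_sqlen _ i = 2"

text \<open>In a root system of finite type, adjacent simple roots satisfy
  \<open>\<langle>\<alpha>, \<beta>\<rangle> = - max \<langle>\<alpha>, \<alpha>\<rangle> \<langle>\<beta>, \<beta>\<rangle> / 2\<close>.\<close>

definition gram_entry :: "cartan_type \<Rightarrow> nat \<Rightarrow> nat \<Rightarrow> real" where
  "gram_entry X i j =
     (if i = j then root_sqlen X i
      else if dynkin_edge X i j \<or> dynkin_edge X j i
        then - max (root_sqlen X i) (root_sqlen X j) / 2
      else 0)"

definition gram :: "cartan_type \<Rightarrow> real mat" where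
  "gram X = mat (rank X) (rank X) (\<lambda>(i, j). gram_entry X (i + 1) (j + 1))"

definition kform :: "cartan_type \<Rightarrow> real vec \<Rightarrow> real vec \<Rightarrow> real" where
  "kform X x y = x \<bullet> (gram X *\<^sub>v y)"

definition simple_root :: "cartan_type \<Rightarrow> nat \<Rightarrow> real vec" where
  "simple_root X i = unit_vec (rank X) (i - 1)"

definition coroot_pairing :: "cartan_type \<Rightarrow> real vec \<Rightarrow> nat \<Rightarrow> real" where
  "coroot_pairing X x i =
     2 * kform X x (simple_root X i) / kform X (simple_root X i) (simple_root X i)"

definition fund_weight :: "cartan_type \<Rightarrow> nat \<Rightarrow> real vec" where
  "fund_weight X i =
     (THE x. x \<in> carrier_vec (rank X) \<and>
        (\<forall>j\<in>{1..rank X}. coroot_pairing X x j = (if j = i then 1 else 0)))"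

definition rho :: "cartan_type \<Rightarrow> real vec" where
  "rho X = (THE x. x \<in> carrier_vec (rank X) \<and> (\<forall>j\<in>{1..rank X}. coroot_pairing X x j = 1))"

fun highest_root_coeff :: "cartan_type \<Rightarrow> nat \<Rightarrow> real" where
  "highest_root_coeff (Type_A n) i = 1"
| "highest_root_coeff (Type_B n) i = (if i = 1 then 1 else 2)"
| "highest_root_coeff (Type_C n) i = (if i = n then 1 else 2)"
| "highest_root_coeff (Type_D n) i = (if i = 1 \<or> i + 1 = n \<or> i = n then 1 else 2)"
| "highest_root_coeff Type_E6 i = [1, 2, 2, 3, 2, 1] ! (i - 1)"
| "highest_root_coeff Type_E7 i = [2, 2, 3, 4, 3, 2, 1] ! (i - 1)"

definition highest_root :: "cartan_type \<Rightarrow> real vec" where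
  "highest_root X = vec (rank X) (\<lambda>i. highest_root_coeff X (i + 1))"

fun dual_coxeter :: "cartan_type \<Rightarrow> nat" where
  "dual_coxeter (Type_A n) = n + 1"
| "dual_coxeter (Type_B n) = 2 * n - 1"
| "dual_coxeter (Type_C n) = n + 1"
| "dual_coxeter (Type_D n) = 2 * n - 2"
| "dual_coxeter Type_E6 = 12"
| "dual_coxeter Type_E7 = 18"

fun lacing :: "cartan_type \<Rightarrow> nat" where
  "lacing (Type_B n) = 2"
| "lacing (Type_C n) = 2"
| "lacing _ = 1"

definition simple_reflection :: "cartan_type \<Rightarrow> nat \<Rightarrow> real mat" where
  "simple_reflection X i =
     mat (rank X) (rank X) (\<lambda>(p, q).
       (unit_vec (rank X) q
          - coroot_pairing X (unit_vec (rank X) q) i \<cdot>\<^sub>v simple_root X i) $ p)"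

inductive_set weyl :: "cartan_type \<Rightarrow> real mat set" for X :: cartan_type where
  one: "1\<^sub>m (rank X) \<in> weyl X"
| step: "w \<in> weyl X \<Longrightarrow> i \<in> {1..rank X} \<Longrightarrow> simple_reflection X i * w \<in> weyl X"


section \<open>The modular data of \<open>\<C>(\<gg>,k)\<close>\<close>

text \<open>\<open>qpow X k t\<close> is \<open>q\<^sup>t\<close> for \<open>q = exp (\<pi> i / (\<ell> (k + h\<^sup>\<or>)))\<close> and real \<open>t\<close>,
  understood as \<open>exp (\<pi> i t / (\<ell> (k + h\<^sup>\<or>)))\<close>.\<close>

definition qpow :: "cartan_type \<Rightarrow> nat \<Rightarrow> real \<Rightarrow> complex" where
  "qpow X k t = cis (pi * t / (real (lacing X) * real (k + dual_coxeter X)))"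

definition simples :: "cartan_type \<Rightarrow> nat \<Rightarrow> real vec set" where
  "simples X k =
     {x \<in> carrier_vec (rank X).
        (\<forall>i\<in>{1..rank X}. coroot_pairing X x i \<in> \<nat>) \<and> kform X x (highest_root X) \<le> real k}"

definition twist :: "cartan_type \<Rightarrow> nat \<Rightarrow> real vec \<Rightarrow> complex" where
  "twist X k x = qpow X k (real (lacing X) * kform X x (x + 2 \<cdot>\<^sub>v rho X))"

text \<open>The S-matrix, up to the common factor by which \<open>S\<^sub>0\<^sub>0\<close> is normalised to 1.\<close>

definition smatrix :: "cartan_type \<Rightarrow> nat \<Rightarrow> real vec \<Rightarrow> real vec \<Rightarrow> complex" where
  "smatrix X k x y =
     (\<Sum>w\<in>weyl X. complex_of_real (det w) *
        qpow X k (2 * real (lacing X) * kform X (w *\<^sub>v (x + rho X)) (y + rho X)))"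

text \<open>\<open>x \<otimes> y \<cong> z\<close> for simple objects. In a premodular category
  \<open>S\<^sub>x\<^sub>u S\<^sub>y\<^sub>u = S\<^sub>0\<^sub>u (\<Sum>z. N\<^sub>x\<^sub>y\<^sup>z S\<^sub>z\<^sub>u)\<close> for all simple \<open>u\<close>, and in a modular one, S being invertible,
  these equations determine the fusion coefficients \<open>N\<^sub>x\<^sub>y\<^sup>z\<close> (Verlinde formula). Both sides
  have degree 2 in S, so its normalisation is immaterial.\<close>

definition tensor_iso :: "cartan_type \<Rightarrow> nat \<Rightarrow> real vec \<Rightarrow> real vec \<Rightarrow> real vec \<Rightarrow> bool" where
  "tensor_iso X k x y z \<longleftrightarrow>
     (\<forall>u\<in>simples X k.
        smatrix X k x u * smatrix X k y u = smatrix X k (0\<^sub>v (rank X)) u * smatrix X k z u)"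

definition invertibles :: "cartan_type \<Rightarrow> nat \<Rightarrow> real vec set" where
  "invertibles X k =
     {x \<in> simples X k. \<exists>y\<in>simples X k. tensor_iso X k x y (0\<^sub>v (rank X))}"

text \<open>\<open>A\<close> is the group of (isomorphism classes of) invertible objects, under the tensor product.\<close>

definition is_invertible_group :: "cartan_type \<Rightarrow> nat \<Rightarrow> real vec monoid \<Rightarrow> bool" where
  "is_invertible_group X k A \<longleftrightarrow>
     group A \<and> carrier A = invertibles X k \<and> \<one>\<^bsub>A\<^esub> = 0\<^sub>v (rank X) \<and>
     (\<forall>x\<in>carrier A. \<forall>y\<in>carrier A. \<forall>z\<in>simples X k.
        tensor_iso X k x y z \<longleftrightarrow> z = x \<otimes>\<^bsub>A\<^esub> y)"

fun generator_node :: "cartan_type \<Rightarrow> nat" where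
  "generator_node (Type_A n) = 1"
| "generator_node (Type_B n) = 1"
| "generator_node (Type_C n) = n"
| "generator_node (Type_D n) = n"
| "generator_node Type_E6 = 1"
| "generator_node Type_E7 = 7"

definition generator :: "cartan_type \<Rightarrow> nat \<Rightarrow> real vec" where
  "generator X k = real k \<cdot>\<^sub>v fund_weight X (generator_node X)"

text \<open>The categories \<open>SU(n+1)\<^sub>k\<close>, \<open>SO(2n+1)\<^sub>k\<close>, \<open>Sp(2n)\<^sub>k\<close>, \<open>SO(2n)\<^sub>k\<close>, \<open>E\<^sub>6(k)\<close>, \<open>E\<^sub>7(k)\<close> under
  consideration. \<open>B\<^sub>1\<close> is excluded because it has no long roots to normalise the form by.\<close>

fun listed_category :: "cartan_type \<Rightarrow> nat \<Rightarrow> bool" where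
  "listed_category (Type_A n) k \<longleftrightarrow> n \<ge> 1 \<and> gcd (n + 1) k \<noteq> 1"
| "listed_category (Type_B n) k \<longleftrightarrow> n \<ge> 2"
| "listed_category (Type_C n) k \<longleftrightarrow> n \<ge> 1 \<and> even k"
| "listed_category (Type_D n) k \<longleftrightarrow> n \<ge> 3 \<and> odd n \<and> even k"
| "listed_category Type_E6 k \<longleftrightarrow> 3 dvd k"
| "listed_category Type_E7 k \<longleftrightarrow> even k"


section \<open>Zesting data for a pre-metric group \<open>(A, q)\<close>\<close>

definition radical :: "('a, 'm) monoid_scheme \<Rightarrow> ('a \<Rightarrow> complex) \<Rightarrow> 'a set" where
  "radical A q = {x \<in> carrier A. \<forall>y\<in>carrier A. q (x \<otimes>\<^bsub>A\<^esub> y) = q x * q y}"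

definition sign_bichar :: "('a \<Rightarrow> complex) \<Rightarrow> 'a \<Rightarrow> 'a \<Rightarrow> complex" where
  "sign_bichar q x y = (if q x = -1 \<and> q y = -1 then -1 else 1)"

text \<open>In the following three definitions \<open>D\<close> plays the role of the character group of \<open>A\<close> and
  \<open>ev \<chi> x\<close> that of \<open>\<chi>(x)\<close>.\<close>

definition two_cocycle ::
  "('b, 'n) monoid_scheme \<Rightarrow> ('a, 'm) monoid_scheme \<Rightarrow> 'a set \<Rightarrow> ('b \<Rightarrow> 'b \<Rightarrow> 'a) \<Rightarrow> bool" where
  "two_cocycle D A A0 lam \<longleftrightarrow>
     (\<forall>x\<in>carrier D. \<forall>y\<in>carrier D. lam x y \<in> A0) \<and>
     (\<forall>x\<in>carrier D. \<forall>y\<in>carrier D. \<forall>z\<in>carrier D.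
        lam x y \<otimes>\<^bsub>A\<^esub> lam (x \<otimes>\<^bsub>D\<^esub> y) z = lam y z \<otimes>\<^bsub>A\<^esub> lam x (y \<otimes>\<^bsub>D\<^esub> z))"

definition associative_zesting ::
  "('b, 'n) monoid_scheme \<Rightarrow> ('a, 'm) monoid_scheme \<Rightarrow> ('a \<Rightarrow> complex) \<Rightarrow>
   ('b \<Rightarrow> 'b \<Rightarrow> 'a) \<Rightarrow> ('b \<Rightarrow> 'b \<Rightarrow> 'b \<Rightarrow> complex) \<Rightarrow> bool" where
  "associative_zesting D A q lam om \<longleftrightarrow>
     two_cocycle D A (radical A q) lam \<and>
     (\<forall>x\<in>carrier D. \<forall>y\<in>carrier D. \<forall>z\<in>carrier D. om x y z \<noteq> 0) \<and>
     (\<forall>x\<in>carrier D. \<forall>y\<in>carrier D. \<forall>z\<in>carrier D. \<forall>w\<in>carrier D.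
        om y z w * om x (y \<otimes>\<^bsub>D\<^esub> z) w * om x y z
          / (om (x \<otimes>\<^bsub>D\<^esub> y) z w * om x y (z \<otimes>\<^bsub>D\<^esub> w))
        = sign_bichar q (lam x y) (lam z w))"

definition braided_zesting ::
  "('b, 'n) monoid_scheme \<Rightarrow> ('a, 'm) monoid_scheme \<Rightarrow> ('a \<Rightarrow> complex) \<Rightarrow>
   ('b \<Rightarrow> 'a \<Rightarrow> complex) \<Rightarrow>
   ('b \<Rightarrow> 'b \<Rightarrow> 'a) \<Rightarrow> ('b \<Rightarrow> 'b \<Rightarrow> 'b \<Rightarrow> complex) \<Rightarrow> ('b \<Rightarrow> 'b \<Rightarrow> complex) \<Rightarrow> bool" where
  "braided_zesting D A q ev lam om t \<longleftrightarrow>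
     associative_zesting D A q lam om \<and>
     (\<forall>x\<in>carrier D. \<forall>y\<in>carrier D. lam x y = lam y x) \<and>
     (\<forall>x\<in>carrier D. \<forall>y\<in>carrier D. t x y \<noteq> 0) \<and>
     (\<forall>x\<in>carrier D. \<forall>y\<in>carrier D. \<forall>z\<in>carrier D.
        om x y z * om y z x / om y x z = t x y * t x z / t x (y \<otimes>\<^bsub>D\<^esub> z)) \<and>
     (\<forall>x\<in>carrier D. \<forall>y\<in>carrier D. \<forall>z\<in>carrier D.
        ev z (lam x y)
        = om x y z * om z x y / om x z y * (t x z * t y z / t (x \<otimes>\<^bsub>D\<^esub> y) z))"


section \<open>Cyclic zestings\<close>

definition xi :: "('a, 'm) monoid_scheme \<Rightarrow> complex" where
  "xi A = cis (2 * pi / real (card (carrier A)))"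

text \<open>The value at \<open>x\<close> of the character of \<open>A = \<langle>g\<rangle>\<close> with \<open>g \<mapsto> \<xi>\<^sup>j\<close>.\<close>

definition cyc_char :: "('a, 'm) monoid_scheme \<Rightarrow> 'a \<Rightarrow> int \<Rightarrow> 'a \<Rightarrow> complex" where
  "cyc_char A g j x = (xi A powi j) ^ (LEAST i::nat. g [^]\<^bsub>A\<^esub> i = x)"

definition radical_gen :: "('a, 'm) monoid_scheme \<Rightarrow> ('a \<Rightarrow> complex) \<Rightarrow> 'a \<Rightarrow> 'a" where
  "radical_gen A q g = g [^]\<^bsub>A\<^esub> (card (carrier A) div card (radical A q))"

definition eps :: "('a, 'm) monoid_scheme \<Rightarrow> ('a \<Rightarrow> complex) \<Rightarrow> 'a \<Rightarrow> nat \<Rightarrow> nat" where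
  "eps A q g a = (if q (radical_gen A q g [^]\<^bsub>A\<^esub> a) = -1 then 1 else 0)"

definition cyc_lambda ::
  "('a, 'm) monoid_scheme \<Rightarrow> ('a \<Rightarrow> complex) \<Rightarrow> 'a \<Rightarrow> nat \<Rightarrow> int \<Rightarrow> int \<Rightarrow> 'a" where
  "cyc_lambda A q g a i j =
     (if i + j < int (card (carrier A)) then \<one>\<^bsub>A\<^esub> else radical_gen A q g [^]\<^bsub>A\<^esub> a)"

definition cyc_omega ::
  "('a, 'm) monoid_scheme \<Rightarrow> ('a \<Rightarrow> complex) \<Rightarrow> 'a \<Rightarrow> complex \<Rightarrow> nat \<Rightarrow> nat \<Rightarrow>
   int \<Rightarrow> int \<Rightarrow> int \<Rightarrow> complex" where
  "cyc_omega A q g \<zeta> a b i j l =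
     (if i + j < int (card (carrier A)) then 1 else \<zeta> powi (l * int (eps A q g a + 2 * b)))"

text \<open>The character group of \<open>A = \<langle>g\<rangle>\<close> is identified with the integers modulo \<open>|A|\<close>,
  realised on the representatives \<open>0 \<le> j < |A|\<close>.\<close>

definition cyc_braided ::
  "('a, 'm) monoid_scheme \<Rightarrow> ('a \<Rightarrow> complex) \<Rightarrow> 'a \<Rightarrow> complex \<Rightarrow> nat \<Rightarrow> nat \<Rightarrow> bool" where
  "cyc_braided A q g \<zeta> a b \<longleftrightarrow>
     (\<exists>t. braided_zesting (integer_mod_group (card (carrier A))) A q (cyc_char A g)
            (cyc_lambda A q g a) (cyc_omega A q g \<zeta> a b) t)"

end

theory Submission
  imports Defs "HOL-Combinatorics.Permutations"
begin

text \<open>The generator \<open>g = k \<lambda>\<^sub>c\<close> comes from a node \<open>c\<close> whose coefficient in \<open>\<Theta>\<close> is 1, and hence from a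
  symmetry \<open>J x = w x + k \<lambda>\<^sub>c\<close> of the level \<open>k\<close> alcove with \<open>w\<close> in the Weyl group and
  \<open>w \<rho> + h\<^sup>\<or> \<lambda>\<^sub>c = \<rho>\<close>. Substituting \<open>w\<close> in the alternating sum defining S gives
  \<open>S\<^bsub>J x, u\<^esub> = \<plusminus> exp (2 \<pi> i \<langle>\<lambda>\<^sub>c, u + \<rho>\<rangle>) S\<^bsub>x, u\<^esub>\<close> with a sign that does not depend on \<open>x\<close>. So the
  Verlinde equations hold for \<open>(g, x, J x)\<close>, and \<open>g\<^sup>j = J\<^sup>j 0\<close> is a weight \<open>k \<lambda>\<^sub>i\<close>. As \<open>J\<close> is an
  isometry up to a shift by \<open>\<rho>\<close>, the twists along the orbit satisfy a recursion, whose solution is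
  \<open>q (g\<^sup>j) = exp (\<pi> i K j (N - j) / N)\<close> for an integer \<open>K\<close> depending on the type. For this cyclic
  pre-metric group \<open>m = gcd N K\<close>, and \<open>\<epsilon>\<^sub>a\<close> and the solvability of the braiding equations are
  elementary.\<close>

section \<open>Zestings of a cyclic pre-metric group\<close>

text \<open>\<open>A\<close> is known only through its axioms: a simple object that satisfies the
  Verlinde equations for a pair of invertibles is their product. Exhibiting one solution therefore
  computes a product, and following the orbit of the unit object identifies the powers of
  \<open>g\<close> and their number \<open>N\<close>. The sign and the phase picked up by S occur
  once on each side of the Verlinde equation for \<open>g\<close> and \<open>g^j\<close>, so their
  values do not matter. The real work is to show that the linear map \<open>w\<close> lies in the
  Weyl group, which is defined as words in simple reflections. For the classical types the Weyl
  group is shown to contain enough signed permutations of orthogonal coordinates; for E6 and E7 an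
  explicit word is evaluated on the simple roots. The integer \<open>K\<close> encodes the norms of
  the weights in the orbit: q(k \<lambda>) = exp(\<pi> i k <\<lambda>, \<lambda>>) for each
  fundamental weight \<lambda> of the orbit, and \<open>K\<close> is chosen so that K j (N - j) / N
  agrees with k <\<lambda>, \<lambda>> modulo 2 at the j-th step. Only A, B, C, E6 and E7 give
  equality of the exponents; D gives a proper congruence.\<close>

lemma cis_2pi_eq_1_iff: "cis (2 * pi * x) = 1 \<longleftrightarrow> x \<in> \<int>"
proof
  assume "cis (2 * pi * x) = 1"
  then have "cos (2 * pi * x) = 1" by (metis cis.sel(1) one_complex.sel(1))
  then obtain n :: int where "2 * pi * x = of_int n * 2 * pi" by (auto simp: cos_one_2pi_int)
  then have "x = of_int n" by simp
  then show "x \<in> \<int>" by simp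
next
  assume "x \<in> \<int>"
  then show "cis (2 * pi * x) = 1" by (rule cis_multiple_2pi)
qed

lemma cis_pi_nat: "cis (pi * real n) = (- 1) ^ n"
  by (metis DeMoivre cis_pi mult.commute)

lemma exists_nth_root:
  fixes z :: complex
  assumes "n > 0"
  obtains w where "w ^ n = z"
proof
  have "rcis (root n (cmod z)) (Arg z / real n) ^ n = rcis (cmod z) (Arg z)"
    using assms by (simp add: DeMoivre2 real_root_pow_pos2)
  then show "rcis (root n (cmod z)) (Arg z / real n) ^ n = z" by (simp add: rcis_cmod_Arg)
qed

lemma dvd_iff_real_div_Ints:
  fixes a b :: nat
  assumes "a > 0"
  shows "a dvd b \<longleftrightarrow> real b / real a \<in> \<int>"
proof
  assume "real b / real a \<in> \<int>"
  then obtain z :: int where "real b / real a = of_int z" by (auto elim: Ints_cases)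
  then have "real b = of_int z * real a" using assms by (simp add: field_simps)
  then have "real_of_int (int b) = real_of_int (z * int a)" by simp
  then have "int b = z * int a" by (simp only: of_int_eq_iff)
  then have "int a dvd int b" by simp
  then show "a dvd b" by simp
next
  assume "a dvd b"
  then show "real b / real a \<in> \<int>" using assms by (auto elim!: dvdE)
qed

lemma dvd_mult_iff_div_gcd:
  fixes N K i :: nat
  assumes "N > 0"
  shows "N dvd K * i \<longleftrightarrow> N div gcd N K dvd i"
proof -
  define m where "m = gcd N K"
  have m: "m > 0" "m dvd N" "m dvd K" using assms by (auto simp: m_def)
  have N: "N = m * (N div m)" and K: "K = m * (K div m)" using m by auto
  have cop: "coprime (N div m) (K div m)" unfolding m_def using assms by (intro div_gcd_coprime) auto
  have "N dvd K * i \<longleftrightarrow> m * (N div m) dvd m * ((K div m) * i)" using N K by (metis mult.assoc)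
  also have "\<dots> \<longleftrightarrow> N div m dvd (K div m) * i" using m(1) by (rule nat_mult_dvd_cancel1)
  also have "\<dots> \<longleftrightarrow> N div m dvd i" using cop by (simp add: coprime_dvd_mult_right_iff)
  finally show ?thesis by (simp add: m_def)
qed

lemma multiples_lessThan:
  fixes d m :: nat
  assumes "d > 0"
  shows "{i. i < m * d \<and> d dvd i} = (\<lambda>t. d * t) ` {..<m}"
  using assms by (auto elim!: dvdE simp: mult.commute)

text \<open>The values of \<open>q\<close> are prescribed only for \<open>j < N\<close>, which is
  the range that an orbit of weights supplies. The shape j (N - j) makes \<open>q\<close> symmetric
  under inversion.\<close>

locale cyclic_premetric = group A for A (structure) +
  fixes g :: 'a and q :: "'a \<Rightarrow> complex" and N K :: nat
  assumes g_closed [simp]: "g \<in> carrier A"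
    and carrier_eq: "carrier A = (\<lambda>j. g [^] j) ` {..<N}"
    and inj_pow: "inj_on (\<lambda>j::nat. g [^] j) {..<N}"
    and pow_N: "g [^] N = \<one>"
    and N_ge_2: "N \<ge> 2"
    and q_pow_less: "\<And>j. j < N \<Longrightarrow> q (g [^] j) = cis (pi * real K * (real j * (real N - real j) / real N))"
begin

lemma card_carrier: "card (carrier A) = N"
  using carrier_eq inj_pow by (simp add: card_image)

lemma pow_add_mult_N: "g [^] (r + N * d) = g [^] r"
proof -
  have "g [^] (N * d) = \<one>" using pow_N by (simp flip: nat_pow_pow)
  then show ?thesis by (simp flip: nat_pow_mult)
qed

text \<open>Replacing j by j + N changes K j (N - j) / N by -2 K j, an even integer. With the
  formula valid for all j, exponents need no reduction modulo N afterwards.\<close>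

lemma q_pow: "q (g [^] j) = cis (pi * real K * (real j * (real N - real j) / real N))"
proof -
  have step: "cis (pi * real K * (real (j + N) * (real N - real (j + N)) / real N))
      = cis (pi * real K * (real j * (real N - real j) / real N))" for j
  proof -
    have "pi * real K * (real (j + N) * (real N - real (j + N)) / real N)
        = pi * real K * (real j * (real N - real j) / real N) + 2 * pi * (- real (K * j))"
      using N_ge_2 by (simp add: field_simps)
    then show ?thesis
      by (simp only: cis_mult[symmetric] cis_multiple_2pi Ints_minus Ints_of_nat mult_1_right)
  qed
  have "q (g [^] (r + N * d))
      = cis (pi * real K * (real (r + N * d) * (real N - real (r + N * d)) / real N))"
    if "r < N" for r d
  proof (induction d)
    case 0
    then show ?case using that q_pow_less by simp
  next
    case (Suc d)
    have "r + N * Suc d = (r + N * d) + N" by simp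
    moreover have "g [^] (r + N * Suc d) = g [^] (r + N * d)" by (simp only: pow_add_mult_N)
    ultimately show ?case using Suc step[of "r + N * d"] by (simp only: pow_add_mult_N)
  qed
  from this[of "j mod N" "j div N"] show ?thesis using N_ge_2 by simp
qed

lemma q_one [simp]: "q \<one> = 1"
  using q_pow[of 0] by simp

text \<open>The last factor is the bicharacter attached to the quadratic function \<open>q\<close>;
  on \<open>g\<close> it is exp(-2 \<pi> i K / N).\<close>

lemma q_pow_add:
  "q (g [^] (i + j)) = q (g [^] i) * q (g [^] j) * cis (2 * pi * (- (real (K * i * j) / real N)))"
proof -
  have "real (i + j) * (real N - real (i + j)) = 
     real i * (real N - real i) + real j * (real N - real j) - 2 * (real i * real j)"
    by (simp add: algebra_simps)
  then have "pi * real K * (real (i + j) * (real N - real (i + j)) / real N)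
      = pi * real K * (real i * (real N - real i) / real N) + pi * real K * (real j * (real N - real j) / real N)
        + 2 * pi * (- (real (K * i * j) / real N))"
    using N_ge_2 by (simp add: field_simps)
  then show ?thesis unfolding q_pow cis_mult by (rule arg_cong)
qed

lemma q_pow_nonzero: "q (g [^] (i::nat)) \<noteq> 0"
  by (simp add: q_pow)

text \<open>By \<open>q_pow_add\<close>, lying in the radical means that the bicharacter vanishes
  against every power of \<open>g\<close>, and j = 1 already decides this.\<close>

lemma pow_in_radical_iff: "g [^] i \<in> radical A q \<longleftrightarrow> N dvd K * i"
proof -
  have "g [^] i \<in> radical A q \<longleftrightarrow> (\<forall>x\<in>(\<lambda>j. g [^] j) ` {..<N}. q (g [^] i \<otimes> x) = q (g [^] i) * q x)"
    using nat_pow_closed[OF g_closed, of i] by (simp add: radical_def flip: carrier_eq)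
  also have "\<dots> \<longleftrightarrow> (\<forall>j<N. q (g [^] (i + j)) = q (g [^] i) * q (g [^] j))"
    by (auto simp: nat_pow_mult)
  also have "\<dots> \<longleftrightarrow> (\<forall>j<N. real (K * i * j) / real N \<in> \<int>)"
    unfolding q_pow_add
    by (simp only: mult_cancel_left2 mult_eq_0_iff q_pow_nonzero cis_2pi_eq_1_iff minus_in_Ints_iff simp_thms)
  also have "\<dots> \<longleftrightarrow> (\<forall>j<N. N dvd K * i * j)"
    using N_ge_2 by (simp only: dvd_iff_real_div_Ints)
  also have "\<dots> \<longleftrightarrow> N dvd K * i"
  proof
    assume "\<forall>j<N. N dvd K * i * j"
    then show "N dvd K * i" using N_ge_2 by (auto dest: spec[of _ 1])
  qed simp
  finally show ?thesis .
qed

lemma card_radical: "card (radical A q) = gcd N K"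
proof -
  define d where "d = N div gcd N K"
  have d: "d > 0" using N_ge_2 gcd_le1_nat[of N K] leD by (fastforce intro!: gr0I simp: d_def div_eq_0_iff)
  have Nd: "N = gcd N K * d" by (simp add: d_def)
  have "radical A q = (\<lambda>j. g [^] j) ` {i. i < N \<and> N dvd K * i}"
  proof (intro equalityI subsetI)
    fix x assume x: "x \<in> radical A q"
    then have "x \<in> carrier A" by (simp add: radical_def)
    then obtain i where "i < N" "x = g [^] i" using carrier_eq by auto
    then show "x \<in> (\<lambda>j. g [^] j) ` {i. i < N \<and> N dvd K * i}"
      using x pow_in_radical_iff by auto
  qed (auto simp: pow_in_radical_iff)
  also have "{i. i < N \<and> N dvd K * i} = {i. i < gcd N K * d \<and> d dvd i}"
    using dvd_mult_iff_div_gcd[of N K] N_ge_2 Nd d_def by auto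
  also have "\<dots> = (\<lambda>t. d * t) ` {..<gcd N K}" by (rule multiples_lessThan[OF d])
  finally have r: "radical A q = (\<lambda>j. g [^] j) ` (\<lambda>t. d * t) ` {..<gcd N K}" .
  have sub: "(\<lambda>t. d * t) ` {..<gcd N K} \<subseteq> {..<N}"
  proof (intro subsetI, elim imageE)
    fix x t assume "x = d * t" "t \<in> {..<gcd N K}"
    then have "x < d * gcd N K" using d by simp
    then show "x \<in> {..<N}" using Nd by (simp add: mult.commute)
  qed
  have "card (radical A q) = card ((\<lambda>t. d * t) ` {..<gcd N K})"
    unfolding r by (intro card_image inj_on_subset[OF inj_pow sub])
  also have "\<dots> = gcd N K" using d by (subst card_image) (auto simp: inj_on_def)
  finally show ?thesis .
qed

abbreviation m :: nat where "m \<equiv> gcd N K"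

lemma m_pos: "m > 0" using N_ge_2 by auto

lemma radical_gen_pow: "radical_gen A q g [^] a = g [^] (N div m * a)"
  by (simp add: radical_gen_def card_radical card_carrier nat_pow_pow)

lemma radical_gen_pow_in_radical: "radical_gen A q g [^] (a::nat) \<in> radical A q"
  using N_ge_2 dvd_mult_iff_div_gcd[of N K] by (simp add: radical_gen_pow pow_in_radical_iff)

text \<open>With N = m d and K = m e the denominator N cancels at the exponent d a, leaving the
  integer e d a (m - a). Hence \<open>q\<close> takes only the values 1 and -1 on the
  radical.\<close>

lemma q_radical_gen_pow:
  assumes "a \<le> m"
  shows "q (radical_gen A q g [^] a) = (- 1) ^ (K div m * (N div m) * a * (m - a))"
proof -
  define d where "d = N div m"
  define e where "e = K div m"
  have N: "real N = real m * real d" and K: "real K = real m * real e"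
    by (auto simp: d_def e_def simp flip: of_nat_mult)
  have pos: "real m > 0" "real d > 0" using m_pos N_ge_2 N by (auto intro: gr0I)
  have "real K * (real (d * a) * (real N - real (d * a)) / real N) = real (e * d * a * (m - a))"
    using pos(2) pos(1)[THEN less_imp_neq] assms unfolding N K of_nat_mult of_nat_diff[OF assms]
    by (simp add: field_simps)
  then show ?thesis
    by (simp only: radical_gen_pow q_pow d_def[symmetric] e_def[symmetric] mult.assoc cis_pi_nat)
qed

text \<open>The sign is -1 iff all four factors of the exponent are odd; a and m - a can both be odd
  only when m is even.\<close>

lemma eps_eq:
  assumes "a < m"
  shows "eps A q g a = (if even m \<and> odd (K div m) \<and> odd (N div m) \<and> odd a then 1 else 0)"
proof -
  have "(- 1 :: complex) ^ (K div m * (N div m) * a * (m - a)) = - 1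
      \<longleftrightarrow> odd (K div m * (N div m) * a * (m - a))"
    by (cases "even (K div m * (N div m) * a * (m - a))") auto
  also have "\<dots> \<longleftrightarrow> even m \<and> odd (K div m) \<and> odd (N div m) \<and> odd a"
    using assms by auto
  finally show ?thesis using assms by (simp add: eps_def q_radical_gen_pow)
qed


lemma xi_eq: "xi A = cis (2 * pi / real N)"
  by (simp add: xi_def card_carrier)

lemma xi_powi: "xi A powi n = cis (2 * pi * (real_of_int n / real N))"
  by (simp add: xi_eq cis_power_int field_simps)

lemma xi_powi_eq_1_iff: "xi A powi n = 1 \<longleftrightarrow> int N dvd n"
proof -
  have "real_of_int n / real N \<in> \<int> \<longleftrightarrow> int N dvd n"
  proof
    assume "real_of_int n / real N \<in> \<int>"
    then obtain z :: int where "real_of_int n / real N = of_int z" by (auto elim: Ints_cases)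
    then have "real_of_int n = of_int (z * int N)" using N_ge_2 by (simp add: field_simps)
    then have "n = z * int N" by (simp only: of_int_eq_iff)
    then show "int N dvd n" by simp
  next
    assume "int N dvd n"
    then obtain z where "n = int N * z" by (elim dvdE)
    then show "real_of_int n / real N \<in> \<int>" using N_ge_2 by simp
  qed
  then show ?thesis by (simp only: xi_powi cis_2pi_eq_1_iff)
qed

lemma cyc_char_pow:
  assumes "j < N"
  shows "cyc_char A g z (g [^] j) = xi A powi (z * int j)"
proof -
  have "(LEAST i::nat. g [^] i = g [^] j) = j"
  proof (rule Least_equality)
    fix i :: nat assume i: "g [^] i = g [^] j"
    show "j \<le> i"
    proof (rule ccontr)
      assume "\<not> j \<le> i"
      then have "i < N" "i \<noteq> j" using assms by auto
      then show False using inj_pow i assms by (auto simp: inj_on_def)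
    qed
  qed simp
  then show ?thesis by (simp add: cyc_char_def power_int_mult)
qed

lemma Nm_mult_less:
  assumes "a < m"
  shows "N div m * a < N"
proof -
  have "N div m > 0" using N_ge_2 gcd_le1_nat[of N K] leD by (fastforce intro!: gr0I simp: div_eq_0_iff)
  then have "N div m * a < N div m * m" using assms by (rule mult_strict_left_mono[rotated])
  also have "\<dots> = N" by simp
  finally show ?thesis .
qed

lemma sign_bichar_lambda:
  "sign_bichar q (cyc_lambda A q g a i j) (cyc_lambda A q g a k l)
     = (if int N \<le> i + j \<and> int N \<le> k + l \<and> eps A q g a = 1 then - 1 else 1)"
  by (auto simp: sign_bichar_def cyc_lambda_def eps_def card_carrier)

text \<open>The carry of addition on representatives modulo N. Both \<open>cyc_lambda\<close> and
  \<open>cyc_omega\<close> are powers with this exponent, so their cocycle identities become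
  identities between integers.\<close>

definition carry :: "int \<Rightarrow> int \<Rightarrow> int" where
  "carry i j = (if i + j < int N then 0 else 1)"

lemma mod_eq_carry:
  assumes "i \<in> {0..<int N}" "j \<in> {0..<int N}"
  shows "(i + j) mod int N = i + j - int N * carry i j"
proof (cases "i + j < int N")
  case True
  then show ?thesis using assms by (simp add: carry_def)
next
  case False
  then have "(i + j) mod int N = (i + j - int N) mod int N" by simp
  also have "\<dots> = i + j - int N" using False assms by (intro mod_pos_pos_trivial) auto
  finally show ?thesis using False by (simp add: carry_def)
qed

text \<open>Each side counts how often N is subtracted when i + j + k is reduced modulo N.\<close>

lemma carry_cocycle:
  assumes "i \<in> {0..<int N}" "j \<in> {0..<int N}" "k \<in> {0..<int N}"
  shows "carry j k + carry i ((j + k) mod int N) = carry i j + carry ((i + j) mod int N) k"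
proof -
  have r: "(x + y) mod int N \<in> {0..<int N}" for x y using N_ge_2 by simp
  have "(i + (j + k) mod int N) mod int N = ((i + j) mod int N + k) mod int N"
    by (simp add: mod_simps add.assoc)
  then have "i + (j + k - int N * carry j k) - int N * carry i ((j + k) mod int N)
      = (i + j - int N * carry i j) + k - int N * carry ((i + j) mod int N) k"
    unfolding mod_eq_carry[OF assms(1) r[of j k]] mod_eq_carry[OF r[of i j] assms(3)]
    using mod_eq_carry[OF assms(1,2)] mod_eq_carry[OF assms(2,3)] by simp
  then have "int N * (carry j k + carry i ((j + k) mod int N))
      = int N * (carry i j + carry ((i + j) mod int N) k)"
    by (simp add: algebra_simps)
  then show ?thesis using N_ge_2 by simp
qed

lemma two_cocycle_cyc_lambda:
  "two_cocycle (integer_mod_group N) A (radical A q) (cyc_lambda A q g a)"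
proof -
  have carr: "carrier (integer_mod_group N) = {0..<int N}"
    using N_ge_2 by (simp add: carrier_integer_mod_group)
  define h where "h = radical_gen A q g [^] a"
  have h: "h \<in> carrier A" "h \<in> radical A q" "\<one> \<in> radical A q"
    using radical_gen_pow_in_radical[of a] pow_in_radical_iff[of 0]
    by (auto simp: h_def radical_gen_pow)
  have lam: "cyc_lambda A q g a i j = h [^] nat (carry i j)" for i j
    using h by (simp add: cyc_lambda_def carry_def h_def card_carrier)
  have nonneg: "carry i j \<ge> 0" for i j by (simp add: carry_def)
  show ?thesis
    unfolding two_cocycle_def
  proof (intro conjI ballI)
    fix i j k
    assume "i \<in> carrier (integer_mod_group N)" "j \<in> carrier (integer_mod_group N)"
      "k \<in> carrier (integer_mod_group N)"
    then show "cyc_lambda A q g a i j \<otimes> cyc_lambda A q g a (i \<otimes>\<^bsub>integer_mod_group N\<^esub> j) k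
        = cyc_lambda A q g a j k \<otimes> cyc_lambda A q g a i (j \<otimes>\<^bsub>integer_mod_group N\<^esub> k)"
      using carry_cocycle[of i j k] h nonneg nat_add_distrib[OF nonneg nonneg, of i j "(i + j) mod int N" k]
        nat_add_distrib[OF nonneg nonneg, of j k i "(j + k) mod int N"]
      by (simp add: lam nat_pow_mult[OF h(1)] carr del: pow_nat)
  next
    fix i j
    show "cyc_lambda A q g a i j \<in> radical A q"
      using h by (simp add: cyc_lambda_def h_def)
  qed
qed

lemma cyc_lambda_sym: "cyc_lambda A q g a i j = cyc_lambda A q g a j i"
  by (simp add: cyc_lambda_def add.commute)

context
  fixes \<zeta> :: complex
  assumes zeta_sq: "\<zeta>\<^sup>2 = xi A"
begin

lemma zeta_nonzero [simp]: "\<zeta> \<noteq> 0"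
  using zeta_sq by (auto simp: xi_eq)

lemma zeta_powi_double: "\<zeta> powi (2 * n) = xi A powi n"
  using zeta_sq by (simp add: power_int_mult)

text \<open>In general zeta^N is only some square root of 1. But \<epsilon> = 1 forces m, hence N,
  to be even, and then zeta^N = xi^(N/2) = -1 for either choice of the square root zeta.\<close>

lemma zeta_powi_eps:
  assumes "a < m"
  shows "\<zeta> powi (int N * int (eps A q g a + 2 * b)) = (if eps A q g a = 1 then - 1 else 1)"
proof -
  have "int N * int (eps A q g a + 2 * b) = int N * int (eps A q g a) + 2 * (int N * int b)"
    by (simp add: algebra_simps)
  then have "\<zeta> powi (int N * int (eps A q g a + 2 * b)) = \<zeta> powi (int N * int (eps A q g a))"
    using xi_powi_eq_1_iff[of "int N * int b"] by (simp add: power_int_add zeta_powi_double)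
  also have "\<dots> = (if eps A q g a = 1 then - 1 else 1)"
  proof (cases "eps A q g a = 1")
    case True
    then have "even m" using eps_eq[OF assms] by presburger
    then have "even N" by (metis dvd_trans gcd_dvd1)
    then obtain d where d: "N = 2 * d" by (elim evenE)
    then have "real_of_int (int d) / real N = 1 / 2" using N_ge_2 by (simp add: field_simps)
    then show ?thesis using True zeta_powi_double[of "int d"] d
      by (simp only: xi_powi) simp
  next
    case False
    then have "eps A q g a = 0" by (simp add: eps_def split: if_splits)
    then show ?thesis by simp
  qed
  finally show ?thesis .
qed

lemma cyc_omega_carry:
  "cyc_omega A q g \<zeta> a b i j l = \<zeta> powi (l * int (eps A q g a + 2 * b) * carry i j)"
  by (simp add: cyc_omega_def carry_def card_carrier)

text \<open>The first two arguments of omega form the carry cocycle and contribute nothing to the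
  coboundary. What remains is the failure of l |-> zeta^(l s) to be multiplicative on
  representatives: reducing z + w leaves zeta^(N s), raised to the product of the carries of (x, y)
  and (z, w), which is the sign c.\<close>

lemma associative_zesting_cyclic:
  assumes "a < m"
  shows "associative_zesting (integer_mod_group N) A q (cyc_lambda A q g a) (cyc_omega A q g \<zeta> a b)"
  unfolding associative_zesting_def
proof (intro conjI ballI two_cocycle_cyc_lambda)
  have carr: "carrier (integer_mod_group N) = {0..<int N}"
    using N_ge_2 by (simp add: carrier_integer_mod_group)
  define s where "s = int (eps A q g a + 2 * b)"
  fix x y z w
  assume "x \<in> carrier (integer_mod_group N)" "y \<in> carrier (integer_mod_group N)"
    "z \<in> carrier (integer_mod_group N)" "w \<in> carrier (integer_mod_group N)"
  then have mem: "x \<in> {0..<int N}" "y \<in> {0..<int N}" "z \<in> {0..<int N}" "w \<in> {0..<int N}"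
    by (simp_all add: carr)
  define e where "e = w * s * carry y z + w * s * carry x ((y + z) mod int N) + z * s * carry x y
      - (w * s * carry ((x + y) mod int N) z + (z + w) mod int N * s * carry x y)"
  have "e = w * s * (carry y z + carry x ((y + z) mod int N) - carry ((x + y) mod int N) z)
      + (z - (z + w) mod int N) * s * carry x y"
    by (simp add: e_def algebra_simps)
  also have "\<dots> = w * s * carry x y + (z - (z + w - int N * carry z w)) * s * carry x y"
    using carry_cocycle[of x y z] mod_eq_carry[of z w] mem by (simp only: ) simp
  also have "\<dots> = int N * s * (carry x y * carry z w)" by (simp add: algebra_simps)
  finally have e: "e = int N * s * (carry x y * carry z w)" .
  have "cyc_omega A q g \<zeta> a b y z w * cyc_omega A q g \<zeta> a b x ((y + z) mod int N) w
        * cyc_omega A q g \<zeta> a b x y z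
        / (cyc_omega A q g \<zeta> a b ((x + y) mod int N) z w * cyc_omega A q g \<zeta> a b x y ((z + w) mod int N))
      = \<zeta> powi e"
    by (simp only: cyc_omega_carry e_def s_def[symmetric] power_int_add power_int_diff zeta_nonzero
        not_False_eq_True simp_thms)
  also have "\<dots> = (\<zeta> powi (int N * s)) powi (carry x y * carry z w)"
    by (simp add: e power_int_mult)
  also have "\<dots> = sign_bichar q (cyc_lambda A q g a x y) (cyc_lambda A q g a z w)"
    unfolding s_def zeta_powi_eps[OF assms] sign_bichar_lambda by (simp add: carry_def)
  finally show "cyc_omega A q g \<zeta> a b y z w
        * cyc_omega A q g \<zeta> a b x (y \<otimes>\<^bsub>integer_mod_group N\<^esub> z) w * cyc_omega A q g \<zeta> a b x y z
        / (cyc_omega A q g \<zeta> a b (x \<otimes>\<^bsub>integer_mod_group N\<^esub> y) z w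
           * cyc_omega A q g \<zeta> a b x y (z \<otimes>\<^bsub>integer_mod_group N\<^esub> w))
      = sign_bichar q (cyc_lambda A q g a x y) (cyc_lambda A q g a z w)"
    by (simp add: mult_integer_mod_group)
qed (simp add: cyc_omega_carry)

text \<open>The carry is symmetric, so two of the three factors cancel; the same happens in
  \<open>omega_quotient_2\<close>.\<close>

lemma omega_quotient_1:
  "cyc_omega A q g \<zeta> a b x y z * cyc_omega A q g \<zeta> a b y z x / cyc_omega A q g \<zeta> a b y x z
     = \<zeta> powi (x * int (eps A q g a + 2 * b) * carry y z)"
  by (simp add: cyc_omega_carry carry_def add.commute)

lemma omega_quotient_2:
  "cyc_omega A q g \<zeta> a b x y z * cyc_omega A q g \<zeta> a b z x y / cyc_omega A q g \<zeta> a b x z y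
     = \<zeta> powi (z * int (eps A q g a + 2 * b) * carry x y)"
  by (simp add: cyc_omega_carry carry_def add.commute)

lemma cyc_char_lambda:
  assumes "a < m"
  shows "cyc_char A g z (cyc_lambda A q g a x y) = \<zeta> powi (2 * (z * int (N div m * a)) * carry x y)"
  using cyc_char_pow[OF Nm_mult_less[OF assms], of z] cyc_char_pow[of 0 z] N_ge_2
  by (simp add: cyc_lambda_def carry_def card_carrier radical_gen_pow zeta_powi_double)

text \<open>The first braiding equation forces \<open>t(1,1)\<^sup>N = \<zeta>\<^sup>s\<close> and the second one
  \<open>t(1,1)\<^sup>N = \<zeta>\<^bsup>2aN/m - s\<^esup>\<close> with \<open>s = \<epsilon>\<^sub>a + 2b\<close>; conversely \<open>t(x,y) = \<tau>\<^bsup>xy\<^esup>\<close> is a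
  solution for every \<open>\<tau>\<close> satisfying both.\<close>

lemma cyc_braided_iff:
  assumes "a < m"
  shows "cyc_braided A q g \<zeta> a b \<longleftrightarrow> [a * (N div m) = eps A q g a + 2 * b] (mod N)"
proof -
  define s where "s = int (eps A q g a + 2 * b)"
  define r where "r = int (N div m * a)"
  have carr: "carrier (integer_mod_group N) = {0..<int N}"
    using N_ge_2 by (simp add: carrier_integer_mod_group)
  have cong: "[a * (N div m) = eps A q g a + 2 * b] (mod N) \<longleftrightarrow> \<zeta> powi (2 * (r - s)) = 1"
    unfolding zeta_powi_double xi_powi_eq_1_iff r_def s_def
    by (subst cong_int_iff[symmetric]) (simp add: cong_iff_dvd_diff mult.commute)
  have bz: "braided_zesting (integer_mod_group N) A q (cyc_char A g)
      (cyc_lambda A q g a) (cyc_omega A q g \<zeta> a b) t \<longleftrightarrow>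
      (\<forall>x\<in>{0..<int N}. \<forall>y\<in>{0..<int N}. t x y \<noteq> 0) \<and>
      (\<forall>x\<in>{0..<int N}. \<forall>y\<in>{0..<int N}. \<forall>z\<in>{0..<int N}.
         \<zeta> powi (x * s * carry y z) = t x y * t x z / t x ((y + z) mod int N)) \<and>
      (\<forall>x\<in>{0..<int N}. \<forall>y\<in>{0..<int N}. \<forall>z\<in>{0..<int N}.
         \<zeta> powi (2 * (z * r) * carry x y)
           = \<zeta> powi (z * s * carry x y) * (t x z * t y z / t ((x + y) mod int N) z))" for t
    unfolding braided_zesting_def omega_quotient_1 omega_quotient_2 cyc_char_lambda[OF assms] carr
      s_def[symmetric] r_def[symmetric]
    using associative_zesting_cyclic[OF assms, of b] cyc_lambda_sym
    by (simp add: mult_integer_mod_group)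
  have "\<zeta> powi (2 * (r - s)) = 1"
    if t0: "\<forall>x\<in>{0..<int N}. \<forall>y\<in>{0..<int N}. t x y \<noteq> 0"
      and t1: "\<forall>x\<in>{0..<int N}. \<forall>y\<in>{0..<int N}. \<forall>z\<in>{0..<int N}.
         \<zeta> powi (x * s * carry y z) = t x y * t x z / t x ((y + z) mod int N)"
      and t2: "\<forall>x\<in>{0..<int N}. \<forall>y\<in>{0..<int N}. \<forall>z\<in>{0..<int N}.
         \<zeta> powi (2 * (z * r) * carry x y)
           = \<zeta> powi (z * s * carry x y) * (t x z * t y z / t ((x + y) mod int N) z)"
    for t :: "int \<Rightarrow> int \<Rightarrow> complex"
  proof -
    have one: "(1::int) \<in> {0..<int N}" "(0::int) \<in> {0..<int N}" "int N - 1 \<in> {0..<int N}"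
      using N_ge_2 by auto
    \<comment> \<open>Normalisation of \<open>t\<close> at the trivial character comes from the
      equations themselves, at arguments without a carry.\<close>
    have "t 1 0 * t 1 0 / t 1 0 = 1" "t 0 1 * t 0 1 / t 0 1 = 1"
      using t1[rule_format, OF one(1) one(2) one(2)] t2[rule_format, OF one(2) one(2) one(1)] N_ge_2
      by (simp_all add: carry_def)
    then have t00: "t 1 0 = 1" "t 0 1 = 1" using t0 one by auto
    have "t 1 (int y) = t 1 1 ^ y \<and> t (int y) 1 = t 1 1 ^ y" if "y < N" for y
      using that
    proof (induction y)
      case 0
      then show ?case using t00 by simp
    next
      case (Suc y)
      then have y: "int y \<in> {0..<int N}" "(int y + 1) mod int N = int (Suc y)" "carry (int y) 1 = 0"
        by (auto simp: carry_def)
      have mem: "int (Suc y) \<in> {0..<int N}" using Suc.prems by auto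
      have "t 1 (int (Suc y)) = t 1 (int y) * t 1 1"
        using t1[rule_format, OF one(1) y(1) one(1)] t0 mem one y by (simp add: field_simps)
      moreover have "t (int (Suc y)) 1 = t (int y) 1 * t 1 1"
        using t2[rule_format, OF y(1) one(1) one(1)] t0 mem one y by (simp add: field_simps)
      ultimately show ?case using Suc by simp
    qed
    from this[of "N - 1"] have tN: "t 1 (int N - 1) = t 1 1 ^ (N - 1)" "t (int N - 1) 1 = t 1 1 ^ (N - 1)"
      using N_ge_2 by (simp_all add: of_nat_diff)
    have pow: "t 1 1 ^ N = t 1 1 ^ (N - 1) * t 1 1"
      using N_ge_2 by (metis One_nat_def Suc_pred gr0I not_numeral_le_zero power_Suc2)
    \<comment> \<open>The step from N - 1 to N is the first with a carry: there t(1,1)^N appears on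
      one side and a power of zeta on the other.\<close>
    have c: "carry (int N - 1) 1 = 1" by (simp add: carry_def)
    have "\<zeta> powi s = t 1 1 ^ N"
      using t1[rule_format, OF one(1) one(3) one(1)] t00 tN pow c by simp
    moreover have "\<zeta> powi (2 * r) = \<zeta> powi s * t 1 1 ^ N"
      using t2[rule_format, OF one(3) one(1) one(1)] t00 tN pow c by simp
    ultimately have "\<zeta> powi (2 * r) = \<zeta> powi s * \<zeta> powi s" by simp
    then have "\<zeta> powi (2 * r) = \<zeta> powi (2 * s)" by (simp flip: power_int_add)
    then show ?thesis by (simp add: right_diff_distrib power_int_diff)
  qed
  moreover have "\<exists>t. braided_zesting (integer_mod_group N) A q (cyc_char A g)
      (cyc_lambda A q g a) (cyc_omega A q g \<zeta> a b) t" if z: "\<zeta> powi (2 * (r - s)) = 1"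
  proof -
    have ne: "\<zeta> powi s \<noteq> 0" by simp
    \<comment> \<open>Any N-th root will do: the first equation is then satisfied, and
      \<open>rs\<close> makes the second one coincide with it.\<close>
    obtain \<tau> where \<tau>: "\<tau> ^ N = \<zeta> powi s"
      using exists_nth_root[of N] N_ge_2 by auto
    then have \<tau>0: "\<tau> \<noteq> 0" using ne N_ge_2 by (auto simp: power_0_left split: if_splits)
    have \<tau>N: "\<tau> powi (int N) = \<zeta> powi s" using \<tau> by simp
    have rs: "\<zeta> powi (2 * r) = \<zeta> powi s * \<zeta> powi s"
      using z by (simp add: right_diff_distrib power_int_diff flip: power_int_add)
    have q1: "\<tau> powi (x * y) * \<tau> powi (x * z) / \<tau> powi (x * ((y + z) mod int N))
        = \<zeta> powi (x * s * carry y z)" if "y \<in> {0..<int N}" "z \<in> {0..<int N}" for x y z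
    proof -
      have "\<tau> powi (x * y) * \<tau> powi (x * z) / \<tau> powi (x * ((y + z) mod int N))
          = \<tau> powi (int N * (x * carry y z))"
        using \<tau>0 by (simp add: mod_eq_carry[OF that] algebra_simps flip: power_int_add power_int_diff)
      also have "\<dots> = (\<zeta> powi s) powi (x * carry y z)" by (simp only: power_int_mult \<tau>N)
      also have "\<dots> = \<zeta> powi (x * s * carry y z)" by (simp add: mult_ac flip: power_int_mult)
      finally show ?thesis .
    qed
    have q2: "\<zeta> powi (2 * (z * r) * carry x y) = \<zeta> powi (z * s * carry x y) * \<zeta> powi (z * s * carry x y)"
      for x y z
    proof -
      have "\<zeta> powi (2 * (z * r) * carry x y) = (\<zeta> powi (2 * r)) powi (z * carry x y)"
        by (simp add: mult_ac flip: power_int_mult)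
      also have "\<dots> = \<zeta> powi (z * s * carry x y) * \<zeta> powi (z * s * carry x y)"
        unfolding rs by (simp add: power_int_mult_distrib mult_ac flip: power_int_mult)
      finally show ?thesis .
    qed
    show ?thesis
    proof (intro exI[of _ "\<lambda>x y. \<tau> powi (x * y)"] bz[THEN iffD2] conjI ballI)
      fix x y z assume "x \<in> {0..<int N}" "y \<in> {0..<int N}"
      then show "\<zeta> powi (2 * (z * r) * carry x y) = \<zeta> powi (z * s * carry x y)
          * (\<tau> powi (x * z) * \<tau> powi (y * z) / \<tau> powi ((x + y) mod int N * z))"
        unfolding q2 mult.commute[of _ z] by (subst q1) (simp_all add: mult_ac)
    qed (use \<tau>0 q1 in simp_all)
  qed
  ultimately show ?thesis
    unfolding cyc_braided_def card_carrier cong using bz by blast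
qed

end

end

section \<open>Weyl group symmetry of the S-matrix\<close>

lemma root_sqlen_cases: "root_sqlen X i = 1 \<or> root_sqlen X i = 2"
  by (cases X) auto

lemma root_sqlen_pos: "root_sqlen X i > 0"
  using root_sqlen_cases[of X i] by auto

lemma gram_entry_sym: "gram_entry X i j = gram_entry X j i"
  by (auto simp: gram_entry_def max.commute)

lemma simple_root_closed [simp]: "simple_root X i \<in> carrier_vec (rank X)"
  by (simp add: simple_root_def)

lemma kform_sum:
  assumes "x \<in> carrier_vec (rank X)" "y \<in> carrier_vec (rank X)"
  shows "kform X x y = (\<Sum>i<rank X. \<Sum>j<rank X. x $ i * gram_entry X (i + 1) (j + 1) * y $ j)"
  using assms
  by (auto simp: kform_def gram_def scalar_prod_def sum_distrib_left mult.assoc atLeast0LessThan intro!: sum.cong)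

lemma kform_sym:
  assumes "x \<in> carrier_vec (rank X)" "y \<in> carrier_vec (rank X)"
  shows "kform X x y = kform X y x"
  unfolding kform_sum[OF assms] kform_sum[OF assms(2,1)]
  by (subst sum.swap) (simp add: gram_entry_sym mult_ac)

lemma kform_add_left:
  assumes "x \<in> carrier_vec (rank X)" "y \<in> carrier_vec (rank X)" "z \<in> carrier_vec (rank X)"
  shows "kform X (x + y) z = kform X x z + kform X y z"
  using assms by (simp add: kform_sum sum.distrib algebra_simps)

lemma kform_smult_left:
  assumes "x \<in> carrier_vec (rank X)" "z \<in> carrier_vec (rank X)"
  shows "kform X (c \<cdot>\<^sub>v x) z = c * kform X x z"
  using assms by (simp add: kform_sum sum_distrib_left mult.assoc)

lemma kform_diff_left:
  assumes "x \<in> carrier_vec (rank X)" "y \<in> carrier_vec (rank X)" "z \<in> carrier_vec (rank X)"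
  shows "kform X (x - y) z = kform X x z - kform X y z"
  using assms by (simp add: kform_sum sum_subtractf algebra_simps)

lemma kform_add_right:
  assumes "x \<in> carrier_vec (rank X)" "y \<in> carrier_vec (rank X)" "z \<in> carrier_vec (rank X)"
  shows "kform X z (x + y) = kform X z x + kform X z y"
  using assms by (simp add: kform_sum sum.distrib algebra_simps)

lemma kform_smult_right:
  assumes "x \<in> carrier_vec (rank X)" "z \<in> carrier_vec (rank X)"
  shows "kform X z (c \<cdot>\<^sub>v x) = c * kform X z x"
  using assms by (simp add: kform_sum sum_distrib_left mult_ac)

lemma kform_diff_right:
  assumes "x \<in> carrier_vec (rank X)" "y \<in> carrier_vec (rank X)" "z \<in> carrier_vec (rank X)"
  shows "kform X z (x - y) = kform X z x - kform X z y"
  using assms by (simp add: kform_sum sum_subtractf algebra_simps)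

lemma kform_zero_left [simp]: "z \<in> carrier_vec (rank X) \<Longrightarrow> kform X (0\<^sub>v (rank X)) z = 0"
  by (simp add: kform_sum)

lemmas kform_linear = kform_add_left kform_smult_left kform_diff_left
  kform_add_right kform_smult_right kform_diff_right

lemma kform_simple_root:
  assumes "x \<in> carrier_vec (rank X)" "i \<in> {1..rank X}"
  shows "kform X x (simple_root X i) = (\<Sum>j<rank X. x $ j * gram_entry X (j + 1) i)"
proof -
  have "kform X x (simple_root X i)
      = (\<Sum>j<rank X. \<Sum>l<rank X. if l = i - 1 then x $ j * gram_entry X (j + 1) (l + 1) else 0)"
    using assms unfolding kform_sum[OF assms(1) simple_root_closed]
    by (intro sum.cong refl) (auto simp: simple_root_def unit_vec_def)
  also have "\<dots> = (\<Sum>j<rank X. x $ j * gram_entry X (j + 1) i)"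
    using assms by (auto intro!: sum.cong simp: sum.delta)
  finally show ?thesis .
qed

lemma kform_expand:
  assumes "x \<in> carrier_vec (rank X)" "y \<in> carrier_vec (rank X)"
  shows "kform X x y = (\<Sum>i<rank X. y $ i * kform X x (simple_root X (i + 1)))"
proof -
  have "kform X x y = (\<Sum>i<rank X. \<Sum>j<rank X. x $ j * gram_entry X (j + 1) (i + 1) * y $ i)"
    unfolding kform_sum[OF assms] by (rule sum.swap)
  also have "\<dots> = (\<Sum>i<rank X. y $ i * kform X x (simple_root X (i + 1)))"
    using assms by (auto simp: kform_simple_root sum_distrib_left mult_ac intro!: sum.cong)
  finally show ?thesis .
qed

lemma kform_simple_root_simple_root:
  assumes "i \<in> {1..rank X}" "j \<in> {1..rank X}"
  shows "kform X (simple_root X i) (simple_root X j) = gram_entry X i j"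
proof -
  have "kform X (simple_root X i) (simple_root X j)
      = (\<Sum>l<rank X. if l = i - 1 then gram_entry X (l + 1) j else 0)"
    unfolding kform_simple_root[OF simple_root_closed assms(2)]
    by (intro sum.cong refl) (auto simp: simple_root_def unit_vec_def)
  also have "\<dots> = gram_entry X i j" using assms by (auto simp: sum.delta)
  finally show ?thesis .
qed

lemma kform_simple_root_self:
  "i \<in> {1..rank X} \<Longrightarrow> kform X (simple_root X i) (simple_root X i) = root_sqlen X i"
  by (simp add: kform_simple_root_simple_root gram_entry_def)

lemma coroot_pairing_eq:
  "i \<in> {1..rank X} \<Longrightarrow> coroot_pairing X x i = 2 * kform X x (simple_root X i) / root_sqlen X i"
  by (simp add: coroot_pairing_def kform_simple_root_self)

lemma kform_eq_coroot_pairing: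
  "i \<in> {1..rank X} \<Longrightarrow> kform X x (simple_root X i) = coroot_pairing X x i * root_sqlen X i / 2"
  using root_sqlen_pos[of X i] by (simp add: coroot_pairing_eq)

lemma coroot_pairing_add_diff:
  assumes "x \<in> carrier_vec (rank X)" "y \<in> carrier_vec (rank X)" "i \<in> {1..rank X}"
  shows "coroot_pairing X (x + y) i = coroot_pairing X x i + coroot_pairing X y i"
    "coroot_pairing X (x - y) i = coroot_pairing X x i - coroot_pairing X y i"
  using assms by (simp_all add: coroot_pairing_eq kform_linear add_divide_distrib diff_divide_distrib)

lemma coroot_pairing_smult:
  assumes "x \<in> carrier_vec (rank X)" "i \<in> {1..rank X}"
  shows "coroot_pairing X (c \<cdot>\<^sub>v x) i = c * coroot_pairing X x i"
  using assms by (simp add: coroot_pairing_eq kform_smult_left)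

lemma coroot_pairing_zero: "i \<in> {1..rank X} \<Longrightarrow> coroot_pairing X (0\<^sub>v (rank X)) i = 0"
  by (simp add: coroot_pairing_eq)

text \<open>Off the diagonal an entry is 0 or -max / length with squared lengths 1 and 2, hence 0,
  -1 or -2.\<close>

lemma cartan_integer:
  "2 * gram_entry X i j / root_sqlen X i \<in> \<int>"
  using root_sqlen_cases[of X i] root_sqlen_cases[of X j] by (auto simp: gram_entry_def max_def)

section \<open>Simple reflections and the group they generate\<close>

lemma simple_reflection_closed [simp]: "simple_reflection X i \<in> carrier_mat (rank X) (rank X)"
  by (simp add: simple_reflection_def)

lemma simple_reflection_mult:
  assumes "x \<in> carrier_vec (rank X)" "i \<in> {1..rank X}"
  shows "simple_reflection X i *\<^sub>v x = x - coroot_pairing X x i \<cdot>\<^sub>v simple_root X i"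
proof (rule eq_vecI)
  fix a assume "a < dim_vec (x - coroot_pairing X x i \<cdot>\<^sub>v simple_root X i)"
  then have a: "a < rank X" by (simp add: simple_root_def)
  have unit: "unit_vec (rank X) l = simple_root X (l + 1)" for l by (simp add: simple_root_def)
  have "(simple_reflection X i *\<^sub>v x) $ a = (\<Sum>l<rank X. (unit_vec (rank X) l
          - coroot_pairing X (unit_vec (rank X) l) i \<cdot>\<^sub>v simple_root X i) $ a * x $ l)"
    using a assms by (auto simp: simple_reflection_def scalar_prod_def atLeast0LessThan intro!: sum.cong)
  also have "\<dots> = (\<Sum>l<rank X. (if l = a then x $ l else 0))
      - (\<Sum>l<rank X. x $ l * coroot_pairing X (simple_root X (l + 1)) i) * simple_root X i $ a"
    unfolding sum_distrib_right sum_subtractf[symmetric] unit[symmetric]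
    using a by (intro sum.cong) (auto simp: simple_root_def algebra_simps)
  also have "(\<Sum>l<rank X. (if l = a then x $ l else 0)) = x $ a" using a by simp
  also have "(\<Sum>l<rank X. x $ l * coroot_pairing X (simple_root X (l + 1)) i) = coroot_pairing X x i"
    using assms kform_expand[of "simple_root X i" X x] kform_sym[of "simple_root X i" X]
    by (simp add: coroot_pairing_eq sum_divide_distrib sum_distrib_left mult_ac)
  finally show "(simple_reflection X i *\<^sub>v x) $ a = (x - coroot_pairing X x i \<cdot>\<^sub>v simple_root X i) $ a"
    using a assms by (simp add: simple_root_def)
qed (use assms in \<open>simp add: simple_reflection_def simple_root_def\<close>)

lemma mat_eq_of_mult_vec:
  fixes A B :: "'a :: comm_ring_1 mat"
  assumes "A \<in> carrier_mat n n" "B \<in> carrier_mat n n"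
    and "\<And>x. x \<in> carrier_vec n \<Longrightarrow> A *\<^sub>v x = B *\<^sub>v x"
  shows "A = B"
proof (rule eq_matI)
  fix i j assume ij: "i < dim_row B" "j < dim_col B"
  then have "(A *\<^sub>v unit_vec n j) $ i = (B *\<^sub>v unit_vec n j) $ i" using assms(3) assms(2) by auto
  then show "A $$ (i, j) = B $$ (i, j)" using ij assms(1,2) by simp
qed (use assms in auto)

lemma simple_reflection_involution:
  assumes i: "i \<in> {1..rank X}"
  shows "simple_reflection X i * simple_reflection X i = 1\<^sub>m (rank X)"
proof (rule mat_eq_of_mult_vec)
  fix x :: "real vec" assume x: "x \<in> carrier_vec (rank X)"
  have p: "coroot_pairing X (simple_root X i) i = 2"
    using i root_sqlen_pos[of X i] by (simp add: coroot_pairing_eq kform_simple_root_self)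
  have "(simple_reflection X i * simple_reflection X i) *\<^sub>v x
      = simple_reflection X i *\<^sub>v (x - coroot_pairing X x i \<cdot>\<^sub>v simple_root X i)"
    using x i by (subst assoc_mult_mat_vec[OF simple_reflection_closed simple_reflection_closed])
      (simp_all add: simple_reflection_mult)
  also have "\<dots> = 1\<^sub>m (rank X) *\<^sub>v x"
    using x i p by (intro eq_vecI)
      (auto simp: simple_reflection_mult coroot_pairing_add_diff coroot_pairing_smult simple_root_def[of X i] simp flip: simple_root_def)
  finally show "(simple_reflection X i * simple_reflection X i) *\<^sub>v x = 1\<^sub>m (rank X) *\<^sub>v x" .
qed (auto intro!: mult_carrier_mat[OF simple_reflection_closed])

lemma weyl_closed: "w \<in> weyl X \<Longrightarrow> w \<in> carrier_mat (rank X) (rank X)"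
  by (induction rule: weyl.induct) (auto intro!: mult_carrier_mat[OF simple_reflection_closed])

lemma weyl_mult:
  assumes "w \<in> weyl X" "v \<in> weyl X"
  shows "w * v \<in> weyl X"
  using assms
proof (induction rule: weyl.induct)
  case one
  then show ?case using left_mult_one_mat[OF weyl_closed] by simp
next
  case (step w i)
  then show ?case
    using weyl.step[of "w * v" X i] weyl_closed assoc_mult_mat[of _ "rank X" "rank X" w "rank X" v "rank X"]
    by simp
qed

lemma simple_reflection_weyl: "i \<in> {1..rank X} \<Longrightarrow> simple_reflection X i \<in> weyl X"
  using weyl.step[OF weyl.one, of i X] right_mult_one_mat[OF simple_reflection_closed] by simp

lemma weyl_inverse:
  assumes "w \<in> weyl X"
  obtains v where "v \<in> weyl X" "w * v = 1\<^sub>m (rank X)" "v * w = 1\<^sub>m (rank X)"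
  using assms
proof (induction arbitrary: thesis rule: weyl.induct)
  case one
  then show ?case using weyl.one[of X] by simp
next
  case (step w i)
  obtain v where v: "v \<in> weyl X" "w * v = 1\<^sub>m (rank X)" "v * w = 1\<^sub>m (rank X)"
    using step.IH by blast
  let ?n = "rank X" and ?s = "simple_reflection X i"
  have c: "w \<in> carrier_mat ?n ?n" "v \<in> carrier_mat ?n ?n" "?s \<in> carrier_mat ?n ?n"
    using weyl_closed step v by auto
  have "(?s * w) * (v * ?s) = ?s * (w * v) * ?s"
    using c by (smt (verit) assoc_mult_mat mult_carrier_mat)
  then have 1: "(?s * w) * (v * ?s) = 1\<^sub>m ?n"
    using v c simple_reflection_involution step by simp
  have "(v * ?s) * (?s * w) = v * (?s * ?s) * w"
    using c by (smt (verit) assoc_mult_mat mult_carrier_mat)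
  then have 2: "(v * ?s) * (?s * w) = 1\<^sub>m ?n"
    using v c simple_reflection_involution step by simp
  show ?case using step.prems[OF weyl_mult[OF v(1) simple_reflection_weyl] 1 2] step by simp
qed

text \<open>This permits the substitution of w v for w in the sum that defines the S-matrix.\<close>

lemma weyl_mult_bij:
  assumes "v \<in> weyl X"
  shows "bij_betw (\<lambda>w. w * v) (weyl X) (weyl X)"
proof -
  obtain v' where v': "v' \<in> weyl X" "v * v' = 1\<^sub>m (rank X)" "v' * v = 1\<^sub>m (rank X)"
    using weyl_inverse[OF assms] by blast
  have "w * v * v' = w" "w * v' * v = w" if "w \<in> weyl X" for w
    using assoc_mult_mat[OF weyl_closed[OF that] weyl_closed weyl_closed] v' assms
      right_mult_one_mat[OF weyl_closed[OF that]] by auto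
  then show ?thesis
    using weyl_mult assms v'(1) by (intro bij_betw_byWitness[where f' = "\<lambda>w. w * v'"]) auto
qed

lemma kform_simple_reflection:
  assumes "x \<in> carrier_vec (rank X)" "y \<in> carrier_vec (rank X)" "i \<in> {1..rank X}"
  shows "kform X (simple_reflection X i *\<^sub>v x) (simple_reflection X i *\<^sub>v y) = kform X x y"
  using assms kform_sym[of "simple_root X i" X y] root_sqlen_pos[of X i]
  by (simp add: simple_reflection_mult kform_linear kform_simple_root_self coroot_pairing_eq field_simps)

lemma weyl_step_mult_vec:
  assumes "w \<in> weyl X" "x \<in> carrier_vec (rank X)"
  shows "(simple_reflection X i * w) *\<^sub>v x = simple_reflection X i *\<^sub>v (w *\<^sub>v x)"
  by (intro assoc_mult_mat_vec[OF simple_reflection_closed weyl_closed] assms)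

lemma weyl_mult_vec_closed [simp]:
  "w \<in> weyl X \<Longrightarrow> x \<in> carrier_vec (rank X) \<Longrightarrow> w *\<^sub>v x \<in> carrier_vec (rank X)"
  using weyl_closed mult_mat_vec_carrier by blast

lemma kform_weyl:
  assumes "w \<in> weyl X" "x \<in> carrier_vec (rank X)" "y \<in> carrier_vec (rank X)"
  shows "kform X (w *\<^sub>v x) (w *\<^sub>v y) = kform X x y"
  using assms
  by (induction rule: weyl.induct) (simp_all add: weyl_step_mult_vec kform_simple_reflection)

text \<open>\<open>W\<close> moves a coweight \<open>\<omega>\<close> only by elements of the coroot lattice.\<close>

lemma weyl_coweight:
  assumes "w \<in> weyl X" "\<omega> \<in> carrier_vec (rank X)"
    and "\<forall>j\<in>{1..rank X}. kform X \<omega> (simple_root X j) \<in> \<int>"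
    and "u \<in> carrier_vec (rank X)" "\<forall>i\<in>{1..rank X}. coroot_pairing X u i \<in> \<int>"
  shows "(\<forall>j\<in>{1..rank X}. kform X (w *\<^sub>v \<omega>) (simple_root X j) \<in> \<int>)
    \<and> kform X (w *\<^sub>v \<omega>) u - kform X \<omega> u \<in> \<int>"
  using assms
proof (induction rule: weyl.induct)
  case (step w i)
  let ?v = "w *\<^sub>v \<omega>"
  have v: "?v \<in> carrier_vec (rank X)" using step by simp
  have IH: "\<forall>j\<in>{1..rank X}. kform X ?v (simple_root X j) \<in> \<int>" "kform X ?v u - kform X \<omega> u \<in> \<int>"
    using step by auto
  \<comment> \<open>Both quantities change by the integer
    \<open>kform X ?v (simple_root X i)\<close> times another integer: a Cartan integer in the first
    claim, a coroot pairing of \<open>u\<close> in the second. Hence the two claims are carried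
    through the induction together.\<close>
  have eq: "(simple_reflection X i * w) *\<^sub>v \<omega> = ?v - coroot_pairing X ?v i \<cdot>\<^sub>v simple_root X i"
    using step v by (simp add: weyl_step_mult_vec simple_reflection_mult)
  show ?case
  proof (intro conjI ballI)
    fix j assume j: "j \<in> {1..rank X}"
    have "kform X ((simple_reflection X i * w) *\<^sub>v \<omega>) (simple_root X j)
        = kform X ?v (simple_root X j) - kform X ?v (simple_root X i) * (2 * gram_entry X i j / root_sqlen X i)"
      unfolding eq using v j step by (simp add: kform_linear kform_simple_root_simple_root coroot_pairing_eq)
    then show "kform X ((simple_reflection X i * w) *\<^sub>v \<omega>) (simple_root X j) \<in> \<int>"
      using IH(1) j step(2) cartan_integer[of X i j] by (simp only: Ints_diff Ints_mult)
  next
    have "kform X ((simple_reflection X i * w) *\<^sub>v \<omega>) u - kform X \<omega> u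
        = (kform X ?v u - kform X \<omega> u) - kform X ?v (simple_root X i) * coroot_pairing X u i"
      unfolding eq using v step kform_sym[of "simple_root X i" X u]
      by (simp add: kform_linear coroot_pairing_eq)
    then show "kform X ((simple_reflection X i * w) *\<^sub>v \<omega>) u - kform X \<omega> u \<in> \<int>"
      using IH step(2) \<open>\<forall>i\<in>{1..rank X}. coroot_pairing X u i \<in> \<int>\<close> by (simp only: Ints_diff Ints_mult)
  qed
qed simp

lemma qpow_add: "qpow X k (s + t) = qpow X k s * qpow X k t"
  by (simp add: qpow_def cis_mult distrib_left add_divide_distrib)

lemma lacing_pos: "lacing X > 0"
  by (cases X) auto

text \<open>The factor \<open>det v'\<close> comes from det w = det (w v) det v'. The translation
  contributes \<open>qpow\<close> at a multiple of k + h, where the denominator cancels and leaves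
  exp(2 \<pi> i <w \<omega>, u + \<rho>>); by \<open>weyl_coweight\<close> the w inside changes this
  only by an integer multiple of 2 \<pi>, so the phase leaves the sum.\<close>

lemma smatrix_shift:
  assumes kh: "k + dual_coxeter X > 0" and v: "v \<in> weyl X" "v' \<in> weyl X" "v * v' = 1\<^sub>m (rank X)"
    and \<omega>: "\<omega> \<in> carrier_vec (rank X)" "\<forall>j\<in>{1..rank X}. kform X \<omega> (simple_root X j) \<in> \<int>"
    and u: "u + rho X \<in> carrier_vec (rank X)" "\<forall>i\<in>{1..rank X}. coroot_pairing X (u + rho X) i \<in> \<int>"
    and x: "x + rho X \<in> carrier_vec (rank X)"
    and y: "y + rho X = v *\<^sub>v (x + rho X) + real (k + dual_coxeter X) \<cdot>\<^sub>v \<omega>"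
  shows "smatrix X k y u
    = complex_of_real (det v') * cis (2 * pi * kform X \<omega> (u + rho X)) * smatrix X k x u"
proof -
  define \<kappa> where "\<kappa> = real (k + dual_coxeter X)"
  define S where "S w = complex_of_real (det w) * qpow X k (2 * real (lacing X) * kform X (w *\<^sub>v (x + rho X)) (u + rho X))" for w
  have "complex_of_real (det w) * qpow X k (2 * real (lacing X) * kform X (w *\<^sub>v (y + rho X)) (u + rho X))
      = complex_of_real (det v') * cis (2 * pi * kform X \<omega> (u + rho X)) * S (w * v)"
    if w: "w \<in> weyl X" for w
  proof -
    have wc: "w \<in> carrier_mat (rank X) (rank X)" "v \<in> carrier_mat (rank X) (rank X)"
      "v' \<in> carrier_mat (rank X) (rank X)" using weyl_closed w v by auto
    have vx: "v *\<^sub>v (x + rho X) \<in> carrier_vec (rank X)" using v x by simp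
    have wy: "w *\<^sub>v (y + rho X) = (w * v) *\<^sub>v (x + rho X) + \<kappa> \<cdot>\<^sub>v (w *\<^sub>v \<omega>)"
      unfolding y \<kappa>_def using wc vx \<omega> x
      by (simp add: mult_add_distrib_mat_vec[of _ "rank X" "rank X"] mult_mat_vec[of _ "rank X" "rank X"]
          assoc_mult_mat_vec[of _ "rank X" "rank X" _ "rank X"])
    have f: "kform X (w *\<^sub>v (y + rho X)) (u + rho X)
        = kform X ((w * v) *\<^sub>v (x + rho X)) (u + rho X) + \<kappa> * kform X (w *\<^sub>v \<omega>) (u + rho X)"
      unfolding wy using weyl_mult[OF w v(1)] w x u \<omega> by (simp add: kform_linear)
    have "w = w * v * v'" using wc v assoc_mult_mat[OF wc] right_mult_one_mat[OF wc(1)] by simp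
    then have d: "det w = det (w * v) * det v'" using wc det_mult[of "w * v" "rank X" v'] by simp
    have "qpow X k (2 * real (lacing X) * (\<kappa> * kform X (w *\<^sub>v \<omega>) (u + rho X)))
        = cis (2 * pi * kform X (w *\<^sub>v \<omega>) (u + rho X))"
    proof -
      have "real (lacing X) \<noteq> 0" "\<kappa> \<noteq> 0" using kh lacing_pos[of X] unfolding \<kappa>_def of_nat_eq_0_iff by simp_all
      then show ?thesis by (simp add: qpow_def \<kappa>_def[symmetric] mult.left_commute[of pi] mult.assoc del: of_nat_add)
    qed
    also have "\<dots> = cis (2 * pi * kform X \<omega> (u + rho X))
        * cis (2 * pi * (kform X (w *\<^sub>v \<omega>) (u + rho X) - kform X \<omega> (u + rho X)))"
      by (simp add: cis_mult algebra_simps)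
    also have "\<dots> = cis (2 * pi * kform X \<omega> (u + rho X))"
      using weyl_coweight[OF w \<omega> u] by (simp only: cis_multiple_2pi mult_1_right)
    finally have "qpow X k (2 * real (lacing X) * (\<kappa> * kform X (w *\<^sub>v \<omega>) (u + rho X)))
        = cis (2 * pi * kform X \<omega> (u + rho X))" .
    then show ?thesis unfolding f S_def distrib_left qpow_add d by (simp add: mult_ac)
  qed
  then have "smatrix X k y u = (\<Sum>w\<in>weyl X. complex_of_real (det v') * cis (2 * pi * kform X \<omega> (u + rho X)) * S (w * v))"
    unfolding smatrix_def by (rule sum.cong[OF refl])
  also have "\<dots> = complex_of_real (det v') * cis (2 * pi * kform X \<omega> (u + rho X)) * (\<Sum>w\<in>weyl X. S (w * v))"
    by (simp add: sum_distrib_left)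
  also have "(\<Sum>w\<in>weyl X. S (w * v)) = sum S (weyl X)"
    by (rule sum.reindex_bij_betw[OF weyl_mult_bij[OF v(1)]])
  finally show ?thesis by (simp add: smatrix_def S_def)
qed

section \<open>Simple currents\<close>

text \<open>\<open>fund_weight\<close> and \<open>rho\<close> are definite descriptions, so nothing
  can be said of them before the Gram matrix is known to be invertible. This is proved for each type
  separately.\<close>

locale nondegenerate_root_datum =
  fixes X :: cartan_type
  assumes nondegenerate:
    "\<lbrakk>x \<in> carrier_vec (rank X); \<forall>i\<in>{1..rank X}. coroot_pairing X x i = 0\<rbrakk> \<Longrightarrow> x = 0\<^sub>v (rank X)"
begin

lemma coroot_pairing_eqI:
  assumes "x \<in> carrier_vec (rank X)" "y \<in> carrier_vec (rank X)"
    and "\<And>i. i \<in> {1..rank X} \<Longrightarrow> coroot_pairing X x i = coroot_pairing X y i"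
  shows "x = y"
proof -
  have "x - y = 0\<^sub>v (rank X)"
    using assms by (intro nondegenerate ballI) (auto simp: coroot_pairing_add_diff coroot_pairing_smult)
  then have "x $ i = y $ i" if "i < rank X" for i
    using that assms(1,2) index_minus_vec(1)[of i y x] by (metis carrier_vecD eq_iff_diff_eq_0 index_zero_vec(1))
  then show ?thesis using assms(1,2) by (intro eq_vecI) auto
qed

text \<open>Injectivity makes the Gram determinant nonzero. The vector \<open>c\<close> rescales the
  prescribed pairings by half the squared root lengths, which turns coroot pairings into values of
  the form.\<close>

lemma ex_weight:
  fixes l :: "nat \<Rightarrow> real"
  obtains x where "x \<in> carrier_vec (rank X)" "\<forall>i\<in>{1..rank X}. coroot_pairing X x i = l i"
proof -
  have G: "gram X \<in> carrier_mat (rank X) (rank X)" by (simp add: gram_def)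
  have "v = 0\<^sub>v (rank X)" if v: "v \<in> carrier_vec (rank X)" "gram X *\<^sub>v v = 0\<^sub>v (rank X)" for v
  proof (rule nondegenerate[OF v(1)], intro ballI)
    fix i assume "i \<in> {1..rank X}"
    moreover have "kform X (simple_root X i) v = 0" by (simp add: kform_def v(2))
    ultimately show "coroot_pairing X v i = 0" using v kform_sym[of v X] by (simp add: coroot_pairing_eq)
  qed
  then have "det (gram X) \<noteq> 0" using det_0_iff_vec_prod_zero_field[OF G] by blast
  then obtain B where B: "B \<in> carrier_mat (rank X) (rank X)" "gram X * B = 1\<^sub>m (rank X)"
    using det_non_zero_imp_unit[OF G, of "()"] by (auto simp: Units_def ring_mat_simps)
  define c where "c = vec (rank X) (\<lambda>i. l (i + 1) * root_sqlen X (i + 1) / 2)"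
  have c: "c \<in> carrier_vec (rank X)" by (simp add: c_def)
  have Bc: "B *\<^sub>v c \<in> carrier_vec (rank X)" using B c by simp
  have "gram X *\<^sub>v (B *\<^sub>v c) = c" using B c assoc_mult_mat_vec[OF G B(1) c] by simp
  have kf: "kform X (simple_root X i) (B *\<^sub>v c) = l i * root_sqlen X i / 2" if "i \<in> {1..rank X}" for i
  proof -
    have "i - 1 < rank X" using that by auto
    then show ?thesis using \<open>gram X *\<^sub>v (B *\<^sub>v c) = c\<close> that scalar_prod_left_unit[OF c, of "i - 1"]
      by (simp add: kform_def simple_root_def c_def)
  qed
  have "coroot_pairing X (B *\<^sub>v c) i = l i" if i: "i \<in> {1..rank X}" for i
    unfolding coroot_pairing_eq[OF i] kform_sym[OF Bc simple_root_closed] kf[OF i]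
    using root_sqlen_pos[of X i] by simp
  then show ?thesis using that Bc by blast
qed

lemma the_weight:
  fixes l :: "nat \<Rightarrow> real"
  defines "x \<equiv> (THE x. x \<in> carrier_vec (rank X) \<and> (\<forall>i\<in>{1..rank X}. coroot_pairing X x i = l i))"
  shows "x \<in> carrier_vec (rank X)" "i \<in> {1..rank X} \<Longrightarrow> coroot_pairing X x i = l i"
proof -
  obtain z where z: "z \<in> carrier_vec (rank X)" "\<forall>i\<in>{1..rank X}. coroot_pairing X z i = l i"
    by (rule ex_weight)
  have "\<exists>!x. x \<in> carrier_vec (rank X) \<and> (\<forall>i\<in>{1..rank X}. coroot_pairing X x i = l i)"
    by (rule ex1I[of _ z]) (use z in \<open>auto intro: coroot_pairing_eqI\<close>)
  from theI'[OF this] show "x \<in> carrier_vec (rank X)" "i \<in> {1..rank X} \<Longrightarrow> coroot_pairing X x i = l i"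
    unfolding x_def by auto
qed

lemma fund_weight_closed [simp]: "fund_weight X i \<in> carrier_vec (rank X)"
  unfolding fund_weight_def by (rule the_weight)

lemma coroot_pairing_fund_weight:
  "j \<in> {1..rank X} \<Longrightarrow> coroot_pairing X (fund_weight X i) j = (if j = i then 1 else 0)"
  unfolding fund_weight_def by (rule the_weight)

lemma rho_closed [simp]: "rho X \<in> carrier_vec (rank X)"
  unfolding rho_def by (rule the_weight)

lemma coroot_pairing_rho: "i \<in> {1..rank X} \<Longrightarrow> coroot_pairing X (rho X) i = 1"
  unfolding rho_def by (rule the_weight)

lemma fund_weight_eqI:
  assumes "x \<in> carrier_vec (rank X)"
    and "\<And>j. j \<in> {1..rank X} \<Longrightarrow> coroot_pairing X x j = (if j = i then 1 else 0)"
  shows "fund_weight X i = x"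
  using assms by (intro coroot_pairing_eqI) (simp_all add: coroot_pairing_fund_weight)

text \<open>In simple root coordinates, pairing with a fundamental weight reads off one coordinate.
  Thus all products with \<lambda>_c follow from the coordinates of \<lambda>_c alone.\<close>

lemma kform_fund_weight:
  assumes "i \<in> {1..rank X}" "x \<in> carrier_vec (rank X)"
  shows "kform X (fund_weight X i) x = x $ (i - 1) * root_sqlen X i / 2"
proof -
  have "kform X (fund_weight X i) x
      = (\<Sum>l<rank X. if l = i - 1 then x $ l * root_sqlen X i / 2 else 0)"
    unfolding kform_expand[OF fund_weight_closed assms(2)]
    using assms(1) by (intro sum.cong refl) (auto simp: kform_eq_coroot_pairing coroot_pairing_fund_weight)
  also have "\<dots> = x $ (i - 1) * root_sqlen X i / 2" using assms(1) by (auto simp: sum.delta)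
  finally show ?thesis .
qed

lemma kform_fund_weight_simple_root:
  assumes "i \<in> {1..rank X}" "j \<in> {1..rank X}"
  shows "kform X (fund_weight X i) (simple_root X j) = (if i = j then root_sqlen X i / 2 else 0)"
  using assms by (auto simp: kform_eq_coroot_pairing coroot_pairing_fund_weight)

end

text \<open>\<open>w\<close> is the linear part of the affine Weyl symmetry \<open>x \<mapsto> w x + k \<lambda>\<^sub>c\<close> of the level \<open>k\<close> alcove,
  \<open>c\<close> being the generator node: \<open>w\<close> permutes the simple roots together with \<open>- \<Theta>\<close>, sending
  \<open>\<alpha>\<^bsub>p i\<^esub>\<close> to \<open>\<alpha>\<^sub>i\<close> and \<open>- \<Theta>\<close> to \<open>\<alpha>\<^sub>c\<close>. The nodes \<open>\<sigma> 1, \<dots>, \<sigma> (N - 1)\<close> are the images of the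
  affine node under its iterates.\<close>

locale simple_current = nondegenerate_root_datum X for X :: cartan_type +
  fixes w :: "real mat" and p :: "nat \<Rightarrow> nat" and \<sigma> :: "nat \<Rightarrow> nat" and N :: nat
  assumes w_weyl: "w \<in> weyl X"
    and w_simple_root: "\<lbrakk>i \<in> {1..rank X}; i \<noteq> generator_node X\<rbrakk> \<Longrightarrow>
      p i \<in> {1..rank X} \<and> w *\<^sub>v simple_root X (p i) = simple_root X i"
    and w_highest_root: "w *\<^sub>v highest_root X = - simple_root X (generator_node X)"
    and generator_node: "generator_node X \<in> {1..rank X}" "root_sqlen X (generator_node X) = 2"
    and dual_coxeter: "(\<Sum>i<rank X. highest_root_coeff X (i + 1) * root_sqlen X (i + 1) / 2) = real (dual_coxeter X) - 1"
    and dual_coxeter_pos: "dual_coxeter X > 0"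
    and N_ge_2: "N \<ge> 2"
    and orbit_1: "\<sigma> 1 = generator_node X"
    and orbit_mem: "\<lbrakk>1 \<le> j; j < N\<rbrakk> \<Longrightarrow>
      \<sigma> j \<in> {1..rank X} \<and> highest_root_coeff X (\<sigma> j) * root_sqlen X (\<sigma> j) = 2"
    and orbit_inj: "inj_on \<sigma> {1..<N}"
    and orbit_step: "\<lbrakk>1 \<le> j; j + 1 < N; i \<in> {1..rank X}; i \<noteq> generator_node X\<rbrakk> \<Longrightarrow>
      p i = \<sigma> j \<longleftrightarrow> i = \<sigma> (j + 1)"
    and orbit_last: "\<lbrakk>i \<in> {1..rank X}; i \<noteq> generator_node X\<rbrakk> \<Longrightarrow> p i \<noteq> \<sigma> (N - 1)"
begin

abbreviation c :: nat where "c \<equiv> generator_node X"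
abbreviation \<omega> :: "real vec" where "\<omega> \<equiv> fund_weight X c"

lemma highest_root_closed [simp]: "highest_root X \<in> carrier_vec (rank X)"
  by (simp add: highest_root_def)

lemma w_closed [simp]: "x \<in> carrier_vec (rank X) \<Longrightarrow> w *\<^sub>v x \<in> carrier_vec (rank X)"
  using w_weyl by simp

text \<open>As \<open>w\<close> is an isometry and \<alpha>_i = w \<alpha>_(p i), pairing w x with
  \<alpha>_i is pairing x with \<alpha>_(p i), and the two roots have equal length. At the node
  \<open>c\<close> the root is -w \<Theta> instead.\<close>

lemma coroot_pairing_w:
  assumes x: "x \<in> carrier_vec (rank X)" and i: "i \<in> {1..rank X}"
  shows "coroot_pairing X (w *\<^sub>v x) i = (if i = c then - kform X x (highest_root X) else coroot_pairing X x (p i))"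
proof (cases "i = c")
  case True
  have "simple_root X c = (- 1) \<cdot>\<^sub>v (w *\<^sub>v highest_root X)"
    unfolding w_highest_root by (auto simp: simple_root_def)
  then have "kform X (w *\<^sub>v x) (simple_root X c) = - kform X x (highest_root X)"
    using x kform_weyl[OF w_weyl x highest_root_closed] by (simp add: kform_smult_right)
  then show ?thesis using True i generator_node by (simp add: coroot_pairing_eq)
next
  case False
  then have pi: "p i \<in> {1..rank X}" "w *\<^sub>v simple_root X (p i) = simple_root X i"
    using w_simple_root i by auto
  have "root_sqlen X (p i) = root_sqlen X i"
    using kform_weyl[OF w_weyl simple_root_closed simple_root_closed, of "p i" "p i"] pi i
    by (simp add: kform_simple_root_self)
  then show ?thesis
    using False kform_weyl[OF w_weyl x simple_root_closed, of "p i"] pi i by (simp add: coroot_pairing_eq)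
qed

text \<open>This is the meaning of the normalisation to 2 in \<open>orbit_mem\<close>: k times such
  a weight lies on the wall of level k.\<close>

lemma kform_fund_weight_highest_root:
  "\<lbrakk>1 \<le> j; j < N\<rbrakk> \<Longrightarrow> kform X (fund_weight X (\<sigma> j)) (highest_root X) = 1"
  using orbit_mem[of j] by (auto simp: kform_fund_weight highest_root_def)

lemma kform_rho_highest_root: "kform X (rho X) (highest_root X) = real (dual_coxeter X) - 1"
  unfolding kform_expand[OF rho_closed highest_root_closed] dual_coxeter[symmetric]
  by (intro sum.cong refl) (simp add: highest_root_def kform_eq_coroot_pairing coroot_pairing_rho)

text \<open>At \<open>c\<close> the pairings add up to -(h - 1) + h = 1. Together with
  \<open>orbit_Suc\<close> this turns the symmetry into an affine map with translation (k + h)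
  \<omega> on \<rho>-shifted weights, the form that \<open>smatrix_shift\<close> expects.\<close>

lemma w_rho: "w *\<^sub>v rho X + real (dual_coxeter X) \<cdot>\<^sub>v \<omega> = rho X"
proof (rule coroot_pairing_eqI)
  fix i assume i: "i \<in> {1..rank X}"
  show "coroot_pairing X (w *\<^sub>v rho X + real (dual_coxeter X) \<cdot>\<^sub>v \<omega>) i = coroot_pairing X (rho X) i"
    using i w_simple_root[OF i]
    by (simp add: coroot_pairing_add_diff coroot_pairing_smult coroot_pairing_w coroot_pairing_fund_weight coroot_pairing_rho
        kform_rho_highest_root)
qed auto

text \<open>The value zero outside \<open>1 \<le> j < N\<close> serves twice: it is the unit at j =
  0 and closes the orbit at j = N.\<close>

definition orbit :: "nat \<Rightarrow> nat \<Rightarrow> real vec" where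
  "orbit k j = (if 1 \<le> j \<and> j < N then real k \<cdot>\<^sub>v fund_weight X (\<sigma> j) else 0\<^sub>v (rank X))"

lemma orbit_closed [simp]: "orbit k j \<in> carrier_vec (rank X)"
  by (simp add: orbit_def)

lemma coroot_pairing_orbit:
  "i \<in> {1..rank X} \<Longrightarrow> coroot_pairing X (orbit k j) i = (if 1 \<le> j \<and> j < N \<and> i = \<sigma> j then real k else 0)"
  by (simp add: orbit_def coroot_pairing_add_diff coroot_pairing_smult coroot_pairing_fund_weight coroot_pairing_zero)

lemma kform_orbit_highest_root:
  "kform X (orbit k j) (highest_root X) = (if 1 \<le> j \<and> j < N then real k else 0)"
  by (simp add: orbit_def kform_smult_left kform_fund_weight_highest_root)

text \<open>At \<open>c\<close> the label is k minus the pairing with \<Theta>, so it is k only when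
  j = 0. The other labels travel along \<sigma>; from \<sigma> (N - 1) there is no node to move to,
  so all labels vanish and the unit returns.\<close>

lemma orbit_Suc:
  assumes "j < N"
  shows "orbit k (j + 1) = w *\<^sub>v orbit k j + real k \<cdot>\<^sub>v \<omega>"
proof (rule coroot_pairing_eqI)
  fix i assume i: "i \<in> {1..rank X}"
  have R: "coroot_pairing X (w *\<^sub>v orbit k j + real k \<cdot>\<^sub>v \<omega>) i
      = (if i = c then real k - kform X (orbit k j) (highest_root X) else coroot_pairing X (orbit k j) (p i))"
    using i by (simp add: coroot_pairing_add_diff coroot_pairing_smult coroot_pairing_w coroot_pairing_fund_weight)
  show "coroot_pairing X (orbit k (j + 1)) i = coroot_pairing X (w *\<^sub>v orbit k j + real k \<cdot>\<^sub>v \<omega>) i"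
  proof (cases "i = c")
    case True
    have "\<sigma> (j + 1) \<noteq> c" if "1 \<le> j" "j + 1 < N"
      using inj_onD[OF orbit_inj, of "j + 1" 1] that orbit_1 by auto
    then show ?thesis
      unfolding R using True i assms N_ge_2 orbit_1
      by (cases "j = 0") (auto simp: coroot_pairing_orbit kform_orbit_highest_root)
  next
    case False
    then have pi: "p i \<in> {1..rank X}" using w_simple_root i by auto
    consider "j = 0" | "1 \<le> j" "j + 1 < N" | "j = N - 1" "1 \<le> j" using assms by linarith
    then show ?thesis
    proof cases
      case 1
      then show ?thesis unfolding R using False i pi orbit_1 by (simp add: coroot_pairing_orbit)
    next
      case 2
      then show ?thesis unfolding R using False i pi orbit_step by (simp add: coroot_pairing_orbit)
    next
      case 3
      then show ?thesis unfolding R using False i pi orbit_last by (simp add: coroot_pairing_orbit)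
    qed
  qed
qed auto

lemma orbit_simples: "orbit k j \<in> simples X k"
  unfolding simples_def by (auto simp: coroot_pairing_orbit kform_orbit_highest_root)

lemma orbit_inj_on:
  assumes "k \<ge> 1"
  shows "inj_on (orbit k) {..<N}"
proof (rule inj_onI, rule ccontr)
  fix i j assume ij: "i \<in> {..<N}" "j \<in> {..<N}" "orbit k i = orbit k j" "i \<noteq> j"
  have aux: False if "1 \<le> i" "i < N" "j < N" "orbit k i = orbit k j" "i \<noteq> j" for i j
  proof -
    have m: "\<sigma> i \<in> {1..rank X}" using orbit_mem that by blast
    have "real k = coroot_pairing X (orbit k j) (\<sigma> i)"
      using coroot_pairing_orbit[OF m, of k i] that by simp
    then have "1 \<le> j" "\<sigma> i = \<sigma> j" using assms by (auto simp: coroot_pairing_orbit[OF m] split: if_splits)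
    then show False using inj_onD[OF orbit_inj, of i j] that by auto
  qed
  show False using aux[of i j] aux[of j i] ij by (cases "1 \<le> i") auto
qed

lemma simples_rho:
  assumes "u \<in> simples X k"
  shows "u + rho X \<in> carrier_vec (rank X)" "\<forall>i\<in>{1..rank X}. coroot_pairing X (u + rho X) i \<in> \<int>"
  using assms by (auto simp: simples_def coroot_pairing_add_diff coroot_pairing_smult coroot_pairing_rho
      intro!: Ints_add dest!: bspec elim!: Nats_cases)

lemma kform_omega_root: "\<forall>j\<in>{1..rank X}. kform X \<omega> (simple_root X j) \<in> \<int>"
  using generator_node by (simp add: kform_fund_weight_simple_root)

text \<open>The factor by which S changes is the same from 0 to \<open>g\<close> as from
  \<open>orbit k j\<close> to its successor.\<close>

lemma tensor_iso_orbit: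
  assumes "k \<ge> 1" "j < N"
  shows "tensor_iso X k (real k \<cdot>\<^sub>v \<omega>) (orbit k j) (orbit k (j + 1))"
proof -
  obtain v where v: "v \<in> weyl X" "w * v = 1\<^sub>m (rank X)" using weyl_inverse[OF w_weyl] by blast
  have shift: "smatrix X k (orbit k (i + 1)) u
      = complex_of_real (det v) * cis (2 * pi * kform X \<omega> (u + rho X)) * smatrix X k (orbit k i) u"
    if "i < N" "u \<in> simples X k" for i u
  proof (rule smatrix_shift[OF _ w_weyl v _ kform_omega_root simples_rho[OF that(2)]])
    have "orbit k (i + 1) + rho X
        = w *\<^sub>v orbit k i + real k \<cdot>\<^sub>v \<omega> + (w *\<^sub>v rho X + real (dual_coxeter X) \<cdot>\<^sub>v \<omega>)"
      unfolding w_rho orbit_Suc[OF that(1)] ..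
    also have "\<dots> = w *\<^sub>v (orbit k i + rho X) + real (k + dual_coxeter X) \<cdot>\<^sub>v \<omega>"
      unfolding mult_add_distrib_mat_vec[OF weyl_closed[OF w_weyl] orbit_closed rho_closed]
      by (rule coroot_pairing_eqI)
        (auto simp: coroot_pairing_add_diff coroot_pairing_smult distrib_right)
    finally show "orbit k (i + 1) + rho X = w *\<^sub>v (orbit k i + rho X) + real (k + dual_coxeter X) \<cdot>\<^sub>v \<omega>" .
  qed (use assms in auto)
  have g: "real k \<cdot>\<^sub>v \<omega> = orbit k (0 + 1)" using N_ge_2 orbit_1 by (simp add: orbit_def)
  have 0: "0\<^sub>v (rank X) = orbit k 0" by (simp add: orbit_def)
  show ?thesis unfolding tensor_iso_def
  proof
    fix u assume u: "u \<in> simples X k"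
    show "smatrix X k (real k \<cdot>\<^sub>v \<omega>) u * smatrix X k (orbit k j) u
        = smatrix X k (0\<^sub>v (rank X)) u * smatrix X k (orbit k (j + 1)) u"
      unfolding g 0 using shift[of 0 u] shift[of j u] u assms N_ge_2 by simp
  qed
qed

section \<open>Twists along the orbit\<close>

lemma w_rho_diff: "w *\<^sub>v rho X = rho X - real (dual_coxeter X) \<cdot>\<^sub>v \<omega>"
proof (rule coroot_pairing_eqI)
  fix i assume "i \<in> {1..rank X}"
  then show "coroot_pairing X (w *\<^sub>v rho X) i = coroot_pairing X (rho X - real (dual_coxeter X) \<cdot>\<^sub>v \<omega>) i"
    using arg_cong[OF w_rho, of "\<lambda>v. coroot_pairing X v i"]
    by (simp add: coroot_pairing_add_diff coroot_pairing_smult)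
qed auto

text \<open>Compare the norms of \<rho> and w \<rho> = \<rho> - h \<omega>, and divide by h.\<close>

lemma kform_rho_omega: "2 * kform X (rho X) \<omega> = real (dual_coxeter X) * kform X \<omega> \<omega>"
proof -
  let ?h = "real (dual_coxeter X)"
  have "kform X (rho X) (rho X) = kform X (rho X - ?h \<cdot>\<^sub>v \<omega>) (rho X - ?h \<cdot>\<^sub>v \<omega>)"
    using kform_weyl[OF w_weyl rho_closed rho_closed] w_rho_diff by simp
  also have "\<dots> = kform X (rho X) (rho X) - 2 * ?h * kform X (rho X) \<omega> + ?h\<^sup>2 * kform X \<omega> \<omega>"
    using kform_sym[of \<omega> X "rho X"] by (simp add: kform_linear power2_eq_square algebra_simps)
  finally have "?h * (2 * kform X (rho X) \<omega>) = ?h * (?h * kform X \<omega> \<omega>)"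
    by (simp add: power2_eq_square algebra_simps)
  then show ?thesis using dual_coxeter_pos by simp
qed

text \<open>Applying the isometry \<open>w\<close> to both arguments replaces x by y - k \<omega>
  and \<rho> by \<rho> - h \<omega>. With \<open>kform_rho_omega\<close> the correction becomes a
  multiple of k + h, which cancels the denominator of the twist.\<close>

lemma kform_orbit_Suc:
  assumes "j < N"
  shows "kform X (orbit k (j + 1)) (orbit k (j + 1) + 2 \<cdot>\<^sub>v rho X)
    = kform X (orbit k j) (orbit k j + 2 \<cdot>\<^sub>v rho X)
      + real (k + dual_coxeter X) * (2 * kform X (orbit k (j + 1)) \<omega> - real k * kform X \<omega> \<omega>)"
proof -
  let ?x = "orbit k j" and ?y = "orbit k (j + 1)" and ?h = "real (dual_coxeter X)"
  have wx: "w *\<^sub>v ?x = ?y - real k \<cdot>\<^sub>v \<omega>"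
    unfolding orbit_Suc[OF assms]
    by (rule coroot_pairing_eqI) (auto simp: coroot_pairing_add_diff coroot_pairing_smult)
  have "kform X ?x ?x + 2 * kform X ?x (rho X)
      = kform X (w *\<^sub>v ?x) (w *\<^sub>v ?x) + 2 * kform X (w *\<^sub>v ?x) (w *\<^sub>v rho X)"
    by (simp add: kform_weyl[OF w_weyl])
  also have "\<dots> = kform X ?y ?y + 2 * kform X ?y (rho X) - 2 * real (k + dual_coxeter X) * kform X ?y \<omega>
      + (real k)\<^sup>2 * kform X \<omega> \<omega> + 2 * real k * ?h * kform X \<omega> \<omega> - real k * (2 * kform X (rho X) \<omega>)"
    unfolding wx w_rho_diff using kform_sym[of \<omega> X "rho X"] kform_sym[of \<omega> X ?y]
    by (simp add: kform_linear power2_eq_square algebra_simps)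
  also have "\<dots> = kform X ?y ?y + 2 * kform X ?y (rho X)
      - real (k + dual_coxeter X) * (2 * kform X ?y \<omega> - real k * kform X \<omega> \<omega>)"
    unfolding kform_rho_omega by (simp add: power2_eq_square algebra_simps)
  finally show ?thesis by (simp add: kform_add_right kform_smult_right)
qed

text \<open>The recursion is that of the norms of the weights in the orbit: \<open>w\<close> maps
  \<lambda>_(\<sigma> j) to \<lambda>_(\<sigma> (j + 1)) - \<omega> and preserves length. So
  \<open>f j\<close> stands for the norm of the j-th weight, with value 0 at the unit.\<close>

lemma twist_orbit:
  assumes "f 0 = 0"
    and "\<And>j. j + 1 < N \<Longrightarrow> f (j + 1) = f j + 2 * kform X (fund_weight X (\<sigma> (j + 1))) \<omega> - kform X \<omega> \<omega>"
    and "j < N"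
  shows "twist X k (orbit k j) = cis (pi * (real k * f j))"
proof -
  let ?\<kappa> = "real (k + dual_coxeter X)"
  have "kform X (orbit k j) (orbit k j + 2 \<cdot>\<^sub>v rho X) = ?\<kappa> * (real k * f j)"
    using assms(3)
  proof (induction j)
    case 0
    then show ?case using assms(1) by (simp add: orbit_def)
  next
    case (Suc j)
    have o: "orbit k (j + 1) = real k \<cdot>\<^sub>v fund_weight X (\<sigma> (j + 1))"
      using Suc.prems by (simp add: orbit_def)
    have "kform X (orbit k (j + 1)) \<omega> = real k * kform X (fund_weight X (\<sigma> (j + 1))) \<omega>"
      unfolding o by (simp add: kform_smult_left)
    then have "kform X (orbit k (j + 1)) (orbit k (j + 1) + 2 \<cdot>\<^sub>v rho X)
        = ?\<kappa> * (real k * f j)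
          + ?\<kappa> * (2 * (real k * kform X (fund_weight X (\<sigma> (j + 1))) \<omega>) - real k * kform X \<omega> \<omega>)"
      using Suc kform_orbit_Suc[of j k] by simp
    also have "\<dots> = ?\<kappa> * (real k * f (j + 1))"
      using Suc.prems assms(2)[of j] by (simp only: Suc_eq_plus1) (simp add: algebra_simps)
    finally show ?case by simp
  qed
  moreover have "real (lacing X) \<noteq> 0" "?\<kappa> \<noteq> 0"
    using lacing_pos[of X] dual_coxeter_pos unfolding of_nat_eq_0_iff by simp_all
  ultimately show ?thesis by (simp add: twist_def qpow_def del: of_nat_add)
qed

text \<open>The passage from root data to the abstract group. The last hypothesis compares values of
  \<open>cis\<close> rather than exponents, since in type D these agree only modulo 2.\<close>

lemma cyclic_premetric:
  assumes k: "k \<ge> 1" and A: "is_invertible_group X k A"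
    and cyclic: "carrier A = range (\<lambda>j::nat. generator X k [^]\<^bsub>A\<^esub> j)"
    and f: "f 0 = 0"
      "\<And>j. j + 1 < N \<Longrightarrow> f (j + 1) = f j + 2 * kform X (fund_weight X (\<sigma> (j + 1))) \<omega> - kform X \<omega> \<omega>"
    and K: "\<And>j. j < N \<Longrightarrow> cis (pi * (real k * f j)) = cis (pi * real K * (real j * (real N - real j) / real N))"
  shows "cyclic_premetric A (generator X k) (twist X k) N K"
proof -
  let ?g = "generator X k"
  interpret group A using A by (simp add: is_invertible_group_def)
  have carr: "carrier A = invertibles X k" and one: "\<one>\<^bsub>A\<^esub> = 0\<^sub>v (rank X)"
    and mult: "\<And>x y z. \<lbrakk>x \<in> carrier A; y \<in> carrier A; z \<in> simples X k; tensor_iso X k x y z\<rbrakk> \<Longrightarrow> z = x \<otimes>\<^bsub>A\<^esub> y"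
    using A by (auto simp: is_invertible_group_def)
  have g: "?g = orbit k 1" "?g = real k \<cdot>\<^sub>v \<omega>"
    using N_ge_2 orbit_1 by (simp_all add: orbit_def generator_def)
  have oN: "orbit k N = 0\<^sub>v (rank X)" by (simp add: orbit_def)
  \<comment> \<open>The last element of the orbit is the inverse that shows \<open>g\<close> to be
    invertible.\<close>
  have "tensor_iso X k ?g (orbit k (N - 1)) (0\<^sub>v (rank X))"
    using tensor_iso_orbit[OF k, of "N - 1"] N_ge_2 g oN by simp
  then have gA: "?g \<in> carrier A"
    using orbit_simples[of k] g(1) unfolding carr invertibles_def by auto
  have pow: "?g [^]\<^bsub>A\<^esub> j = orbit k j" if "j \<le> N" for j
    using that
  proof (induction j)
    case 0
    then show ?case by (simp add: one orbit_def)
  next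
    case (Suc j)
    then have IH: "?g [^]\<^bsub>A\<^esub> j = orbit k j" by simp
    have "orbit k j \<in> carrier A" using nat_pow_closed[OF gA, of j] IH by simp
    then have "orbit k (j + 1) = ?g \<otimes>\<^bsub>A\<^esub> orbit k j"
      using tensor_iso_orbit[OF k, of j] Suc.prems g(2)
      by (intro mult[OF gA _ orbit_simples]) auto
    then show ?case using nat_pow_Suc2[OF gA, of j] IH by simp
  qed
  have gN: "?g [^]\<^bsub>A\<^esub> N = \<one>\<^bsub>A\<^esub>" using pow[of N] oN one by simp
  have "?g [^]\<^bsub>A\<^esub> j = ?g [^]\<^bsub>A\<^esub> (j mod N)" for j :: nat
  proof -
    have "?g [^]\<^bsub>A\<^esub> (N * (j div N) + j mod N) = ?g [^]\<^bsub>A\<^esub> (j mod N)"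
      using nat_pow_mult[OF gA, of "N * (j div N)" "j mod N"] nat_pow_pow[OF gA, of N "j div N"]
        nat_pow_closed[OF gA, of "j mod N"] gN by (metis nat_pow_one l_one)
    then show ?thesis by simp
  qed
  moreover have "j mod N < N" for j using N_ge_2 by simp
  ultimately have carrN: "carrier A = (\<lambda>j. ?g [^]\<^bsub>A\<^esub> j) ` {..<N}"
    unfolding cyclic by (auto simp: image_iff)
  have inj: "inj_on (\<lambda>j. ?g [^]\<^bsub>A\<^esub> j) {..<N}"
    using orbit_inj_on[OF k] pow by (auto simp: inj_on_def)
  show ?thesis
  proof unfold_locales
    fix j assume "j < N"
    then show "twist X k (?g [^]\<^bsub>A\<^esub> j) = cis (pi * real K * (real j * (real N - real j) / real N))"
      using pow[of j] twist_orbit[of f j k, OF f] K[of j] by simp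
  qed (use gA carrN inj gN N_ge_2 in auto)
qed

end

section \<open>Classical types\<close>

text \<open>Indexed by nodes and extended by 0, so that the same formula serves at an end of the
  diagram as in its middle.\<close>

definition node_coord :: "real vec \<Rightarrow> nat \<Rightarrow> real" where
  "node_coord x j = (if 1 \<le> j \<and> j \<le> dim_vec x then x $ (j - 1) else 0)"

lemma node_coord_0 [simp]: "node_coord x 0 = 0"
  by (simp add: node_coord_def)

lemma node_coord_zero_vec [simp]: "node_coord (0\<^sub>v r) j = 0"
  by (auto simp: node_coord_def)

lemma node_coord_Suc_dim [simp]: "node_coord x (Suc (dim_vec x)) = 0"
  by (simp add: node_coord_def)

lemma node_coord_simple_root:
  "i \<in> {1..rank X} \<Longrightarrow> node_coord (simple_root X i) j = (if j = i then 1 else 0)"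
  by (auto simp: node_coord_def simple_root_def)

lemma node_coord_highest_root:
  "node_coord (highest_root X) j = (if j \<in> {1..rank X} then highest_root_coeff X j else 0)"
  by (auto simp: node_coord_def highest_root_def)

lemma node_coord_eqI:
  assumes "x \<in> carrier_vec r" "y \<in> carrier_vec r" "\<And>j. j \<in> {1..r} \<Longrightarrow> node_coord x j = node_coord y j"
  shows "x = y"
proof (rule eq_vecI)
  fix i assume "i < dim_vec y"
  then show "x $ i = y $ i" using assms(3)[of "i + 1"] assms(1,2) by (simp add: node_coord_def)
qed (use assms in auto)

lemma node_coord_minus:
  "node_coord (- x) j = - node_coord x j"
  by (auto simp: node_coord_def)

text \<open>\<open>S\<close> is meant to be a node with its neighbours. It may reach beyond the
  diagram, where \<open>node_coord\<close> vanishes.\<close>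

lemma coroot_pairing_node_coord:
  assumes "x \<in> carrier_vec (rank X)" "i \<in> {1..rank X}" "finite S"
    and "\<And>j. \<lbrakk>j \<in> {1..rank X}; j \<notin> S\<rbrakk> \<Longrightarrow> gram_entry X j i = 0"
  shows "coroot_pairing X x i = (\<Sum>j\<in>S. node_coord x j * (2 * gram_entry X j i / root_sqlen X i))"
proof -
  have "coroot_pairing X x i = (\<Sum>l<rank X. x $ l * (2 * gram_entry X (l + 1) i / root_sqlen X i))"
    using assms by (simp add: coroot_pairing_eq kform_simple_root sum_distrib_left sum_divide_distrib mult_ac)
  also have "\<dots> = (\<Sum>j\<in>{1..rank X}. node_coord x j * (2 * gram_entry X j i / root_sqlen X i))"
    using assms(1)
    by (intro sum.reindex_bij_witness[of _ "\<lambda>j. j - 1" "\<lambda>j. j + 1"]) (auto simp: node_coord_def)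
  also have "\<dots> = (\<Sum>j\<in>S. node_coord x j * (2 * gram_entry X j i / root_sqlen X i))"
    using assms by (intro sum.mono_neutral_cong) (auto simp: node_coord_def)
  finally show ?thesis .
qed

lemma node_coord_simple_reflection:
  assumes "x \<in> carrier_vec (rank X)" "i \<in> {1..rank X}"
  shows "node_coord (simple_reflection X i *\<^sub>v x) j
    = (if j = i then node_coord x i - coroot_pairing X x i else node_coord x j)"
  using assms by (auto simp: simple_reflection_mult node_coord_def simple_root_def)

lemma coroot_pairing_A:
  assumes "x \<in> carrier_vec n" "i \<in> {1..n}"
  shows "coroot_pairing (Type_A n) x i = 2 * node_coord x i - node_coord x (i - 1) - node_coord x (i + 1)"
proof -
  obtain l where "i = Suc l" using assms by (cases i) auto
  then show ?thesis using assms
    by (subst coroot_pairing_node_coord[of _ _ _ "{l, Suc l, Suc (Suc l)}"]) (auto simp: gram_entry_def)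
qed

lemma coroot_pairing_B:
  assumes "x \<in> carrier_vec n" "i \<in> {1..n}"
  shows "coroot_pairing (Type_B n) x i = (if i = n then 2 * node_coord x n - 2 * node_coord x (n - 1)
    else 2 * node_coord x i - node_coord x (i - 1) - node_coord x (i + 1))"
proof -
  obtain l where "i = Suc l" using assms by (cases i) auto
  then show ?thesis using assms node_coord_Suc_dim[of x]
    by (subst coroot_pairing_node_coord[of _ _ _ "{l, Suc l, Suc (Suc l)}"]) (auto simp: gram_entry_def)
qed

lemma coroot_pairing_C:
  assumes "x \<in> carrier_vec n" "i \<in> {1..n}"
  shows "coroot_pairing (Type_C n) x i = (if i = n then 2 * node_coord x n - node_coord x (n - 1)
    else if i + 1 = n then 2 * node_coord x i - node_coord x (i - 1) - 2 * node_coord x n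
    else 2 * node_coord x i - node_coord x (i - 1) - node_coord x (i + 1))"
proof -
  obtain l where "i = Suc l" using assms by (cases i) auto
  then show ?thesis using assms node_coord_Suc_dim[of x]
    by (subst coroot_pairing_node_coord[of _ _ _ "{l, Suc l, Suc (Suc l)}"]) (auto simp: gram_entry_def)
qed

lemma coroot_pairing_D:
  assumes "x \<in> carrier_vec n" "i \<in> {1..n}" "n \<ge> 3"
  shows "coroot_pairing (Type_D n) x i = (if i = n \<or> i + 1 = n then 2 * node_coord x i - node_coord x (n - 2)
    else if i + 2 = n then 2 * node_coord x i - node_coord x (i - 1) - node_coord x (n - 1) - node_coord x n
    else 2 * node_coord x i - node_coord x (i - 1) - node_coord x (i + 1))"
proof -
  consider "i = n \<or> i + 1 = n" | "i + 2 = n" | "i + 2 < n" using assms by force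
  then show ?thesis
  proof cases
    case 1
    then show ?thesis using assms
      by (subst coroot_pairing_node_coord[of _ _ _ "{n - 2, i}"]) (auto simp: gram_entry_def)
  next
    case 2
    then obtain l where "i = Suc l" "n = l + 3" using assms by (cases i) auto
    then show ?thesis using assms
      by (subst coroot_pairing_node_coord[of _ _ _ "{l, l + 1, l + 2, l + 3}"]) (auto simp: gram_entry_def)
  next
    case 3
    then obtain l where "i = Suc l" using assms by (cases i) auto
    then show ?thesis using assms 3
      by (subst coroot_pairing_node_coord[of _ _ _ "{l, Suc l, Suc (Suc l)}"]) (auto simp: gram_entry_def)
  qed
qed

text \<open>Coordinates with respect to the usual orthogonal basis \<open>\<epsilon>\<^sub>1, \<dots>, \<epsilon>\<^sub>M\<close>, on which the Weyl group of a
  classical type acts by signed permutations.\<close>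

fun eps_dim :: "cartan_type \<Rightarrow> nat" where
  "eps_dim (Type_A n) = n + 1"
| "eps_dim X = rank X"

text \<open>Expansion of a vector using \<alpha>_i = \<epsilon>_i - \<epsilon>_(i+1), except that
  \<alpha>_n is \<epsilon>_n, 2 \<epsilon>_n, \<epsilon>_(n-1) + \<epsilon>_n in types B, C,
  D.\<close>

fun eps_coord :: "cartan_type \<Rightarrow> real vec \<Rightarrow> nat \<Rightarrow> real" where
  "eps_coord (Type_C n) x p = (if p = n then 2 * node_coord x n else node_coord x p) - node_coord x (p - 1)"
| "eps_coord (Type_D n) x p =
     (if p + 1 = n then node_coord x p + node_coord x n else node_coord x p) - node_coord x (p - 1)"
| "eps_coord _ x p = node_coord x p - node_coord x (p - 1)"

fun classical :: "cartan_type \<Rightarrow> bool" where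
  "classical (Type_A n) \<longleftrightarrow> n \<ge> 1"
| "classical (Type_B n) \<longleftrightarrow> n \<ge> 2"
| "classical (Type_C n) \<longleftrightarrow> n \<ge> 1"
| "classical (Type_D n) \<longleftrightarrow> n \<ge> 3"
| "classical _ \<longleftrightarrow> False"

lemma eps_coord_zero [simp]: "eps_coord X (0\<^sub>v r) p = 0"
  by (cases X) auto

lemma eps_coord_eqI:
  assumes X: "classical X" and xy: "x \<in> carrier_vec (rank X)" "y \<in> carrier_vec (rank X)"
    and eq: "\<And>p. p \<in> {1..eps_dim X} \<Longrightarrow> eps_coord X x p = eps_coord X y p"
  shows "x = y"
proof (rule node_coord_eqI[OF xy])
  fix j assume j: "j \<in> {1..rank X}"
  have aux: "node_coord x j = node_coord y j"
    if "j \<le> L" "\<And>p. \<lbrakk>1 \<le> p; p \<le> L\<rbrakk> \<Longrightarrow> node_coord x p - node_coord x (p - 1) = node_coord y p - node_coord y (p - 1)"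
    for j L
    using that(1)
  proof (induction j)
    case (Suc j)
    then show ?case using that(2)[of "Suc j"] by simp
  qed simp
  show "node_coord x j = node_coord y j"
  proof (cases X)
    case (Type_A n)
    then show ?thesis using aux[of j n] j eq by simp
  next
    case (Type_B n)
    then show ?thesis using aux[of j n] j eq by simp
  next
    case (Type_C n)
    have l: "node_coord x i = node_coord y i" if "i < n" for i
    proof (rule aux[of _ "n - 1"])
      fix p assume "1 \<le> p" "p \<le> n - 1"
      moreover from this have "p < n" by linarith
      ultimately show "node_coord x p - node_coord x (p - 1) = node_coord y p - node_coord y (p - 1)"
        using eq[of p] Type_C by auto
    qed (use that in simp)
    then show ?thesis using Type_C X j eq[of n] l[of "n - 1"] by (cases "j = n") auto
  next
    case (Type_D n)
    have l: "node_coord x i = node_coord y i" if "i \<le> n - 2" for i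
    proof (rule aux[of _ "n - 2"])
      fix p assume "1 \<le> p" "p \<le> n - 2"
      moreover from this have "p + 1 < n" by linarith
      ultimately show "node_coord x p - node_coord x (p - 1) = node_coord y p - node_coord y (p - 1)"
        using eq[of p] Type_D by auto
    qed (use that in simp)
    \<comment> \<open>The two nodes at the fork enter the last coordinates only through their sum
      and difference.\<close>
    have "node_coord x (n - 1) + node_coord x n = node_coord y (n - 1) + node_coord y n"
      "node_coord x n - node_coord x (n - 1) = node_coord y n - node_coord y (n - 1)"
      using eq[of "n - 1"] eq[of n] l[of "n - 2"] X Type_D by (auto simp: numeral_2_eq_2)
    then have "node_coord x (n - 1) = node_coord y (n - 1)" "node_coord x n = node_coord y n" by auto
    moreover have "j \<le> n - 2 \<or> j = n - 1 \<or> j = n" using j Type_D by auto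
    ultimately show ?thesis using l by auto
  qed (use X in auto)
qed

text \<open>The permutation acts on positions, hence contravariantly: a product w v belongs to
  \<open>\<pi>' \<circ> \<pi>\<close>. Only positions in the coordinate range count, which gives
  \<open>signed_perm_weyl_cong\<close> its freedom.\<close>

definition signed_perm_weyl :: "cartan_type \<Rightarrow> (nat \<Rightarrow> nat) \<Rightarrow> (nat \<Rightarrow> real) \<Rightarrow> bool" where
  "signed_perm_weyl X \<pi> s \<longleftrightarrow> (\<exists>w\<in>weyl X. \<forall>x\<in>carrier_vec (rank X). \<forall>p\<in>{1..eps_dim X}.
     eps_coord X (w *\<^sub>v x) p = s p * eps_coord X x (\<pi> p))"

lemma signed_perm_weyl_id: "signed_perm_weyl X id (\<lambda>_. 1)"
  unfolding signed_perm_weyl_def by (intro bexI[OF _ weyl.one]) auto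

lemma signed_perm_weyl_comp:
  assumes "signed_perm_weyl X \<pi> s" "signed_perm_weyl X \<pi>' s'"
    and "\<And>p. p \<in> {1..eps_dim X} \<Longrightarrow> \<pi> p \<in> {1..eps_dim X}"
  shows "signed_perm_weyl X (\<pi>' \<circ> \<pi>) (\<lambda>p. s p * s' (\<pi> p))"
proof -
  obtain w where w: "w \<in> weyl X" "\<forall>x\<in>carrier_vec (rank X). \<forall>p\<in>{1..eps_dim X}.
     eps_coord X (w *\<^sub>v x) p = s p * eps_coord X x (\<pi> p)"
    using assms(1) by (auto simp: signed_perm_weyl_def)
  obtain v where v: "v \<in> weyl X" "\<forall>x\<in>carrier_vec (rank X). \<forall>p\<in>{1..eps_dim X}.
     eps_coord X (v *\<^sub>v x) p = s' p * eps_coord X x (\<pi>' p)"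
    using assms(2) by (auto simp: signed_perm_weyl_def)
  show ?thesis unfolding signed_perm_weyl_def
  proof (intro bexI[of _ "w * v"] ballI weyl_mult w(1) v(1))
    fix x :: "real vec" and p assume x: "x \<in> carrier_vec (rank X)" and p: "p \<in> {1..eps_dim X}"
    have "w * v *\<^sub>v x = w *\<^sub>v (v *\<^sub>v x)"
      by (rule assoc_mult_mat_vec[OF weyl_closed[OF w(1)] weyl_closed[OF v(1)] x])
    then show "eps_coord X (w * v *\<^sub>v x) p = s p * s' (\<pi> p) * eps_coord X x ((\<pi>' \<circ> \<pi>) p)"
      using w v x p assms(3)[OF p] by simp
  qed
qed

lemma signed_perm_weyl_cong:
  assumes "signed_perm_weyl X \<pi> s"
    and "\<And>p. p \<in> {1..eps_dim X} \<Longrightarrow> \<pi> p = \<pi>' p \<and> s p = s' p"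
  shows "signed_perm_weyl X \<pi>' s'"
  using assms unfolding signed_perm_weyl_def by auto

lemma signed_perm_weyl_adjacent:
  assumes X: "classical X" and i: "1 \<le> i" "i < eps_dim X"
  shows "signed_perm_weyl X (transpose i (i + 1)) (\<lambda>_. 1)"
  unfolding signed_perm_weyl_def
proof (intro bexI[of _ "simple_reflection X i"] ballI)
  have ir: "i \<in> {1..rank X}" using assms by (cases X) auto
  then show "simple_reflection X i \<in> weyl X" by (rule simple_reflection_weyl)
  fix x :: "real vec" and p assume x: "x \<in> carrier_vec (rank X)" and p: "p \<in> {1..eps_dim X}"
  note nc = node_coord_simple_reflection[OF x ir]
  have last: "node_coord x (Suc (rank X)) = 0" using node_coord_Suc_dim[of x] x by simp
  have "eps_coord X (simple_reflection X i *\<^sub>v x) p = eps_coord X x (transpose i (i + 1) p)"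
  proof (cases X)
    case (Type_A n)
    then show ?thesis using x ir i p last by (auto simp: nc[unfolded Type_A] coroot_pairing_A transpose_def)
  next
    case (Type_B n)
    then show ?thesis using x ir i p last by (auto simp: nc[unfolded Type_B] coroot_pairing_B transpose_def)
  next
    case (Type_C n)
    then show ?thesis using x ir i p last by (auto simp: nc[unfolded Type_C] coroot_pairing_C transpose_def)
  next
    case (Type_D n)
    then show ?thesis using x ir i p last X
      by (auto simp: nc[unfolded Type_D] coroot_pairing_D transpose_def numeral_2_eq_2)
  qed (use X in auto)
  then show "eps_coord X (simple_reflection X i *\<^sub>v x) p = 1 * eps_coord X x (transpose i (i + 1) p)" by simp
qed

text \<open>Induction on b: (a, b + 1) is the conjugate of (a, b) by the adjacent transposition (b,
  b + 1).\<close>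

lemma signed_perm_weyl_transpose:
  assumes X: "classical X" and "1 \<le> a" "a < b" "b \<le> eps_dim X"
  shows "signed_perm_weyl X (transpose a b) (\<lambda>_. 1)"
proof -
  have "b \<le> eps_dim X \<longrightarrow> signed_perm_weyl X (transpose a b) (\<lambda>_. 1)"
    using Suc_leI[OF assms(3)]
  proof (induction b rule: dec_induct)
    case base
    then show ?case using signed_perm_weyl_adjacent[OF X, of a] assms by simp
  next
    case (step b)
    show ?case
    proof
      assume b: "Suc b \<le> eps_dim X"
      have adj: "signed_perm_weyl X (transpose b (Suc b)) (\<lambda>_. 1)"
        using signed_perm_weyl_adjacent[OF X, of b] b step by simp
      have "signed_perm_weyl X (transpose b (Suc b) \<circ> (transpose a b \<circ> transpose b (Suc b))) (\<lambda>p. 1 * 1 * 1)"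
        by (intro signed_perm_weyl_comp adj mp[OF step.IH])
          (use step.hyps(1) b assms(2) in \<open>auto simp: transpose_def\<close>)
      moreover have "transpose b (Suc b) \<circ> (transpose a b \<circ> transpose b (Suc b)) = transpose a (Suc b)"
        using step by (auto simp: fun_eq_iff transpose_def)
      ultimately show "signed_perm_weyl X (transpose a (Suc b)) (\<lambda>_. 1)" by simp
    qed
  qed
  then show ?thesis using assms by simp
qed

lemma signed_perm_weyl_permutes:
  assumes X: "classical X" and "\<pi> permutes {1..eps_dim X}"
  shows "signed_perm_weyl X \<pi> (\<lambda>_. 1)"
proof -
  have "finite {1..eps_dim X}" by simp
  then show ?thesis using assms(2)
  proof (induction rule: permutes_rev_induct)
    case id
    then show ?case by (rule signed_perm_weyl_id)
  next
    case (swap a b p)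
    have t: "signed_perm_weyl X (transpose a b) (\<lambda>_. 1)"
    proof (cases a b rule: linorder_cases)
      case equal
      then show ?thesis using signed_perm_weyl_id by simp
    next
      case less
      then show ?thesis using signed_perm_weyl_transpose[OF X] swap by auto
    next
      case greater
      then show ?thesis using signed_perm_weyl_transpose[OF X, of b a] swap by (auto simp: transpose_commute)
    qed
    have "signed_perm_weyl X (p \<circ> transpose a b) (\<lambda>q. 1 * 1)"
      using swap by (intro signed_perm_weyl_comp t) (auto simp: transpose_def)
    then show ?case by (rule signed_perm_weyl_cong) simp
  qed
qed

lemma signed_perm_weyl_conj:
  assumes "classical X" "signed_perm_weyl X id s" "\<pi> permutes {1..eps_dim X}"
  shows "signed_perm_weyl X id (s \<circ> \<pi>)"
proof -
  have in_dim: "\<pi> p \<in> {1..eps_dim X}" if "p \<in> {1..eps_dim X}" for p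
    using that permutes_in_image[OF assms(3)] by blast
  have first: "signed_perm_weyl X (id \<circ> \<pi>) (\<lambda>p. 1 * s (\<pi> p))"
    by (intro signed_perm_weyl_comp signed_perm_weyl_permutes assms in_dim)
  have "signed_perm_weyl X (inv_into UNIV \<pi> \<circ> (id \<circ> \<pi>)) (\<lambda>p. (1 * s (\<pi> p)) * 1)"
    by (rule signed_perm_weyl_comp[OF first signed_perm_weyl_permutes[OF assms(1) permutes_inv[OF assms(3)]]])
      (simp only: in_dim comp_apply id_apply)
  then show ?thesis by (rule signed_perm_weyl_cong) (simp add: permutes_inverses[OF assms(3)])
qed

lemma signed_perm_weyl_flip_last:
  assumes X: "X = Type_B n \<and> n \<ge> 2 \<or> X = Type_C n \<and> n \<ge> 1"
  shows "signed_perm_weyl X id (\<lambda>p. if p = n then - 1 else 1)"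
  unfolding signed_perm_weyl_def
proof (intro bexI[of _ "simple_reflection X n"] ballI)
  have nr: "n \<in> {1..rank X}" using X by auto
  then show "simple_reflection X n \<in> weyl X" by (rule simple_reflection_weyl)
  fix x :: "real vec" and p assume x: "x \<in> carrier_vec (rank X)" and p: "p \<in> {1..eps_dim X}"
  note nc = node_coord_simple_reflection[OF x nr]
  show "eps_coord X (simple_reflection X n *\<^sub>v x) p = (if p = n then - 1 else 1) * eps_coord X x (id p)"
    using X
  proof (elim disjE conjE)
    assume "X = Type_B n"
    then show ?thesis using x nr p by (auto simp: nc[unfolded \<open>X = Type_B n\<close>] coroot_pairing_B)
  next
    assume "X = Type_C n"
    then show ?thesis using x nr p by (auto simp: nc[unfolded \<open>X = Type_C n\<close>] coroot_pairing_C)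
  qed
qed

text \<open>The reflection in \<alpha>_n changes the sign of the last coordinate; conjugating by a
  transposition moves this to any position, and the positions are flipped one by one.\<close>

lemma signed_perm_weyl_flip_set:
  assumes X: "X = Type_B n \<and> n \<ge> 2 \<or> X = Type_C n \<and> n \<ge> 1" and "T \<subseteq> {1..n}"
  shows "signed_perm_weyl X id (\<lambda>p. if p \<in> T then - 1 else 1)"
proof -
  have dim: "eps_dim X = n" "classical X" using X by auto
  have "finite T" using assms(2) finite_subset by blast
  then show ?thesis using assms(2)
  proof (induction T)
    case empty
    show ?case by (rule signed_perm_weyl_cong[OF signed_perm_weyl_id]) simp
  next
    case (insert i T)
    have "transpose i n permutes {1..eps_dim X}" using insert dim by (intro permutes_swap_id) auto
    then have flip: "signed_perm_weyl X id ((\<lambda>p. if p = n then - 1 else 1) \<circ> transpose i n)"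
      by (intro signed_perm_weyl_conj signed_perm_weyl_flip_last X dim)
    have "signed_perm_weyl X (id \<circ> id)
        (\<lambda>p. ((\<lambda>p. if p = n then - 1 else 1) \<circ> transpose i n) p * (if id p \<in> T then - 1 else 1))"
      by (rule signed_perm_weyl_comp[OF flip insert.IH]) (use insert.prems in auto)
    then show ?case by (rule signed_perm_weyl_cong) (use insert.hyps in \<open>auto simp: transpose_def split: if_splits\<close>)
  qed
qed

text \<open>The reflection in \<epsilon>_(n-1) + \<epsilon>_n swaps the last two coordinates and
  negates both. Undoing the swap leaves two sign changes, and a permutation carries them to a and
  b.\<close>

lemma signed_perm_weyl_flip_pair:
  assumes n: "n \<ge> 3" and ab: "a \<in> {1..n}" "b \<in> {1..n}" "a \<noteq> b"
  shows "signed_perm_weyl (Type_D n) id (\<lambda>p. if p = a \<or> p = b then - 1 else 1)"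
proof -
  let ?X = "Type_D n"
  let ?s = "\<lambda>p. if p = n - 1 \<or> p = n then - 1 else (1::real)"
  have swap: "transpose (n - 1) n permutes {1..eps_dim ?X}" using n by (intro permutes_swap_id) auto
  have "signed_perm_weyl ?X (transpose (n - 1) n) ?s"
    unfolding signed_perm_weyl_def
  proof (intro bexI[of _ "simple_reflection ?X n"] ballI)
    have nr: "n \<in> {1..rank ?X}" using n by auto
    then show "simple_reflection ?X n \<in> weyl ?X" by (rule simple_reflection_weyl)
    fix x :: "real vec" and p assume x: "x \<in> carrier_vec (rank ?X)" and p: "p \<in> {1..eps_dim ?X}"
    have m: "n - 2 = n - 1 - 1" "n - 1 \<noteq> n" "n - 1 + 1 = n" using n by auto
    consider "p = n" | "p = n - 1" | "p + 1 < n" using p by force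
    then show "eps_coord ?X (simple_reflection ?X n *\<^sub>v x) p = ?s p * eps_coord ?X x (transpose (n - 1) n p)"
    proof cases
      case 1
      then show ?thesis using n x nr m by (simp add: node_coord_simple_reflection coroot_pairing_D)
    next
      case 2
      then show ?thesis using n x nr m by (simp add: node_coord_simple_reflection coroot_pairing_D)
    next
      case 3
      then show ?thesis using n x nr by (auto simp: node_coord_simple_reflection transpose_def)
    qed
  qed
  then have "signed_perm_weyl ?X (transpose (n - 1) n \<circ> transpose (n - 1) n) (\<lambda>p. ?s p * 1)"
    using signed_perm_weyl_permutes[OF _ swap] n permutes_in_image[OF swap]
    by (intro signed_perm_weyl_comp) auto
  then have flip: "signed_perm_weyl ?X id ?s" by (rule signed_perm_weyl_cong) auto
  \<comment> \<open>The place of b after a has been moved to n - 1; it differs from b when b = n -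
    1.\<close>
  define b' where "b' = transpose a (n - 1) b"
  define \<pi> where "\<pi> = transpose b' n \<circ> transpose a (n - 1)"
  have b': "b' \<noteq> n - 1" "b' \<in> {1..n}" using ab n by (auto simp: b'_def transpose_def)
  have \<pi>: "\<pi> permutes {1..eps_dim ?X}"
    unfolding \<pi>_def using ab b' n by (intro permutes_compose permutes_swap_id) auto
  have "\<pi> a = n - 1" "\<pi> b = n" using b' n unfolding \<pi>_def comp_apply b'_def[symmetric] by (simp_all add: transpose_def)
  then have "?s (\<pi> p) = (if p = a \<or> p = b then - 1 else 1)" for p
    using permutes_inj[OF \<pi>] by (metis injD)
  then have "?s \<circ> \<pi> = (\<lambda>p. if p = a \<or> p = b then - 1 else 1)" by (simp add: fun_eq_iff)
  then show ?thesis using signed_perm_weyl_conj[OF _ flip \<pi>] n by simp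
qed

text \<open>Sign changes in type D come in pairs. For odd n the positions 2, ..., n are even in
  number and can be paired off.\<close>

lemma signed_perm_weyl_flip_tail:
  assumes n: "n \<ge> 3" "odd n"
  shows "signed_perm_weyl (Type_D n) id (\<lambda>p. if p = 1 then 1 else - 1)"
proof -
  have "2 * j + 1 \<le> n \<longrightarrow> signed_perm_weyl (Type_D n) id (\<lambda>p. if 2 \<le> p \<and> p \<le> 2 * j + 1 then - 1 else 1)" for j
  proof (induction j)
    case 0
    then show ?case using signed_perm_weyl_id[of "Type_D n"] by (auto elim!: signed_perm_weyl_cong)
  next
    case (Suc j)
    show ?case
    proof
      assume j: "2 * Suc j + 1 \<le> n"
      have "signed_perm_weyl (Type_D n) (id \<circ> id) (\<lambda>p. (if 2 \<le> p \<and> p \<le> 2 * j + 1 then - 1 else 1)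
          * (if id p = 2 * j + 2 \<or> id p = 2 * j + 3 then - 1 else 1))"
        using Suc j n by (intro signed_perm_weyl_comp signed_perm_weyl_flip_pair) auto
      then show "signed_perm_weyl (Type_D n) id (\<lambda>p. if 2 \<le> p \<and> p \<le> 2 * Suc j + 1 then - 1 else 1)"
        by (rule signed_perm_weyl_cong) auto
    qed
  qed
  from this[of "(n - 1) div 2"] show ?thesis
    using n by (auto elim!: signed_perm_weyl_cong oddE)
qed

text \<open>Orthogonality to all \<epsilon>_p - \<epsilon>_(p+1) makes the orthogonal coordinates
  equal. Their common value is 0 because they sum to 0 in type A, and because of \<alpha>_n in types
  B, C, D.\<close>

lemma nondegenerate_classical:
  assumes X: "classical X"
  shows "nondegenerate_root_datum X"
proof
  fix x assume x: "x \<in> carrier_vec (rank X)" and "\<forall>i\<in>{1..rank X}. coroot_pairing X x i = 0"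
  then have zero: "coroot_pairing X x i = 0" if "i \<in> {1..rank X}" for i using that by blast
  have adj: "eps_coord X x (p + 1) = eps_coord X x p" if p: "1 \<le> p" "p < eps_dim X" for p
  proof (cases X)
    case (Type_A n)
    then show ?thesis using x zero[of p] p by (simp add: coroot_pairing_A)
  next
    case (Type_B n)
    then show ?thesis using x zero[of p] p by (simp add: coroot_pairing_B)
  next
    case (Type_C n)
    then show ?thesis using x zero[of p] p by (auto simp: coroot_pairing_C split: if_splits)
  next
    case (Type_D n)
    then show ?thesis using x zero[of p] p X by (auto simp: coroot_pairing_D numeral_2_eq_2 split: if_splits)
  qed (use X in auto)
  have const: "eps_coord X x p = eps_coord X x 1" if "p \<in> {1..eps_dim X}" for p
  proof -
    have "1 \<le> p" using that by simp
    then show ?thesis using that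
    proof (induction p rule: dec_induct)
      case (step q)
      then show ?case using adj[of q] by simp
    qed simp
  qed
  have "eps_coord X x 1 = 0"
  proof (cases X)
    case (Type_A n)
    have "node_coord x p = real p * eps_coord X x 1" if "p \<le> n + 1" for p
      using that
    proof (induction p)
      case (Suc p)
      then show ?case using const[of "Suc p"] Type_A by (simp add: algebra_simps)
    qed simp
    from this[of "n + 1"] show ?thesis using node_coord_Suc_dim[of x] x Type_A by simp
  next
    case (Type_B n)
    then show ?thesis using x zero[of n] const[of n] X by (simp add: coroot_pairing_B)
  next
    case (Type_C n)
    then show ?thesis using x zero[of n] const[of n] X by (simp add: coroot_pairing_C)
  next
    case (Type_D n)
    then have n: "n - 1 \<in> {1..eps_dim X}" "n \<in> {1..eps_dim X}" using X by auto
    have "eps_coord X x (n - 1) + eps_coord X x n = 2 * eps_coord X x 1"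
      using const[OF n(1)] const[OF n(2)] by linarith
    moreover obtain l where "n = l + 3" using X Type_D by (metis classical.simps(4) le_add_diff_inverse2)
    then have "eps_coord X x (n - 1) + eps_coord X x n = coroot_pairing X x n"
      using Type_D x by (simp add: coroot_pairing_D)
    moreover have "coroot_pairing X x n = 0" using zero[of n] X Type_D by simp
    ultimately show ?thesis by linarith
  qed (use X in auto)
  then show "x = 0\<^sub>v (rank X)" using const x by (intro eps_coord_eqI[OF X]) auto
qed

lemma eps_coord_uminus: "eps_coord X (- x) p = - eps_coord X x p"
  by (cases X) (auto simp: node_coord_minus)

lemma signed_perm_weyl_simple_current:
  assumes X: "classical X"
    and w: "signed_perm_weyl X \<pi> s"
    and p: "\<And>i. \<lbrakk>i \<in> {1..rank X}; i \<noteq> generator_node X\<rbrakk> \<Longrightarrow> p i \<in> {1..rank X}"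
    and roots: "\<And>i q. \<lbrakk>i \<in> {1..rank X}; i \<noteq> generator_node X; q \<in> {1..eps_dim X}\<rbrakk> \<Longrightarrow>
      s q * eps_coord X (simple_root X (p i)) (\<pi> q) = eps_coord X (simple_root X i) q"
    and high: "\<And>q. q \<in> {1..eps_dim X} \<Longrightarrow>
      s q * eps_coord X (highest_root X) (\<pi> q) = - eps_coord X (simple_root X (generator_node X)) q"
    and rest: "generator_node X \<in> {1..rank X}" "root_sqlen X (generator_node X) = 2"
      "(\<Sum>i<rank X. highest_root_coeff X (i + 1) * root_sqlen X (i + 1) / 2) = real (dual_coxeter X) - 1"
      "dual_coxeter X > 0" "N \<ge> 2" "\<sigma> 1 = generator_node X"
      "\<And>j. \<lbrakk>1 \<le> j; j < N\<rbrakk> \<Longrightarrow> \<sigma> j \<in> {1..rank X} \<and> highest_root_coeff X (\<sigma> j) * root_sqlen X (\<sigma> j) = 2"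
      "inj_on \<sigma> {1..<N}"
      "\<And>i j. \<lbrakk>1 \<le> j; j + 1 < N; i \<in> {1..rank X}; i \<noteq> generator_node X\<rbrakk> \<Longrightarrow> p i = \<sigma> j \<longleftrightarrow> i = \<sigma> (j + 1)"
      "\<And>i. \<lbrakk>i \<in> {1..rank X}; i \<noteq> generator_node X\<rbrakk> \<Longrightarrow> p i \<noteq> \<sigma> (N - 1)"
  shows "\<exists>w. simple_current X w p \<sigma> N"
proof -
  obtain w where w: "w \<in> weyl X" "\<And>x q. \<lbrakk>x \<in> carrier_vec (rank X); q \<in> {1..eps_dim X}\<rbrakk> \<Longrightarrow>
     eps_coord X (w *\<^sub>v x) q = s q * eps_coord X x (\<pi> q)"
    using w by (auto simp: signed_perm_weyl_def)
  have hc: "highest_root X \<in> carrier_vec (rank X)" by (simp add: highest_root_def)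
  interpret nondegenerate_root_datum X by (rule nondegenerate_classical[OF X])
  have "simple_current X w p \<sigma> N"
  proof (unfold_locales, goal_cases)
    case (2 i)
    have "w *\<^sub>v simple_root X (p i) = simple_root X i"
      using 2 w roots by (intro eps_coord_eqI[OF X]) auto
    then show ?case using 2 p by simp
  next
    case 3
    show ?case
      using w hc high by (intro eps_coord_eqI[OF X]) (auto simp: eps_coord_uminus)
  next
    case (10 j)
    then show ?case using rest by blast
  next
    case (12 j i)
    then show ?case using rest by blast
  next
    case (13 i)
    then show ?case using rest by blast
  qed (use w(1) rest in auto)
  then show ?thesis ..
qed

section \<open>Exceptional types\<close>

text \<open>Applying a word letter by letter to a vector lets rewriting work on coordinate lists
  instead of matrix products.\<close>

lemma weyl_foldr:
  assumes "set is \<subseteq> {1..rank X}"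
  obtains w where "w \<in> weyl X"
    "\<And>x. x \<in> carrier_vec (rank X) \<Longrightarrow> w *\<^sub>v x = foldr (\<lambda>i y. simple_reflection X i *\<^sub>v y) is x"
  using assms
proof (induction "is" arbitrary: thesis)
  case Nil
  show ?case by (rule Nil.prems(1)[OF weyl.one]) simp
next
  case (Cons i "is")
  obtain w where w: "w \<in> weyl X"
    "\<And>x. x \<in> carrier_vec (rank X) \<Longrightarrow> w *\<^sub>v x = foldr (\<lambda>i y. simple_reflection X i *\<^sub>v y) is x"
    using Cons.IH Cons.prems(2) by auto
  show ?case
    by (rule Cons.prems(1)[OF weyl.step[OF w(1), of i]]) (use w Cons.prems(2) in \<open>auto simp: weyl_step_mult_vec\<close>)
qed

lemma coroot_pairing_E6:
  assumes "x \<in> carrier_vec 6"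
  shows "coroot_pairing Type_E6 x 1 = 2 * node_coord x 1 - node_coord x 3"
    "coroot_pairing Type_E6 x 2 = 2 * node_coord x 2 - node_coord x 4"
    "coroot_pairing Type_E6 x 3 = 2 * node_coord x 3 - node_coord x 1 - node_coord x 4"
    "coroot_pairing Type_E6 x 4 = 2 * node_coord x 4 - node_coord x 2 - node_coord x 3 - node_coord x 5"
    "coroot_pairing Type_E6 x 5 = 2 * node_coord x 5 - node_coord x 4 - node_coord x 6"
    "coroot_pairing Type_E6 x 6 = 2 * node_coord x 6 - node_coord x 5"
  using assms
  by (subst coroot_pairing_node_coord[of _ _ _ "{1, 2, 3, 4, 5, 6}"]; auto simp: gram_entry_def)+

lemma coroot_pairing_E7:
  assumes "x \<in> carrier_vec 7"
  shows "coroot_pairing Type_E7 x 1 = 2 * node_coord x 1 - node_coord x 3"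
    "coroot_pairing Type_E7 x 2 = 2 * node_coord x 2 - node_coord x 4"
    "coroot_pairing Type_E7 x 3 = 2 * node_coord x 3 - node_coord x 1 - node_coord x 4"
    "coroot_pairing Type_E7 x 4 = 2 * node_coord x 4 - node_coord x 2 - node_coord x 3 - node_coord x 5"
    "coroot_pairing Type_E7 x 5 = 2 * node_coord x 5 - node_coord x 4 - node_coord x 6"
    "coroot_pairing Type_E7 x 6 = 2 * node_coord x 6 - node_coord x 5 - node_coord x 7"
    "coroot_pairing Type_E7 x 7 = 2 * node_coord x 7 - node_coord x 6"
  using assms
  by (subst coroot_pairing_node_coord[of _ _ _ "{1, 2, 3, 4, 5, 6, 7}"]; auto simp: gram_entry_def)+

definition node_vec :: "real list \<Rightarrow> real vec" where
  "node_vec xs = vec (length xs) (\<lambda>i. xs ! i)"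

lemma node_vec_closed: "length xs = n \<Longrightarrow> node_vec xs \<in> carrier_vec n"
  by (auto simp: node_vec_def)

lemma node_coord_node_vec:
  "node_coord (node_vec xs) j = (if 1 \<le> j \<and> j \<le> length xs then xs ! (j - 1) else 0)"
  by (auto simp: node_coord_def node_vec_def)

lemma simple_reflection_node_vec:
  assumes "length xs = rank X" "i \<in> {1..rank X}"
  shows "simple_reflection X i *\<^sub>v node_vec xs
    = node_vec (xs[i - 1 := xs ! (i - 1) - coroot_pairing X (node_vec xs) i])"
proof (rule node_coord_eqI[of _ "rank X"])
  fix j assume j: "j \<in> {1..rank X}"
  show "node_coord (simple_reflection X i *\<^sub>v node_vec xs) j
    = node_coord (node_vec (xs[i - 1 := xs ! (i - 1) - coroot_pairing X (node_vec xs) i])) j"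
    using assms j node_vec_closed[of xs "rank X"]
    by (auto simp: node_coord_simple_reflection node_coord_node_vec nth_list_update)
qed (use assms in \<open>simp_all add: node_vec_closed mult_mat_vec_carrier[OF simple_reflection_closed]\<close>)

lemma simple_reflection_E6:
  "simple_reflection Type_E6 1 *\<^sub>v node_vec [a, b, c, d, e, f] = node_vec [c - a, b, c, d, e, f]"
  "simple_reflection Type_E6 2 *\<^sub>v node_vec [a, b, c, d, e, f] = node_vec [a, d - b, c, d, e, f]"
  "simple_reflection Type_E6 3 *\<^sub>v node_vec [a, b, c, d, e, f] = node_vec [a, b, a + d - c, d, e, f]"
  "simple_reflection Type_E6 4 *\<^sub>v node_vec [a, b, c, d, e, f] = node_vec [a, b, c, b + c + e - d, e, f]"
  "simple_reflection Type_E6 5 *\<^sub>v node_vec [a, b, c, d, e, f] = node_vec [a, b, c, d, d + f - e, f]"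
  "simple_reflection Type_E6 6 *\<^sub>v node_vec [a, b, c, d, e, f] = node_vec [a, b, c, d, e, e - f]"
  using node_vec_closed[of "[a, b, c, d, e, f]" 6]
  by (simp_all add: simple_reflection_node_vec coroot_pairing_E6 node_coord_node_vec del: One_nat_def)
    (simp_all add: numeral_eq_Suc add.assoc)

lemma simple_reflection_E7:
  "simple_reflection Type_E7 1 *\<^sub>v node_vec [a, b, c, d, e, f, g] = node_vec [c - a, b, c, d, e, f, g]"
  "simple_reflection Type_E7 2 *\<^sub>v node_vec [a, b, c, d, e, f, g] = node_vec [a, d - b, c, d, e, f, g]"
  "simple_reflection Type_E7 3 *\<^sub>v node_vec [a, b, c, d, e, f, g] = node_vec [a, b, a + d - c, d, e, f, g]"
  "simple_reflection Type_E7 4 *\<^sub>v node_vec [a, b, c, d, e, f, g] = node_vec [a, b, c, b + c + e - d, e, f, g]"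
  "simple_reflection Type_E7 5 *\<^sub>v node_vec [a, b, c, d, e, f, g] = node_vec [a, b, c, d, d + f - e, f, g]"
  "simple_reflection Type_E7 6 *\<^sub>v node_vec [a, b, c, d, e, f, g] = node_vec [a, b, c, d, e, e + g - f, g]"
  "simple_reflection Type_E7 7 *\<^sub>v node_vec [a, b, c, d, e, f, g] = node_vec [a, b, c, d, e, f, f - g]"
  using node_vec_closed[of "[a, b, c, d, e, f, g]" 7]
  by (simp_all add: simple_reflection_node_vec coroot_pairing_E7 node_coord_node_vec del: One_nat_def)
    (simp_all add: numeral_eq_Suc add.assoc)

lemma node_vec_uminus: "- node_vec xs = node_vec (map uminus xs)"
  by (intro eq_vecI) (auto simp: node_vec_def)

lemma simple_root_E6:
  "simple_root Type_E6 1 = node_vec [1, 0, 0, 0, 0, 0]" "simple_root Type_E6 2 = node_vec [0, 1, 0, 0, 0, 0]"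
  "simple_root Type_E6 3 = node_vec [0, 0, 1, 0, 0, 0]" "simple_root Type_E6 4 = node_vec [0, 0, 0, 1, 0, 0]"
  "simple_root Type_E6 5 = node_vec [0, 0, 0, 0, 1, 0]" "simple_root Type_E6 6 = node_vec [0, 0, 0, 0, 0, 1]"
  by (auto intro!: eq_vecI simp: node_vec_def simple_root_def less_Suc_eq numeral_eq_Suc)

lemma highest_root_E6: "highest_root Type_E6 = node_vec [1, 2, 2, 3, 2, 1]"
  by (auto intro!: eq_vecI simp: node_vec_def highest_root_def)

lemma simple_root_E7:
  "simple_root Type_E7 1 = node_vec [1, 0, 0, 0, 0, 0, 0]" "simple_root Type_E7 2 = node_vec [0, 1, 0, 0, 0, 0, 0]"
  "simple_root Type_E7 3 = node_vec [0, 0, 1, 0, 0, 0, 0]" "simple_root Type_E7 4 = node_vec [0, 0, 0, 1, 0, 0, 0]"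
  "simple_root Type_E7 5 = node_vec [0, 0, 0, 0, 1, 0, 0]" "simple_root Type_E7 6 = node_vec [0, 0, 0, 0, 0, 1, 0]"
  "simple_root Type_E7 7 = node_vec [0, 0, 0, 0, 0, 0, 1]"
  by (auto intro!: eq_vecI simp: node_vec_def simple_root_def less_Suc_eq numeral_eq_Suc)

lemma highest_root_E7: "highest_root Type_E7 = node_vec [2, 2, 3, 4, 3, 2, 1]"
  by (auto intro!: eq_vecI simp: node_vec_def highest_root_def)

lemma atLeastAtMost_1_6: "{1..6::nat} = {1, 2, 3, 4, 5, 6}" by auto
lemma atLeastAtMost_1_7: "{1..7::nat} = {1, 2, 3, 4, 5, 6, 7}" by auto

lemma nondegenerate_E6: "nondegenerate_root_datum Type_E6"
proof
  fix x assume "x \<in> carrier_vec (rank Type_E6)" "\<forall>i\<in>{1..rank Type_E6}. coroot_pairing Type_E6 x i = 0"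
  then have x: "x \<in> carrier_vec 6" and z: "\<forall>i\<in>{1, 2, 3, 4, 5, 6}. coroot_pairing Type_E6 x i = 0"
    by (simp_all add: atLeastAtMost_1_6 del: One_nat_def)
  note eqs = z[unfolded ball_simps coroot_pairing_E6[OF x]]
  have "\<forall>j\<in>{1, 2, 3, 4, 5, 6}. node_coord x j = 0"
    unfolding ball_simps using eqs by (intro conjI TrueI; linarith)
  then have "x = 0\<^sub>v 6"
    by (intro node_coord_eqI[OF x]) (simp_all only: atLeastAtMost_1_6 node_coord_zero_vec zero_carrier_vec)
  then show "x = 0\<^sub>v (rank Type_E6)" by simp
qed

lemma nondegenerate_E7: "nondegenerate_root_datum Type_E7"
proof
  fix x assume "x \<in> carrier_vec (rank Type_E7)" "\<forall>i\<in>{1..rank Type_E7}. coroot_pairing Type_E7 x i = 0"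
  then have x: "x \<in> carrier_vec 7" and z: "\<forall>i\<in>{1, 2, 3, 4, 5, 6, 7}. coroot_pairing Type_E7 x i = 0"
    by (simp_all add: atLeastAtMost_1_7 del: One_nat_def)
  note eqs = z[unfolded ball_simps coroot_pairing_E7[OF x]]
  have "\<forall>j\<in>{1, 2, 3, 4, 5, 6, 7}. node_coord x j = 0"
    unfolding ball_simps using eqs by (intro conjI TrueI; linarith)
  then have "x = 0\<^sub>v 7"
    by (intro node_coord_eqI[OF x]) (simp_all only: atLeastAtMost_1_7 node_coord_zero_vec zero_carrier_vec)
  then show "x = 0\<^sub>v (rank Type_E7)" by simp
qed

text \<open>The words below are found by reflecting \<open>\<rho> - h\<^sup>\<or> \<lambda>\<^sub>c\<close>, which has to be \<open>w \<rho>\<close>, into the dominant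
  chamber.\<close>

lemma simple_current_E6:
  obtains w where "simple_current Type_E6 w (\<lambda>i. [1, 5, 2, 4, 3, 1] ! (i - 1)) (\<lambda>j. if j = 1 then 1 else 6) 3"
proof -
  \<comment> \<open>The rotation of order 3 of the extended diagram; the entry at node 1, the
    generator node, is a placeholder.\<close>
  let ?p = "\<lambda>i. [1, 5, 2, 4, 3, 1] ! (i - 1) :: nat"
  interpret nondegenerate_root_datum Type_E6 by (rule nondegenerate_E6)
  obtain w where w: "w \<in> weyl Type_E6" "\<And>x. x \<in> carrier_vec (rank Type_E6) \<Longrightarrow>
      w *\<^sub>v x = foldr (\<lambda>i y. simple_reflection Type_E6 i *\<^sub>v y) [1,3,4,2,5,4,3,1,6,5,4,2,3,4,5,6] x"
    by (rule weyl_foldr[of "[1,3,4,2,5,4,3,1,6,5,4,2,3,4,5,6]" Type_E6]) auto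
  have wl: "w *\<^sub>v node_vec xs
      = foldr (\<lambda>i y. simple_reflection Type_E6 i *\<^sub>v y) [1,3,4,2,5,4,3,1,6,5,4,2,3,4,5,6] (node_vec xs)"
    if "length xs = 6" for xs
    using w(2) node_vec_closed[OF that] by simp
  have roots: "?p i \<in> {1..6} \<and> w *\<^sub>v simple_root Type_E6 (?p i) = simple_root Type_E6 i" if "i \<in> {1..6}" "i \<noteq> 1" for i
  proof -
    have "i \<in> {2, 3, 4, 5, 6}" using that unfolding atLeastAtMost_1_6 by blast
    then show ?thesis
      by (elim insertE emptyE) (simp_all add: simple_root_E6 wl simple_reflection_E6 del: One_nat_def)
  qed
  have high: "w *\<^sub>v highest_root Type_E6 = - simple_root Type_E6 1"
    by (simp add: highest_root_E6 simple_root_E6 wl simple_reflection_E6 node_vec_uminus del: One_nat_def)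
  have "simple_current Type_E6 w ?p (\<lambda>j. if j = 1 then 1 else 6) 3"
  proof (unfold_locales, goal_cases)
    case (2 i)
    then show ?case using roots[of i] by (simp del: One_nat_def)
  next
    case 3
    show ?case using high by (simp del: One_nat_def)
  next
    case (12 j i)
    then show ?case unfolding rank.simps atLeastAtMost_1_6 by (auto simp del: One_nat_def)
  next
    case (13 i)
    then show ?case unfolding rank.simps atLeastAtMost_1_6 by (auto simp del: One_nat_def)
  qed (use w(1) in \<open>auto simp: inj_on_def lessThan_nat_numeral lessThan_Suc\<close>)
  then show ?thesis using that by blast
qed

lemma simple_current_E7:
  obtains w where "simple_current Type_E7 w (\<lambda>i. [6, 2, 5, 4, 3, 1, 7] ! (i - 1)) (\<lambda>j. 7) 2"
proof -
  \<comment> \<open>The flip of the extended diagram, exchanging 1 with 6, 3 with 5 and node 7 with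
    the affine node; the entry at 7 is a placeholder.\<close>
  let ?p = "\<lambda>i. [6, 2, 5, 4, 3, 1, 7] ! (i - 1) :: nat"
  let ?word = "[7,6,5,4,2,3,1,4,3,5,4,2,6,5,4,3,1,7,6,5,4,2,3,4,5,6,7] :: nat list"
  interpret nondegenerate_root_datum Type_E7 by (rule nondegenerate_E7)
  obtain w where w: "w \<in> weyl Type_E7" "\<And>x. x \<in> carrier_vec (rank Type_E7) \<Longrightarrow>
      w *\<^sub>v x = foldr (\<lambda>i y. simple_reflection Type_E7 i *\<^sub>v y) ?word x"
    by (rule weyl_foldr[of ?word Type_E7]) auto
  have wl: "w *\<^sub>v node_vec xs = foldr (\<lambda>i y. simple_reflection Type_E7 i *\<^sub>v y) ?word (node_vec xs)"
    if "length xs = 7" for xs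
    using w(2) node_vec_closed[OF that] by simp
  have roots: "?p i \<in> {1..7} \<and> w *\<^sub>v simple_root Type_E7 (?p i) = simple_root Type_E7 i" if "i \<in> {1..7}" "i \<noteq> 7" for i
  proof -
    have "i \<in> {1, 2, 3, 4, 5, 6}" using that unfolding atLeastAtMost_1_7 by blast
    then show ?thesis
      by (elim insertE emptyE) (simp_all add: simple_root_E7 wl simple_reflection_E7 del: One_nat_def)
  qed
  have high: "w *\<^sub>v highest_root Type_E7 = - simple_root Type_E7 7"
    by (simp add: highest_root_E7 simple_root_E7 wl simple_reflection_E7 node_vec_uminus del: One_nat_def)
  have "simple_current Type_E7 w ?p (\<lambda>j. 7) 2"
  proof (unfold_locales, goal_cases)
    case (2 i)
    then show ?case using roots[of i] by (simp del: One_nat_def)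
  next
    case 3
    show ?case using high by simp
  next
    case (13 i)
    then show ?case unfolding rank.simps atLeastAtMost_1_7 by (auto simp del: One_nat_def)
  qed (use w(1) in \<open>auto simp: inj_on_def lessThan_nat_numeral lessThan_Suc\<close>)
  then show ?thesis using that by blast
qed

section \<open>Generators of the groups of invertible objects\<close>

lemma permutes_involution:
  assumes "\<And>p. p \<in> S \<Longrightarrow> \<pi> p \<in> S" "\<And>p. p \<in> S \<Longrightarrow> \<pi> (\<pi> p) = p" "\<And>p. p \<notin> S \<Longrightarrow> \<pi> p = p"
  shows "\<pi> permutes S"
  using assms by (intro bij_imp_permutes bij_betw_byWitness[where f' = \<pi>]) auto

lemma eps_coord_simple_root_A:
  assumes "i \<in> {1..n}"
  shows "eps_coord (Type_A n) (simple_root (Type_A n) i) p = (if p = i then 1 else 0) - (if p = i + 1 then 1 else 0)"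
  using assms by (auto simp: node_coord_simple_root)

lemma eps_coord_simple_root_B:
  assumes "i \<in> {1..n}" "p \<le> n"
  shows "eps_coord (Type_B n) (simple_root (Type_B n) i) p
    = (if p = i then 1 else 0) - (if p = i + 1 then 1 else 0)"
  using assms by (auto simp: node_coord_simple_root)

lemma eps_coord_simple_root_C:
  assumes "i \<in> {1..n}" "p \<le> n"
  shows "eps_coord (Type_C n) (simple_root (Type_C n) i) p
    = (if i = n then if p = n then 2 else 0 else (if p = i then 1 else 0) - (if p = i + 1 then 1 else 0))"
  using assms by (auto simp: node_coord_simple_root)

lemma eps_coord_simple_root_D:
  assumes "i \<in> {1..n}" "p \<in> {1..n}" "n \<ge> 3"
  shows "eps_coord (Type_D n) (simple_root (Type_D n) i) p
    = (if i = n then if p = n \<or> p + 1 = n then 1 else 0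
       else (if p = i then 1 else 0) - (if p = i + 1 then 1 else 0))"
  using assms by (auto simp: node_coord_simple_root)

lemma eps_coord_highest_root_A:
  assumes "p \<in> {1..n + 1}" "n \<ge> 1"
  shows "eps_coord (Type_A n) (highest_root (Type_A n)) p = (if p = 1 then 1 else 0) - (if p = n + 1 then 1 else 0)"
  using assms by (auto simp: node_coord_highest_root)

lemma eps_coord_highest_root_B:
  assumes "p \<in> {1..n}" "n \<ge> 2"
  shows "eps_coord (Type_B n) (highest_root (Type_B n)) p = (if p \<le> 2 then 1 else 0)"
  using assms by (auto simp: node_coord_highest_root)

lemma eps_coord_highest_root_C:
  assumes "p \<in> {1..n}"
  shows "eps_coord (Type_C n) (highest_root (Type_C n)) p = (if p = 1 then 2 else 0)"
  using assms by (auto simp: node_coord_highest_root)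

lemma eps_coord_highest_root_D:
  assumes "p \<in> {1..n}" "n \<ge> 3"
  shows "eps_coord (Type_D n) (highest_root (Type_D n)) p = (if p \<le> 2 then 1 else 0)"
  using assms by (auto simp: node_coord_highest_root)

text \<open>\<open>w\<close> is the cyclic shift \<epsilon>_p to \<epsilon>_(p+1); it sends \<Theta>
  = \<epsilon>_1 - \<epsilon>_(n+1) to \<epsilon>_2 - \<epsilon>_1 = -\<alpha>_1.\<close>

lemma simple_current_A:
  assumes n: "n \<ge> 1"
  shows "\<exists>w. simple_current (Type_A n) w (\<lambda>i. i - 1) (\<lambda>j. j) (n + 1)"
proof -
  define \<pi> where "\<pi> = (\<lambda>p. if p \<in> {1..n + 1} then if p = 1 then n + 1 else p - 1 else p)"
  have \<pi>: "\<pi> permutes {1..eps_dim (Type_A n)}"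
    unfolding \<pi>_def
    by (intro bij_imp_permutes bij_betw_byWitness[where f' = "\<lambda>p. if p = n + 1 then 1 else p + 1"]) auto
  have c: "classical (Type_A n)" using n by simp
  show ?thesis
  proof (rule signed_perm_weyl_simple_current[OF c signed_perm_weyl_permutes[OF c \<pi>]], goal_cases)
    case (2 i q)
    then have i: "i - 1 \<in> {1..n}" "i \<in> {1..n}" by auto
    show ?case unfolding eps_coord_simple_root_A[OF i(1)] eps_coord_simple_root_A[OF i(2)]
      using 2 by (auto simp: \<pi>_def)
  next
    case (3 q)
    then have q: "\<pi> q \<in> {1..n + 1}" "1 \<in> {1..n}" using n by (auto simp: \<pi>_def)
    show ?case
      unfolding generator_node.simps eps_coord_highest_root_A[OF q(1) n] eps_coord_simple_root_A[OF q(2)]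
      using 3 n by (auto simp: \<pi>_def)
  qed (use n in \<open>auto simp: inj_on_def\<close>)
qed

text \<open>\<open>w\<close> negates \<epsilon>_1 alone, so \<Theta> = \<epsilon>_1 + \<epsilon>_2
  becomes -\<alpha>_1 and the other simple roots are fixed.\<close>

lemma simple_current_B:
  assumes n: "n \<ge> 2"
  shows "\<exists>w. simple_current (Type_B n) w (\<lambda>i. i) (\<lambda>j. 1) 2"
proof -
  have c: "classical (Type_B n)" using n by simp
  have sp: "signed_perm_weyl (Type_B n) id (\<lambda>p. if p \<in> {1} then - 1 else 1)"
    using n by (intro signed_perm_weyl_flip_set[where n = n]) auto
  have "(\<Sum>i<n. highest_root_coeff (Type_B n) (i + 1) * root_sqlen (Type_B n) (i + 1) / 2)
      = (\<Sum>i<n. 2 - (if i = 0 then 1 else 0) - (if i = n - 1 then 1 else 0))"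
    using n by (intro sum.cong) auto
  then have s: "(\<Sum>i<n. highest_root_coeff (Type_B n) (i + 1) * root_sqlen (Type_B n) (i + 1) / 2) = real (2 * n - 1) - 1"
    using n by (simp add: sum_subtractf of_nat_diff)
  show ?thesis
  proof (rule signed_perm_weyl_simple_current[OF c sp], goal_cases)
    case (2 i q)
    then show ?case by (auto simp: eps_coord_simple_root_B simp del: eps_coord.simps)
  next
    case (3 q)
    then show ?case using n
      by (auto simp: eps_coord_simple_root_B eps_coord_highest_root_B simp del: eps_coord.simps)
  next
    case 6
    show ?case using s by simp
  qed (use n in \<open>auto simp: inj_on_def\<close>)
qed

text \<open>\<open>w\<close> reverses the coordinates and negates all of them: \<Theta> = 2
  \<epsilon>_1 becomes -2 \<epsilon>_n = -\<alpha>_n.\<close>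

lemma simple_current_C:
  assumes n: "n \<ge> 1"
  shows "\<exists>w. simple_current (Type_C n) w (\<lambda>i. n - i) (\<lambda>j. n) 2"
proof -
  have c: "classical (Type_C n)" using n by simp
  define \<pi> where "\<pi> = (\<lambda>p. if p \<in> {1..n} then n + 1 - p else p)"
  have \<pi>: "\<pi> permutes {1..eps_dim (Type_C n)}"
    unfolding \<pi>_def by (rule permutes_involution) auto
  have flip: "signed_perm_weyl (Type_C n) id (\<lambda>p. if p \<in> {1..n} then - 1 else 1)"
    using n by (intro signed_perm_weyl_flip_set[where n = n]) auto
  have "signed_perm_weyl (Type_C n) (\<pi> \<circ> id) (\<lambda>p. (if p \<in> {1..n} then - 1 else 1) * 1)"
    by (rule signed_perm_weyl_comp[OF flip signed_perm_weyl_permutes[OF c \<pi>]]) auto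
  then have sp: "signed_perm_weyl (Type_C n) \<pi> (\<lambda>_. - 1)" by (rule signed_perm_weyl_cong) simp
  have "(\<Sum>i<n. highest_root_coeff (Type_C n) (i + 1) * root_sqlen (Type_C n) (i + 1) / 2) = (\<Sum>i<n. 1)"
    by (intro sum.cong) auto
  then have s: "(\<Sum>i<n. highest_root_coeff (Type_C n) (i + 1) * root_sqlen (Type_C n) (i + 1) / 2) = real (n + 1) - 1"
    by simp
  show ?thesis
  proof (rule signed_perm_weyl_simple_current[OF c sp], goal_cases)
    case (2 i q)
    then have i: "n - i \<in> {1..n}" "i \<in> {1..n}" "\<pi> q \<le> n" "q \<le> n" by (auto simp: \<pi>_def)
    have "\<pi> q = n - i \<longleftrightarrow> q = i + 1" "\<pi> q = n - i + 1 \<longleftrightarrow> q = i" "n - i \<noteq> n" "i \<noteq> n"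
      using 2 by (auto simp: \<pi>_def)
    then show ?case unfolding eps_coord_simple_root_C[OF i(1,3)] eps_coord_simple_root_C[OF i(2,4)] by simp
  next
    case (3 q)
    then have q: "\<pi> q \<in> {1..n}" by (auto simp: \<pi>_def)
    show ?case unfolding eps_coord_highest_root_C[OF q] using 3 n
      by (auto simp: \<pi>_def eps_coord_simple_root_C simp del: eps_coord.simps)
  next
    case 6
    show ?case using s by simp
  qed (use n in \<open>auto simp: inj_on_def\<close>)
qed

text \<open>\<open>w\<close> sends \<epsilon>_n to \<epsilon>_1 and every other \<epsilon>_p to
  -\<epsilon>_(n+1-p), an even number of sign changes since n is odd. The affine node runs through
  n, 1, n - 1 and back, whence order 4.\<close>

lemma simple_current_D:
  assumes n: "n \<ge> 3" "odd n"
  shows "\<exists>w. simple_current (Type_D n) w (\<lambda>i. if i = 1 then n else n - i)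
    (\<lambda>j. if j = 1 then n else if j = 2 then 1 else n - 1) 4"
proof -
  have c: "classical (Type_D n)" using n by simp
  define \<pi> where "\<pi> = (\<lambda>p. if p \<in> {1..n} then n + 1 - p else p)"
  have \<pi>: "\<pi> permutes {1..eps_dim (Type_D n)}"
    unfolding \<pi>_def by (rule permutes_involution) auto
  have "signed_perm_weyl (Type_D n) (\<pi> \<circ> id) (\<lambda>p. (if p = 1 then 1 else - 1) * 1)"
    by (rule signed_perm_weyl_comp[OF signed_perm_weyl_flip_tail[OF n] signed_perm_weyl_permutes[OF c \<pi>]]) auto
  then have sp: "signed_perm_weyl (Type_D n) \<pi> (\<lambda>p. if p = 1 then 1 else - 1)" by (rule signed_perm_weyl_cong) simp
  have "(\<Sum>i<n. highest_root_coeff (Type_D n) (i + 1) * root_sqlen (Type_D n) (i + 1) / 2)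
      = (\<Sum>i<n. 2 - (if i = 0 then 1 else 0) - (if i = n - 2 then 1 else 0) - (if i = n - 1 then 1 else 0))"
    using n by (intro sum.cong) auto
  then have s: "(\<Sum>i<n. highest_root_coeff (Type_D n) (i + 1) * root_sqlen (Type_D n) (i + 1) / 2) = real (2 * n - 2) - 1"
    using n by (simp add: sum_subtractf of_nat_diff)
  show ?thesis
  proof (rule signed_perm_weyl_simple_current[OF c sp], goal_cases)
    case (2 i q)
    then have i: "(if i = 1 then n else n - i) \<in> {1..n}" "\<pi> q \<in> {1..n}" "i \<in> {1..n}" "q \<in> {1..n}"
      using n by (auto simp: \<pi>_def)
    have "\<pi> q = n - i \<longleftrightarrow> q = i + 1" "\<pi> q = n - i + 1 \<longleftrightarrow> q = i" "n - i \<noteq> n" "i \<noteq> n"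
      "\<pi> q = n \<longleftrightarrow> q = 1" "\<pi> q + 1 = n \<longleftrightarrow> q = 2" "1 \<le> i"
      using 2 n by (auto simp: \<pi>_def)
    then show ?case unfolding eps_coord_simple_root_D[OF i(1,2) n(1)] eps_coord_simple_root_D[OF i(3,4) n(1)]
      by (cases "i = 1"; cases "q = 1") simp_all
  next
    case (3 q)
    then have q: "\<pi> q \<in> {1..n}" by (auto simp: \<pi>_def)
    show ?case unfolding eps_coord_highest_root_D[OF q n(1)] using 3 n
      by (auto simp: \<pi>_def eps_coord_simple_root_D simp del: eps_coord.simps)
  next
    case 6
    show ?case using s by simp
  next
    case (10 j)
    then show ?case using n by auto
  next
    case (12 i j)
    then have "j = 1 \<or> j = 2" "i \<in> {1..n}" "i \<noteq> n" by auto
    then show ?case using n by (cases "i = 1") auto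
  next
    case (13 i)
    then show ?case using n by auto
  qed (use n in \<open>auto simp: inj_on_def\<close>)
qed

text \<open>The twists of the invertible objects are those of the pre-metric group \<open>\<int>/N\<close> with
  \<open>q(j) = exp (\<pi> i K j (N - j) / N)\<close>, for a multiple \<open>K\<close> of the level. In type D the
  spinor weight has \<open>\<langle>\<lambda>\<^sub>n, \<lambda>\<^sub>n\<rangle> = n / 4\<close>, and the multiplier \<open>3 n\<close> is chosen so that \<open>j = 1\<close> gives
  \<open>9 n / 4\<close>, congruent to \<open>n / 4\<close> modulo 2.\<close>

fun center_order :: "cartan_type \<Rightarrow> nat" where
  "center_order (Type_A n) = n + 1"
| "center_order (Type_B n) = 2"
| "center_order (Type_C n) = 2"
| "center_order (Type_D n) = 4"
| "center_order Type_E6 = 3"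
| "center_order Type_E7 = 2"

fun twist_multiplier :: "cartan_type \<Rightarrow> nat" where
  "twist_multiplier (Type_A n) = 1"
| "twist_multiplier (Type_B n) = 2"
| "twist_multiplier (Type_C n) = n"
| "twist_multiplier (Type_D n) = 3 * n"
| "twist_multiplier Type_E6 = 2"
| "twist_multiplier Type_E7 = 3"

lemma cis_pi_cong:
  assumes "t = s + 2 * real n"
  shows "cis (pi * s) = cis (pi * t)"
proof -
  have "cis (pi * t) = cis (pi * s) * cis (2 * pi * real n)"
    unfolding assms cis_mult by (simp add: algebra_simps)
  also have "cis (2 * pi * real n) = 1" by (rule cis_multiple_2pi) simp
  finally show ?thesis by simp
qed

section \<open>The generating fundamental weight in simple root coordinates\<close>

lemma fund_weight_A:
  assumes "n \<ge> 1"
  shows "fund_weight (Type_A n) 1 = vec n (\<lambda>i. (real n - real i) / (real n + 1))"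
proof -
  interpret nondegenerate_root_datum "Type_A n" using assms by (intro nondegenerate_classical) simp
  define x where "x = vec n (\<lambda>i. (real n - real i) / (real n + 1))"
  have x: "x \<in> carrier_vec n" by (simp add: x_def)
  show ?thesis
    unfolding x_def[symmetric]
  proof (rule fund_weight_eqI)
    fix j assume j: "j \<in> {1..rank (Type_A n)}"
    define d where "d = real n + 1"
    have d: "d \<noteq> 0" by (simp add: d_def)
    have c: "node_coord x i = (if i = 0 then 0 else (d - real i) / d)" if "i \<le> n + 1" for i
      using that by (auto simp: x_def d_def node_coord_def of_nat_diff)
    obtain l where l: "j = Suc l" "l < n" using j by (cases j) auto
    show "coroot_pairing (Type_A n) x j = (if j = 1 then 1 else 0)"
      using j l d by (simp add: coroot_pairing_A[OF x] c) (simp add: field_simps)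
  qed (use x in simp)
qed

lemma fund_weight_B:
  assumes "n \<ge> 2"
  shows "fund_weight (Type_B n) 1 = vec n (\<lambda>_. 1)"
proof -
  interpret nondegenerate_root_datum "Type_B n" using assms by (intro nondegenerate_classical) simp
  show ?thesis
  proof (rule fund_weight_eqI)
    fix j assume j: "j \<in> {1..rank (Type_B n)}"
    show "coroot_pairing (Type_B n) (vec n (\<lambda>_. 1)) j = (if j = 1 then 1 else 0)"
      using j assms by (auto simp: coroot_pairing_B node_coord_def)
  qed simp
qed

lemma fund_weight_C:
  assumes "n \<ge> 1"
  shows "fund_weight (Type_C n) n = vec n (\<lambda>i. if i + 1 = n then real n / 2 else real (i + 1))"
proof -
  interpret nondegenerate_root_datum "Type_C n" using assms by (intro nondegenerate_classical) simp
  define x where "x = vec n (\<lambda>i. if i + 1 = n then real n / 2 else real (i + 1))"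
  have x: "x \<in> carrier_vec n" by (simp add: x_def)
  show ?thesis
    unfolding x_def[symmetric]
  proof (rule fund_weight_eqI)
    fix j assume j: "j \<in> {1..rank (Type_C n)}"
    have c: "node_coord x i = (if i = n then real n / 2 else real i)" if "i \<le> n" for i
      using that assms by (auto simp: x_def node_coord_def)
    show "coroot_pairing (Type_C n) x j = (if j = n then 1 else 0)"
    proof -
      obtain l where l: "j = Suc l" "l < n" using j by (cases j) auto
      then show ?thesis using j by (auto simp: coroot_pairing_C[OF x] c)
    qed
  qed (use x in simp)
qed

lemma fund_weight_D:
  assumes "n \<ge> 3"
  shows "fund_weight (Type_D n) n
    = vec n (\<lambda>i. if i + 1 = n then real n / 4 else if i + 2 = n then (real n - 2) / 4 else real (i + 1) / 2)"
proof -
  interpret nondegenerate_root_datum "Type_D n" using assms by (intro nondegenerate_classical) simp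
  define x where "x = vec n (\<lambda>i. if i + 1 = n then real n / 4 else if i + 2 = n then (real n - 2) / 4 else real (i + 1) / 2)"
  have x: "x \<in> carrier_vec n" by (simp add: x_def)
  show ?thesis
    unfolding x_def[symmetric]
  proof (rule fund_weight_eqI)
    fix j assume j: "j \<in> {1..rank (Type_D n)}"
    have c: "node_coord x i = (if i = n then real n / 4 else if i + 1 = n then (real n - 2) / 4 else real i / 2)"
      if "i \<le> n" for i
      using that assms by (auto simp: x_def node_coord_def)
    have "j = n \<or> j + 1 = n \<or> j + 2 = n \<or> j + 2 < n" using j by auto
    show "coroot_pairing (Type_D n) x j = (if j = n then 1 else 0)"
    proof -
      obtain l where l: "j = Suc l" "l < n" using j by (cases j) auto
      obtain r where r: "n = r + 3" using assms by (metis le_add_diff_inverse2)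
      from \<open>j = n \<or> j + 1 = n \<or> j + 2 = n \<or> j + 2 < n\<close> show ?thesis
        unfolding coroot_pairing_D[OF x j[unfolded rank.simps] assms]
        using l r by (elim disjE) (simp_all add: c field_simps)
    qed
  qed (use x in simp)
qed

lemma fund_weight_E6: "fund_weight Type_E6 1 = node_vec [4/3, 1, 5/3, 2, 4/3, 2/3]"
proof -
  interpret nondegenerate_root_datum Type_E6 by (rule nondegenerate_E6)
  show ?thesis
  proof (rule fund_weight_eqI)
    fix j assume "j \<in> {1..rank Type_E6}"
    then have "j \<in> {1, 2, 3, 4, 5, 6}" unfolding rank.simps atLeastAtMost_1_6 .
    then show "coroot_pairing Type_E6 (node_vec [4/3, 1, 5/3, 2, 4/3, 2/3]) j = (if j = 1 then 1 else 0)"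
      by (elim insertE emptyE)
        (simp_all add: coroot_pairing_E6 node_vec_closed node_coord_node_vec del: One_nat_def)
  qed (simp add: node_vec_closed)
qed

lemma fund_weight_E7: "fund_weight Type_E7 7 = node_vec [1, 3/2, 2, 3, 5/2, 2, 3/2]"
proof -
  interpret nondegenerate_root_datum Type_E7 by (rule nondegenerate_E7)
  show ?thesis
  proof (rule fund_weight_eqI)
    fix j assume "j \<in> {1..rank Type_E7}"
    then have "j \<in> {1, 2, 3, 4, 5, 6, 7}" unfolding rank.simps atLeastAtMost_1_7 .
    then show "coroot_pairing Type_E7 (node_vec [1, 3/2, 2, 3, 5/2, 2, 3/2]) j = (if j = 7 then 1 else 0)"
      by (elim insertE emptyE)
        (simp_all add: coroot_pairing_E7 node_vec_closed node_coord_node_vec del: One_nat_def)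
  qed (simp add: node_vec_closed)
qed

context
  fixes k :: nat and A :: "real vec monoid"
  assumes k: "k \<ge> 1"
begin

abbreviation cyclic_invertibles :: "cartan_type \<Rightarrow> bool" where
  "cyclic_invertibles X \<equiv> is_invertible_group X k A \<and> carrier A = range (\<lambda>j::nat. generator X k [^]\<^bsub>A\<^esub> j)"

lemma cyclic_premetric_A:
  assumes "n \<ge> 1" "cyclic_invertibles (Type_A n)"
  shows "cyclic_premetric A (generator (Type_A n) k) (twist (Type_A n) k) (n + 1) k"
proof -
  obtain w where "simple_current (Type_A n) w (\<lambda>i. i - 1) (\<lambda>j. j) (n + 1)"
    using simple_current_A[OF assms(1)] by blast
  then interpret simple_current "Type_A n" w "\<lambda>i. i - 1" "\<lambda>j. j" "n + 1" .
  have wt: "kform (Type_A n) (fund_weight (Type_A n) i) (fund_weight (Type_A n) 1) = (real n + 1 - real i) / (real n + 1)"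
    if "i \<in> {1..n}" for i
  proof -
    have i: "i \<in> {1..rank (Type_A n)}" using that by simp
    show ?thesis
      unfolding kform_fund_weight[OF i fund_weight_closed] unfolding fund_weight_A[OF assms(1)]
      using that by (auto simp: of_nat_diff)
  qed
  show ?thesis
  proof (rule cyclic_premetric[OF k, where f = "\<lambda>j. real j * (real (n + 1) - real j) / real (n + 1)"])
    fix j assume "j + 1 < n + 1"
    then show "real (j + 1) * (real (n + 1) - real (j + 1)) / real (n + 1)
      = real j * (real (n + 1) - real j) / real (n + 1)
        + 2 * kform (Type_A n) (fund_weight (Type_A n) (j + 1)) (fund_weight (Type_A n) (generator_node (Type_A n)))
        - kform (Type_A n) (fund_weight (Type_A n) (generator_node (Type_A n)))
            (fund_weight (Type_A n) (generator_node (Type_A n)))"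
      using assms(1) wt[of "j + 1"] wt[of 1] unfolding generator_node.simps by (simp add: field_simps)
  qed (use assms in \<open>auto simp: mult.assoc\<close>)
qed

lemma cyclic_premetric_B:
  assumes "n \<ge> 2" "cyclic_invertibles (Type_B n)"
  shows "cyclic_premetric A (generator (Type_B n) k) (twist (Type_B n) k) 2 (2 * k)"
proof -
  obtain w where "simple_current (Type_B n) w (\<lambda>i. i) (\<lambda>j. 1) 2"
    using simple_current_B[OF assms(1)] by blast
  then interpret simple_current "Type_B n" w "\<lambda>i. i" "\<lambda>j. 1" 2 .
  have wt: "kform (Type_B n) (fund_weight (Type_B n) 1) (fund_weight (Type_B n) 1) = 1"
    unfolding kform_fund_weight[OF generator_node(1)[unfolded generator_node.simps] fund_weight_closed]
    using assms(1) by (simp add: fund_weight_B[unfolded One_nat_def])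
  show ?thesis
  proof (rule cyclic_premetric[OF k, where f = real])
    fix j :: nat assume "j < 2"
    then show "cis (pi * (real k * real j)) = cis (pi * real (2 * k) * (real j * (real 2 - real j) / real 2))"
      by (auto simp: less_2_cases_iff)
  qed (use assms wt in auto)
qed

lemma cyclic_premetric_C:
  assumes "n \<ge> 1" "cyclic_invertibles (Type_C n)"
  shows "cyclic_premetric A (generator (Type_C n) k) (twist (Type_C n) k) 2 (n * k)"
proof -
  obtain w where "simple_current (Type_C n) w (\<lambda>i. n - i) (\<lambda>j. n) 2"
    using simple_current_C[OF assms(1)] by blast
  then interpret simple_current "Type_C n" w "\<lambda>i. n - i" "\<lambda>j. n" 2 .
  have wt: "kform (Type_C n) (fund_weight (Type_C n) n) (fund_weight (Type_C n) n) = real n / 2"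
    unfolding kform_fund_weight[OF generator_node(1)[unfolded generator_node.simps] fund_weight_closed]
    using assms(1) by (simp add: fund_weight_C)
  show ?thesis
  proof (rule cyclic_premetric[OF k, where f = "\<lambda>j. real j * real n / 2"])
    fix j :: nat assume "j < 2"
    then show "cis (pi * (real k * (real j * real n / 2))) = cis (pi * real (n * k) * (real j * (real 2 - real j) / real 2))"
      by (auto simp: less_2_cases_iff mult_ac)
  qed (use assms wt in auto)
qed

lemma cyclic_premetric_D:
  assumes n: "n \<ge> 3" "odd n" and "cyclic_invertibles (Type_D n)"
  shows "cyclic_premetric A (generator (Type_D n) k) (twist (Type_D n) k) 4 (3 * n * k)"
proof -
  obtain w where "simple_current (Type_D n) w (\<lambda>i. if i = 1 then n else n - i)
    (\<lambda>j. if j = 1 then n else if j = 2 then 1 else n - 1) 4"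
    using simple_current_D[OF n] by blast
  then interpret simple_current "Type_D n" w "\<lambda>i. if i = 1 then n else n - i"
    "\<lambda>j. if j = 1 then n else if j = 2 then 1 else n - 1" 4 .
  have wt: "kform (Type_D n) (fund_weight (Type_D n) i) (fund_weight (Type_D n) n)
      = (if i = n then real n / 4 else if i + 1 = n then (real n - 2) / 4 else real i / 2)"
    if i: "i \<in> {1..n}" for i
  proof -
    have i': "i \<in> {1..rank (Type_D n)}" using i by simp
    show ?thesis
      unfolding kform_fund_weight[OF i' fund_weight_closed] unfolding fund_weight_D[OF n(1)]
      using i n by auto
  qed
  have wt': "kform (Type_D n) (fund_weight (Type_D n) n) (fund_weight (Type_D n) n) = real n / 4"
    "kform (Type_D n) (fund_weight (Type_D n) 1) (fund_weight (Type_D n) n) = 1 / 2"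
    "kform (Type_D n) (fund_weight (Type_D n) (n - 1)) (fund_weight (Type_D n) n) = (real n - 2) / 4"
    using n wt[of n] wt[of 1] wt[of "n - 1"] by auto
  show ?thesis
  proof (rule cyclic_premetric[OF k, where f = "\<lambda>j. if j = 0 then 0 else if j = 2 then 1 else real n / 4"])
    fix j :: nat assume j: "j + 1 < 4"
    then have "j = 0 \<or> j = 1 \<or> j = 2" by auto
    then show "(if j + 1 = 0 then 0 else if j + 1 = 2 then 1 else real n / 4)
      = (if j = 0 then 0 else if j = 2 then 1 else real n / 4)
        + 2 * kform (Type_D n) (fund_weight (Type_D n) (if j + 1 = 1 then n else if j + 1 = 2 then 1 else n - 1))
            (fund_weight (Type_D n) (generator_node (Type_D n)))
        - kform (Type_D n) (fund_weight (Type_D n) (generator_node (Type_D n)))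
            (fund_weight (Type_D n) (generator_node (Type_D n)))"
      using wt' by (auto simp: field_simps)
  next
    fix j :: nat assume "j < 4"
    then consider "j = 0" | "j = 1 \<or> j = 3" | "j = 2" by force
    then show "cis (pi * (real k * (if j = 0 then 0 else if j = 2 then 1 else real n / 4)))
        = cis (pi * real (3 * n * k) * (real j * (real 4 - real j) / real 4))"
    proof cases
      case 2
      then show ?thesis
        \<comment> \<open>The exponents are n k / 4 and 9 n k / 4.\<close>
        unfolding mult.assoc[of pi] by (intro cis_pi_cong[of _ _ "n * k"]) (auto simp: field_simps)
    next
      case 3
      \<comment> \<open>The exponents are k and 3 n k; their difference k (3 n - 1) is even because
        n is odd.\<close>
      obtain l where "n = 2 * l + 1" using n(2) by (elim oddE)
      then show ?thesis
        unfolding mult.assoc[of pi] using 3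
        by (intro cis_pi_cong[of _ _ "k * (3 * l + 1)"]) (auto simp: field_simps)
    qed simp
  qed (use assms in auto)
qed

lemma cyclic_premetric_E6:
  assumes "cyclic_invertibles Type_E6"
  shows "cyclic_premetric A (generator Type_E6 k) (twist Type_E6 k) 3 (2 * k)"
proof -
  obtain w where "simple_current Type_E6 w (\<lambda>i. [1, 5, 2, 4, 3, 1] ! (i - 1)) (\<lambda>j. if j = 1 then 1 else 6) 3"
    by (rule simple_current_E6)
  then interpret simple_current Type_E6 w "\<lambda>i. [1, 5, 2, 4, 3, 1] ! (i - 1)" "\<lambda>j. if j = 1 then 1 else 6" 3 .
  have wt: "kform Type_E6 (fund_weight Type_E6 1) (fund_weight Type_E6 1) = 4 / 3"
    "kform Type_E6 (fund_weight Type_E6 6) (fund_weight Type_E6 1) = 2 / 3"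
    using kform_fund_weight[OF _ fund_weight_closed, of 1 1] kform_fund_weight[OF _ fund_weight_closed, of 6 1]
    by (simp_all add: fund_weight_E6 node_vec_def del: One_nat_def)
  show ?thesis
  proof (rule cyclic_premetric[OF k, where f = "\<lambda>j. if j = 0 then 0 else 4 / 3"])
    fix j :: nat assume "j < 3"
    then have "j = 0 \<or> j = 1 \<or> j = 2" by auto
    then show "cis (pi * (real k * (if j = 0 then 0 else 4 / 3)))
        = cis (pi * real (2 * k) * (real j * (real 3 - real j) / real 3))"
      by (auto simp: mult_ac)
  qed (use assms wt in \<open>auto simp del: One_nat_def\<close>)
qed

lemma cyclic_premetric_E7:
  assumes "cyclic_invertibles Type_E7"
  shows "cyclic_premetric A (generator Type_E7 k) (twist Type_E7 k) 2 (3 * k)"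
proof -
  obtain w where "simple_current Type_E7 w (\<lambda>i. [6, 2, 5, 4, 3, 1, 7] ! (i - 1)) (\<lambda>j. 7) 2"
    by (rule simple_current_E7)
  then interpret simple_current Type_E7 w "\<lambda>i. [6, 2, 5, 4, 3, 1, 7] ! (i - 1)" "\<lambda>j. 7" 2 .
  have wt: "kform Type_E7 (fund_weight Type_E7 7) (fund_weight Type_E7 7) = 3 / 2"
    using kform_fund_weight[OF _ fund_weight_closed, of 7 7] by (simp add: fund_weight_E7 node_vec_def)
  show ?thesis
  proof (rule cyclic_premetric[OF k, where f = "\<lambda>j. real j * (3 / 2)"])
    fix j :: nat assume "j < 2"
    then show "cis (pi * (real k * (real j * (3 / 2)))) = cis (pi * real (3 * k) * (real j * (real 2 - real j) / real 2))"
      by (auto simp: less_2_cases_iff mult_ac)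
  qed (use assms wt in auto)
qed

end

section \<open>The table\<close>

lemma cyclic_premetric_listed:
  assumes "k \<ge> 1" "listed_category X k" "is_invertible_group X k A"
    and "carrier A = range (\<lambda>j::nat. generator X k [^]\<^bsub>A\<^esub> j)"
  shows "cyclic_premetric A (generator X k) (twist X k) (center_order X) (twist_multiplier X * k)"
proof (cases X)
  case (Type_A n)
  then show ?thesis using cyclic_premetric_A[of k n A] assms by simp
next
  case (Type_B n)
  then show ?thesis using cyclic_premetric_B[of k n A] assms by simp
next
  case (Type_C n)
  then show ?thesis using cyclic_premetric_C[of k n A] assms by simp
next
  case (Type_D n)
  then show ?thesis using cyclic_premetric_D[of k n A] assms by simp
next
  case Type_E6
  then show ?thesis using cyclic_premetric_E6[of k A] assms by simp
next
  case Type_E7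
  then show ?thesis using cyclic_premetric_E7[of k A] assms by simp
qed

lemma less_4_cases: "(a::nat) < 4 \<longleftrightarrow> a = 0 \<or> a = 1 \<or> a = 2 \<or> a = 3"
  by auto

lemma less_3_cases: "(a::nat) < 3 \<longleftrightarrow> a = 0 \<or> a = 1 \<or> a = 2"
  by auto

text \<open>Modulo 2 the term 2 b disappears, so the condition is a = \<epsilon> a and both values
  of b occur with every admissible a.\<close>

lemma rows_order_2:
  fixes \<epsilon> :: "nat \<Rightarrow> nat"
  assumes "\<forall>a<2. \<epsilon> a = (if P \<and> a = 1 then 1 else 0)"
    and "\<forall>a<2. \<forall>b<2. braided a b \<longleftrightarrow> [a = \<epsilon> a + 2 * b] (mod 2)"
  shows "{(a, b). a < 2 \<and> b < (2::nat) \<and> \<epsilon> a = 1 \<and> braided a b} = (if P then {(1,0), (1,1)} else {})"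
    "{(a, b). a < 2 \<and> b < (2::nat) \<and> \<epsilon> a = 0 \<and> braided a b} = {(0,0), (0,1)}"
  using assms by (auto simp: less_2_cases_iff cong_def split: if_splits)

theorem theorem5p5:
  fixes X :: cartan_type and k :: nat and A :: "real vec monoid"
    and q :: "real vec \<Rightarrow> complex" and g :: "real vec" and \<zeta> :: complex
    and N m :: nat and \<epsilon> :: "nat \<Rightarrow> nat"
    and braided :: "nat \<Rightarrow> nat \<Rightarrow> bool" and row :: "nat \<Rightarrow> (nat \<times> nat) set"
  assumes "k \<ge> 1"
    and "listed_category X k"
    and "is_invertible_group X k A"
    and "g = generator X k"
    and "carrier A = range (\<lambda>j::nat. g [^]\<^bsub>A\<^esub> j)"
    and "q = twist X k"
    and "N = card (carrier A)"
    and "m = card (radical A q)"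
    and "\<zeta>\<^sup>2 = xi A"
    and "\<epsilon> = eps A q g"
    and "braided = cyc_braided A q g \<zeta>"
    and "row = (\<lambda>e. {(a, b). a < m \<and> b < N \<and> \<epsilon> a = e \<and> braided a b})"
  shows "(\<forall>a<m. \<forall>b<N. braided a b \<longleftrightarrow> [a * (N div m) = \<epsilon> a + 2 * b] (mod N)) \<and>
    (\<forall>n. X = Type_A n \<longrightarrow>
       m = gcd (n + 1) k \<and> N = n + 1 \<and>
       (\<forall>a<m.
          if even (gcd (n + 1) k) \<and> odd ((n + 1) div gcd (n + 1) k) \<and> odd a
               \<and> odd (k div gcd (n + 1) k)
          then \<epsilon> a = 1 \<and>
            (\<forall>b<N. braided a b \<longleftrightarrow> [a * ((n + 1) div gcd (n + 1) k) = 1 + 2 * b] (mod (n + 1)))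
          else \<epsilon> a = 0 \<and>
            (\<forall>b<N. braided a b \<longleftrightarrow> [a * ((n + 1) div gcd (n + 1) k) = 2 * b] (mod (n + 1))))) \<and>
    (X = Type_E6 \<longrightarrow>
       m = 3 \<and> N = 3 \<and> (\<forall>a<m. \<epsilon> a = 0) \<and> row 0 = {(0,0), (1,2), (2,1)}) \<and>
    (\<forall>n. X = Type_B n \<longrightarrow>
       m = 2 \<and> N = 2 \<and>
       (\<forall>a<m. \<epsilon> a = (if odd k \<and> a = 1 then 1 else 0)) \<and>
       row 1 = (if odd k then {(1,0), (1,1)} else {}) \<and>
       row 0 = {(0,0), (0,1)}) \<and>
    (\<forall>n. X = Type_C n \<longrightarrow>
       m = 2 \<and> N = 2 \<and>
       (\<forall>a<m. \<epsilon> a = (if odd n \<and> odd (k div 2) \<and> a = 1 then 1 else 0)) \<and>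
       row 1 = (if odd n \<and> odd (k div 2) then {(1,0), (1,1)} else {}) \<and>
       row 0 = {(0,0), (0,1)}) \<and>
    (X = Type_E7 \<longrightarrow>
       m = 2 \<and> N = 2 \<and>
       (\<forall>a<m. \<epsilon> a = (if odd (k div 2) \<and> a = 1 then 1 else 0)) \<and>
       row 1 = (if odd (k div 2) then {(1,0), (1,1)} else {}) \<and>
       row 0 = {(0,0), (0,1)}) \<and>
    (\<forall>n. X = Type_D n \<and> \<not> 4 dvd k \<longrightarrow>
       m = 2 \<and> N = 4 \<and> (\<forall>a<m. \<epsilon> a = 0) \<and>
       row 0 = {(0,0), (0,2), (1,1), (1,3)}) \<and>
    (\<forall>n. X = Type_D n \<and> 4 dvd k \<longrightarrow>
       m = 4 \<and> N = 4 \<and>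
       (\<forall>a<m. \<epsilon> a = (if odd (k div 4) \<and> odd a then 1 else 0)) \<and>
       row 1 = (if odd (k div 4) then {(1,0), (1,2), (3,1), (3,3)} else {}) \<and>
       row 0 = {(0,0), (0,2), (2,1), (2,3)})"
proof -
  define K where "K = twist_multiplier X * k"
  interpret Z: cyclic_premetric A g q "center_order X" K
    unfolding K_def assms(4,6) by (rule cyclic_premetric_listed[OF assms(1,2,3) assms(5)[unfolded assms(4)]])
  have N: "N = center_order X" using assms(7) Z.card_carrier by simp
  have m: "m = gcd N K" using assms(8) Z.card_radical N by simp
  have eps: "\<epsilon> a = (if even m \<and> odd (K div m) \<and> odd (N div m) \<and> odd a then 1 else 0)" if "a < m" for a
    using Z.eps_eq[of a] that unfolding assms(10) m N by simp
  have br: "braided a b \<longleftrightarrow> [a * (N div m) = \<epsilon> a + 2 * b] (mod N)" if "a < m" for a b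
    using Z.cyc_braided_iff[OF assms(9), of a b] that unfolding assms(10,11) m N by simp
  have row: "row e = {(a, b). a < m \<and> b < N \<and> \<epsilon> a = e \<and> braided a b}" for e
    unfolding assms(12) ..
  have row_cong: "row e = {(a, b). a < m \<and> b < N \<and> \<epsilon> a = e \<and> [a * (N div m) = e + 2 * b] (mod N)}" for e
    unfolding row using br by auto
  have order_2: "(\<forall>a<m. \<epsilon> a = (if P \<and> a = 1 then 1 else 0)) \<and>
      row 1 = (if P then {(1,0), (1,1)} else {}) \<and> row 0 = {(0,0), (0,1)}"
    if "m = 2" "N = 2" "odd (K div 2) \<longleftrightarrow> P" for P
  proof -
    have e: "\<forall>a<2. \<epsilon> a = (if P \<and> a = 1 then 1 else 0)"
      using eps that by (auto simp: less_2_cases_iff)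
    have b: "\<forall>a<2. \<forall>b<2. braided a b \<longleftrightarrow> [a = \<epsilon> a + 2 * b] (mod 2)" using br that by simp
    show ?thesis unfolding row that(1,2) using e rows_order_2[OF e b] by blast
  qed
  show ?thesis
  proof (intro conjI[OF _ conjI[OF _ conjI[OF _ conjI[OF _ conjI[OF _ conjI[OF _ conjI]]]]]] allI impI)
    fix a b assume "a < m"
    then show "braided a b \<longleftrightarrow> [a * (N div m) = \<epsilon> a + 2 * b] (mod N)" by (rule br)
  next
    fix n assume X: "X = Type_A n"
    have "K = k" "N = n + 1" "m = gcd (n + 1) k" using X m N by (simp_all add: K_def)
    then show "m = gcd (n + 1) k \<and> N = n + 1 \<and>
       (\<forall>a<m.
          if even (gcd (n + 1) k) \<and> odd ((n + 1) div gcd (n + 1) k) \<and> odd a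
               \<and> odd (k div gcd (n + 1) k)
          then \<epsilon> a = 1 \<and>
            (\<forall>b<N. braided a b \<longleftrightarrow> [a * ((n + 1) div gcd (n + 1) k) = 1 + 2 * b] (mod (n + 1)))
          else \<epsilon> a = 0 \<and>
            (\<forall>b<N. braided a b \<longleftrightarrow> [a * ((n + 1) div gcd (n + 1) k) = 2 * b] (mod (n + 1))))"
      using eps br by simp
  next
    assume X: "X = Type_E6"
    then have "3 dvd k" using assms(2) by simp
    then have mN: "m = 3" "N = 3" using X m N by (auto simp: K_def gcd_nat.absorb1)
    \<comment> \<open>Odd m excludes the sign.\<close>
    have e: "\<forall>a<3. \<epsilon> a = 0" using eps mN by simp
    have b: "\<forall>a<3. \<forall>b<3. braided a b \<longleftrightarrow> [a = 2 * b] (mod 3)" using br e mN by simp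
    have "row 0 = {(a, b). a < 3 \<and> b < 3 \<and> [a = 2 * b] (mod 3)}"
      unfolding row mN using e b by auto
    also have "\<dots> = {(0,0), (1,2), (2,1)}" by (auto simp: less_3_cases cong_def)
    finally have "row 0 = {(0,0), (1,2), (2,1)}" .
    then show "m = 3 \<and> N = 3 \<and> (\<forall>a<m. \<epsilon> a = 0) \<and> row 0 = {(0,0), (1,2), (2,1)}" using e mN by simp
  next
    fix n assume X: "X = Type_B n"
    then have mN: "m = 2" "N = 2" and odd: "odd (K div 2) \<longleftrightarrow> odd k" using m N by (simp_all add: K_def)
    from order_2[OF mN odd] mN show "m = 2 \<and> N = 2 \<and> (\<forall>a<m. \<epsilon> a = (if odd k \<and> a = 1 then 1 else 0)) \<and>
       row 1 = (if odd k then {(1,0), (1,1)} else {}) \<and> row 0 = {(0,0), (0,1)}"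
      by (intro conjI) simp_all
  next
    fix n assume X: "X = Type_C n"
    then have k: "even k" using assms(2) by simp
    then have mN: "m = 2" "N = 2" using X m N by (simp_all add: K_def gcd_nat.absorb1)
    \<comment> \<open>Here q(g) = exp(\<pi> i n k / 2), which is -1 exactly when n and k / 2 are
      both odd.\<close>
    have "K div 2 = n * (k div 2)" using X k by (simp add: K_def div_mult_swap)
    then have "odd (K div 2) \<longleftrightarrow> odd n \<and> odd (k div 2)" by simp
    from order_2[OF mN this] mN show "m = 2 \<and> N = 2 \<and>
       (\<forall>a<m. \<epsilon> a = (if odd n \<and> odd (k div 2) \<and> a = 1 then 1 else 0)) \<and>
       row 1 = (if odd n \<and> odd (k div 2) then {(1,0), (1,1)} else {}) \<and> row 0 = {(0,0), (0,1)}"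
      by (intro conjI) simp_all
  next
    assume X: "X = Type_E7"
    then have k: "even k" using assms(2) by simp
    then have mN: "m = 2" "N = 2" using X m N by (simp_all add: K_def gcd_nat.absorb1)
    have "K div 2 = 3 * (k div 2)" using X k by (simp add: K_def div_mult_swap)
    then have "odd (K div 2) \<longleftrightarrow> odd (k div 2)" by simp
    from order_2[OF mN this] mN show "m = 2 \<and> N = 2 \<and> (\<forall>a<m. \<epsilon> a = (if odd (k div 2) \<and> a = 1 then 1 else 0)) \<and>
       row 1 = (if odd (k div 2) then {(1,0), (1,1)} else {}) \<and> row 0 = {(0,0), (0,1)}"
      by (intro conjI) simp_all
  next
    fix n assume X: "X = Type_D n \<and> \<not> 4 dvd k"
    then have k: "even k" "odd n" using assms(2) by auto
    then obtain l where l: "k = 2 * l" "odd l" using X by (auto elim!: evenE)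
    have "gcd 4 (3 * n * k) = 2 * gcd 2 (3 * n * l)"
      using gcd_mult_distrib_nat[of 2 2 "3 * n * l"] l(1) by (simp add: mult_ac)
    moreover have "coprime 2 (3 * n * l)" using k l by simp
    ultimately have mN: "m = 2" "N = 4" using X m N by (simp_all add: K_def)
    \<comment> \<open>The index N / m = 2 is even, which excludes the sign; the condition then reads
      2 a = 2 b modulo 4, that is, a and b have equal parity.\<close>
    have e: "\<forall>a<2. \<epsilon> a = 0" using eps mN by simp
    have b: "\<forall>a<2. \<forall>b<4. braided a b \<longleftrightarrow> [a * 2 = 2 * b] (mod 4)" using br e mN by simp
    have "row 0 = {(a, b). a < 2 \<and> b < 4 \<and> [a * 2 = 2 * b] (mod 4)}"
      unfolding row mN using e b by auto
    also have "\<dots> = {(0,0), (0,2), (1,1), (1,3)}" by (auto simp: less_2_cases_iff less_4_cases cong_def)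
    finally have "row 0 = {(0,0), (0,2), (1,1), (1,3)}" .
    then show "m = 2 \<and> N = 4 \<and> (\<forall>a<m. \<epsilon> a = 0) \<and> row 0 = {(0,0), (0,2), (1,1), (1,3)}"
      using e mN by simp
  next
    fix n assume X: "X = Type_D n \<and> 4 dvd k"
    then have k: "4 dvd k" "odd n" using assms(2) by auto
    then have mN: "m = 4" "N = 4" using X m N by (auto simp: K_def gcd_nat.absorb1)
    have "K div 4 = 3 * n * (k div 4)" using X k by (simp add: K_def div_mult_swap)
    \<comment> \<open>The odd factor 3 n does not affect the parity.\<close>
    then have "odd (K div 4) \<longleftrightarrow> odd (k div 4)" using k by simp
    then have e: "\<forall>a<4. \<epsilon> a = (if odd (k div 4) \<and> odd a then 1 else 0)" using eps mN by simp
    then have e': "\<epsilon> a = 1 \<longleftrightarrow> odd (k div 4) \<and> odd a" "\<epsilon> a = 0 \<longleftrightarrow> \<not> (odd (k div 4) \<and> odd a)"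
      if "a < 4" for a using that by simp_all
    have "row 1 = {(a, b). a < 4 \<and> b < 4 \<and> (odd (k div 4) \<and> odd a) \<and> [a = 1 + 2 * b] (mod 4)}"
      unfolding row_cong mN using e'(1) by auto
    also have "\<dots> = (if odd (k div 4) then {(1,0), (1,2), (3,1), (3,3)} else {})"
      by (auto simp: less_4_cases cong_def)
    finally have row_1: "row 1 = (if odd (k div 4) then {(1,0), (1,2), (3,1), (3,3)} else {})" .
    have "row 0 = {(a, b). a < 4 \<and> b < 4 \<and> \<not> (odd (k div 4) \<and> odd a) \<and> [a = 2 * b] (mod 4)}"
      unfolding row_cong mN using e'(2) by auto
    also have "\<dots> = {(0,0), (0,2), (2,1), (2,3)}" by (auto simp: less_4_cases cong_def)
    finally have "row 0 = {(0,0), (0,2), (2,1), (2,3)}" .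
    with row_1 show "m = 4 \<and> N = 4 \<and> (\<forall>a<m. \<epsilon> a = (if odd (k div 4) \<and> odd a then 1 else 0)) \<and>
       row 1 = (if odd (k div 4) then {(1,0), (1,2), (3,1), (3,3)} else {}) \<and>
       row 0 = {(0,0), (0,2), (2,1), (2,3)}"
      using e mN by simp
  qed
qed

end
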